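(* Let $F$ be a holomorphic function in a neighborhood of the circle $\mathbb{T}+1$ with $F(0)=0$. Then there is a function $K$ such that $F(\mathcal{C}_+)=\mathcal{H}_{K+}$ and the following conditions hold: (a) $K(u)=0$ for a.e. $u<0$; (b) $K(u)u^{-\frac12}\in L^1(\mathbb{R}_+)$; (c) $(\mathcal{M}K)(z)=F(z^{-1})$ for all $z\in\mathbb{C}$ with $\mathrm{Re}(z)=\frac12$. Conversely, if a function $K$ satisfies conditions (a), (b), and (c), where $F$ is holomorphic in some neighborhood of $\mathbb{T}+1$, then $F(0)=0$ and $\mathcal{H}_{K+}=F(\mathcal{C}_+)$.
   Context: $\mathbb{T}$ is the unit circle in $\mathbb{C}$ and $\mathbb{T}+1=\{z\in\mathbb{C}:|z-1|=1\}$; $\mathbb{R}_+=(0,\infty)$. $\mathcal{C}_+$ is the Cesàro operator in $L^2(\mathbb{R}_+)$, $(\mathcal{C}_+f)(x)=\frac1x\int_0^x f(t)\,dt=\int_0^1 f(ux)\,du$; its spectrum is $\mathbb{T}+1$, and $F(\mathcal{C}_+)$ is defined by the holomorphic (Riesz–Dunford) functional calculus. For a measurable $K$ on $\mathbb{R}$ with $K(u)|u|^{-1/2}\in L^1(\mathbb{R})$, $\mathcal{H}_K$ is the bounded operator in $L^2(\mathbb{R})$ given by $(\mathcal{H}_Kf)(x)=\int_{\mathbb{R}}K(u)f(ux)\,du$; when $K$ is supported in $\mathbb{R}_+$, it leaves $L^2(\mathbb{R}_+)$ (viewed as a subspace of $L^2(\mathbb{R})$ via extension by zero) invariant, and $\mathcal{H}_{K+}$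 denotes its restriction to $L^2(\mathbb{R}_+)$. The Mellin transform is $(\mathcal{M}K)(z)=\int_{(0,+\infty)}K(u)u^{z-1}\,du$. *)

theory Defs
  imports "HOL-Complex_Analysis.Complex_Analysis"
begin

section \<open>Complex normed spaces and the holomorphic functional calculus\<close>

class complex_normed_vector = real_normed_vector +
  fixes scaleC :: "complex \<Rightarrow> 'a \<Rightarrow> 'a"  (infixr "*\<^sub>C" 75)
  assumes scaleC_add_right: "a *\<^sub>C (x + y) = a *\<^sub>C x + a *\<^sub>C y"
    and scaleC_add_left: "(a + b) *\<^sub>C x = a *\<^sub>C x + b *\<^sub>C x"
    and scaleC_scaleC: "a *\<^sub>C b *\<^sub>C x = (a * b) *\<^sub>C x"
    and scaleC_of_real: "complex_of_real r *\<^sub>C x = r *\<^sub>R x"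
    and norm_scaleC: "norm (a *\<^sub>C x) = cmod a * norm x"

lift_definition scalar_op :: "complex \<Rightarrow> 'a::complex_normed_vector \<Rightarrow>\<^sub>L 'a" is "\<lambda>c x. c *\<^sub>C x"
proof -
  fix c
  show "bounded_linear (\<lambda>x::'a. c *\<^sub>C x)"
  proof (rule bounded_linear_intro)
    fix r and x :: 'a
    show "c *\<^sub>C r *\<^sub>R x = r *\<^sub>R c *\<^sub>C x"
      by (simp add: scaleC_scaleC mult.commute flip: scaleC_of_real)
    show "norm (c *\<^sub>C x) \<le> norm x * cmod c"
      by (simp add: norm_scaleC mult.commute)
  qed (rule scaleC_add_right)
qed

text \<open>
  The type of bounded operators consists of the real-linear ones.  This makes no difference here:
  an inverse of a complex-linear operator is again complex-linear, so for complex-linear \<open>A\<close> the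
  definitions below give the usual spectrum and the usual resolvent \<open>inverse (z - A)\<close>.
\<close>

definition op_inverses :: "('a::real_normed_vector \<Rightarrow>\<^sub>L 'a) \<Rightarrow> ('a \<Rightarrow>\<^sub>L 'a) \<Rightarrow> bool" where
  "op_inverses A R \<longleftrightarrow> A o\<^sub>L R = id_blinfun \<and> R o\<^sub>L A = id_blinfun"

definition spectrum :: "('a::complex_normed_vector \<Rightarrow>\<^sub>L 'a) \<Rightarrow> complex set" where
  "spectrum A = {z. \<nexists>R. op_inverses (scalar_op z - A) R}"

definition resolvent :: "('a::complex_normed_vector \<Rightarrow>\<^sub>L 'a) \<Rightarrow> complex \<Rightarrow> ('a \<Rightarrow>\<^sub>L 'a)" where
  "resolvent A z = (THE R. op_inverses (scalar_op z - A) R)"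

text \<open>
  A cycle, i.e. a finite family of closed piecewise \<open>C\<^sup>1\<close> curves, that lies in \<open>U - S\<close>, winds once
  around each point of \<open>S\<close> and does not wind around any point outside \<open>U\<close>.  A single curve would
  not do: if \<open>S\<close> is a circle and \<open>U\<close> an annulus, two curves are needed.
\<close>

definition encircling_cycle ::
    "complex set \<Rightarrow> complex set \<Rightarrow> (real \<Rightarrow> complex) list \<Rightarrow> bool" where
  "encircling_cycle U S \<Gamma> \<longleftrightarrow>
     (\<forall>\<gamma>\<in>set \<Gamma>. valid_path \<gamma> \<and> pathfinish \<gamma> = pathstart \<gamma> \<and> path_image \<gamma> \<subseteq> U - S) \<and>
     (\<forall>w\<in>S. (\<Sum>\<gamma>\<leftarrow>\<Gamma>. winding_number \<gamma> w) = 1) \<and>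
     (\<forall>w. w \<notin> U \<longrightarrow> (\<Sum>\<gamma>\<leftarrow>\<Gamma>. winding_number \<gamma> w) = 0)"

text \<open>
  The contour integral of \<open>F(z) inverse (z - A)\<close> along a curve, as an integral in the space of
  bounded operators with the operator norm; compare \<open>has_contour_integral_def\<close>.
\<close>

definition resolvent_integral ::
    "(complex \<Rightarrow> complex) \<Rightarrow> ('a::complex_normed_vector \<Rightarrow>\<^sub>L 'a) \<Rightarrow> (real \<Rightarrow> complex) \<Rightarrow> ('a \<Rightarrow>\<^sub>L 'a)"
  where
  "resolvent_integral F A \<gamma> =
     integral {0..1} (\<lambda>t. scalar_op (F (\<gamma> t) * vector_derivative \<gamma> (at t within {0..1}))
                          o\<^sub>L resolvent A (\<gamma> t))"

text \<open>
  \<open>F(A)\<close> for \<open>F\<close> holomorphic on the open set \<open>U\<close> containing the spectrum of \<open>A\<close>; by Cauchy's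
  theorem the value does not depend on the cycle.
\<close>

definition holomorphic_calculus ::
    "complex set \<Rightarrow> (complex \<Rightarrow> complex) \<Rightarrow> ('a::complex_normed_vector \<Rightarrow>\<^sub>L 'a) \<Rightarrow> ('a \<Rightarrow>\<^sub>L 'a)"
  where
  "holomorphic_calculus U F A =
     (let \<Gamma> = (SOME \<Gamma>. encircling_cycle U (spectrum A) \<Gamma>)
      in scalar_op (1 / (2 * of_real pi * \<i>)) o\<^sub>L (\<Sum>\<gamma>\<leftarrow>\<Gamma>. resolvent_integral F A \<gamma>))"


section \<open>The space \<open>L\<^sup>2\<close> of the line\<close>

definition square_integrable :: "(real \<Rightarrow> complex) \<Rightarrow> bool" where
  "square_integrable f \<longleftrightarrow>
     f \<in> borel_measurable lebesgue \<and> integrable lebesgue (\<lambda>x. (cmod (f x))\<^sup>2)"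

definition l2_eq :: "(real \<Rightarrow> complex) \<Rightarrow> (real \<Rightarrow> complex) \<Rightarrow> bool" where
  "l2_eq f g \<longleftrightarrow> square_integrable f \<and> square_integrable g \<and> (AE x in lebesgue. f x = g x)"

lemma square_integrable_zero: "square_integrable (\<lambda>x. 0)"
  by (simp add: square_integrable_def)

lemma square_integrable_scale:
  assumes "square_integrable f"
  shows "square_integrable (\<lambda>x. c * f x)"
  using assms by (auto simp: square_integrable_def norm_mult power_mult_distrib)

lemma cmod_add_squared_le: "(cmod (a + b))\<^sup>2 \<le> 2 * (cmod a)\<^sup>2 + 2 * (cmod b)\<^sup>2"
proof -
  have "(cmod (a + b))\<^sup>2 \<le> (cmod a + cmod b)\<^sup>2"
    by (simp add: norm_triangle_ineq power_mono)
  also have "\<dots> \<le> 2 * (cmod a)\<^sup>2 + 2 * (cmod b)\<^sup>2"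
    using sum_squares_bound[of "cmod a" "cmod b"] by (simp add: power2_sum)
  finally show ?thesis .
qed

lemma square_integrable_add:
  assumes "square_integrable f" "square_integrable g"
  shows "square_integrable (\<lambda>x. f x + g x)"
proof -
  have [measurable]: "f \<in> borel_measurable lebesgue" "g \<in> borel_measurable lebesgue"
    using assms by (auto simp: square_integrable_def)
  have "integrable lebesgue (\<lambda>x. (cmod (f x + g x))\<^sup>2)"
  proof (rule Bochner_Integration.integrable_bound)
    show "integrable lebesgue (\<lambda>x. 2 * (cmod (f x))\<^sup>2 + 2 * (cmod (g x))\<^sup>2)"
      using assms by (auto simp: square_integrable_def)
    show "AE x in lebesgue. norm ((cmod (f x + g x))\<^sup>2) \<le> norm (2 * (cmod (f x))\<^sup>2 + 2 * (cmod (g x))\<^sup>2)"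
      using cmod_add_squared_le by (intro AE_I2) simp
  qed measurable
  then show ?thesis
    by (simp add: square_integrable_def)
qed

lemma square_integrable_uminus: "square_integrable f \<Longrightarrow> square_integrable (\<lambda>x. - f x)"
  using square_integrable_scale[of f "-1"] by simp

lemma square_integrable_diff:
  "square_integrable f \<Longrightarrow> square_integrable g \<Longrightarrow> square_integrable (\<lambda>x. f x - g x)"
  using square_integrable_add[of f "\<lambda>x. - g x"] square_integrable_uminus[of g] by simp

definition l2_norm_fun :: "(real \<Rightarrow> complex) \<Rightarrow> real" where
  "l2_norm_fun f = sqrt (LINT x|lebesgue. (cmod (f x))\<^sup>2)"

lemma l2_norm_fun_nonneg: "0 \<le> l2_norm_fun f"
  by (simp add: l2_norm_fun_def)

lemma l2_norm_fun_power2: "(l2_norm_fun f)\<^sup>2 = (LINT x|lebesgue. (cmod (f x))\<^sup>2)"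
  by (simp add: l2_norm_fun_def)

lemma l2_norm_fun_eq_0:
  assumes "square_integrable f"
  shows "l2_norm_fun f = 0 \<longleftrightarrow> (AE x in lebesgue. f x = 0)"
  using assms integral_nonneg_eq_0_iff_AE[of lebesgue "\<lambda>x. (cmod (f x))\<^sup>2"]
  by (simp add: l2_norm_fun_def square_integrable_def)

lemma l2_norm_fun_cong:
  assumes "l2_eq f g"
  shows "l2_norm_fun f = l2_norm_fun g"
proof -
  have [measurable]: "f \<in> borel_measurable lebesgue" "g \<in> borel_measurable lebesgue"
    and eq: "AE x in lebesgue. f x = g x"
    using assms by (simp_all add: l2_eq_def square_integrable_def)
  from eq have "AE x in lebesgue. (cmod (f x))\<^sup>2 = (cmod (g x))\<^sup>2"
    by eventually_elim simp
  then have "(LINT x|lebesgue. (cmod (f x))\<^sup>2) = (LINT x|lebesgue. (cmod (g x))\<^sup>2)"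
    by (rule integral_cong_AE[rotated 2]) measurable
  then show ?thesis
    by (simp add: l2_norm_fun_def)
qed

lemma l2_norm_fun_scale: "l2_norm_fun (\<lambda>x. c * f x) = cmod c * l2_norm_fun f"
  by (simp add: l2_norm_fun_def norm_mult power_mult_distrib real_sqrt_mult)

lemma weighted_cmod_add_squared_le:
  assumes "0 < a" "0 < b"
  shows "(cmod (z + w))\<^sup>2 \<le> (1 + b / a) * (cmod z)\<^sup>2 + (1 + a / b) * (cmod w)\<^sup>2"
proof -
  have "0 \<le> (b * cmod z - a * cmod w)\<^sup>2 / (a * b)"
    using assms by simp
  also have "\<dots> = (b * cmod z)\<^sup>2 / (a * b) + (a * cmod w)\<^sup>2 / (a * b)
      - 2 * (b * cmod z) * (a * cmod w) / (a * b)"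
    by (simp add: power2_diff add_divide_distrib diff_divide_distrib)
  also have "\<dots> = b / a * (cmod z)\<^sup>2 + a / b * (cmod w)\<^sup>2 - 2 * cmod z * cmod w"
    using assms by (simp add: power2_eq_square mult.commute mult.left_commute)
  finally have "(cmod z + cmod w)\<^sup>2 \<le> (1 + b / a) * (cmod z)\<^sup>2 + (1 + a / b) * (cmod w)\<^sup>2"
    by (simp add: power2_sum algebra_simps)
  moreover have "(cmod (z + w))\<^sup>2 \<le> (cmod z + cmod w)\<^sup>2"
    by (simp add: norm_triangle_ineq power_mono)
  ultimately show ?thesis
    by linarith
qed

lemma l2_norm_fun_triangle:
  assumes f: "square_integrable f" and g: "square_integrable g"
  shows "l2_norm_fun (\<lambda>x. f x + g x) \<le> l2_norm_fun f + l2_norm_fun g"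
proof -
  define a b where "a = l2_norm_fun f" and "b = l2_norm_fun g"
  have fg: "square_integrable (\<lambda>x. f x + g x)"
    using f g by (rule square_integrable_add)
  have cong: "l2_norm_fun (\<lambda>x. f x + g x) = l2_norm_fun h"
    if "square_integrable h" "AE x in lebesgue. f x + g x = h x" for h
    using that fg by (intro l2_norm_fun_cong) (simp add: l2_eq_def)
  consider "a = 0" | "b = 0" | "0 < a" "0 < b"
    using l2_norm_fun_nonneg[of f] l2_norm_fun_nonneg[of g] unfolding a_def b_def by linarith
  then show ?thesis
  proof cases
    case 1
    then have "AE x in lebesgue. f x + g x = g x"
      using l2_norm_fun_eq_0[OF f] by (simp add: a_def)
    then show ?thesis
      using cong[OF g] 1 by (simp add: a_def)
  next
    case 2
    then have "AE x in lebesgue. f x + g x = f x"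
      using l2_norm_fun_eq_0[OF g] by (simp add: b_def)
    then show ?thesis
      using cong[OF f] 2 by (simp add: b_def)
  next
    case 3
    have intf: "integrable lebesgue (\<lambda>x. (cmod (f x))\<^sup>2)" and intg: "integrable lebesgue (\<lambda>x. (cmod (g x))\<^sup>2)"
      and intfg: "integrable lebesgue (\<lambda>x. (cmod (f x + g x))\<^sup>2)"
      using f g fg by (simp_all add: square_integrable_def)
    have "(l2_norm_fun (\<lambda>x. f x + g x))\<^sup>2
        \<le> (LINT x|lebesgue. (1 + b / a) * (cmod (f x))\<^sup>2 + (1 + a / b) * (cmod (g x))\<^sup>2)"
      unfolding l2_norm_fun_power2
    proof (rule integral_mono)
      show "integrable lebesgue (\<lambda>x. (1 + b / a) * (cmod (f x))\<^sup>2 + (1 + a / b) * (cmod (g x))\<^sup>2)"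
        by (intro Bochner_Integration.integrable_add integrable_mult_right intf intg)
    qed (rule intfg weighted_cmod_add_squared_le[OF 3])+
    also have "\<dots> = (1 + b / a) * a\<^sup>2 + (1 + a / b) * b\<^sup>2"
      using intf intg by (simp add: a_def b_def l2_norm_fun_power2)
    also have "\<dots> = (a + b)\<^sup>2"
    proof -
      have "(1 + b / a) * a\<^sup>2 = a\<^sup>2 + a * b" "(1 + a / b) * b\<^sup>2 = b\<^sup>2 + a * b"
        using 3 by (simp_all add: power2_eq_square distrib_right)
      then show ?thesis
        by (simp add: power2_sum)
    qed
    finally have "l2_norm_fun (\<lambda>x. f x + g x) \<le> a + b"
      by (rule power2_le_imp_le) (use 3 in simp)
    then show ?thesis
      by (simp only: a_def b_def)
  qed
qed

text \<open>\<open>fun_of f\<close> is a representative of the class \<open>f\<close>, determined up to null sets only.\<close>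

quotient_type l2 = "real \<Rightarrow> complex" / partial: l2_eq
  morphisms fun_of l2_of
proof (rule part_equivpI)
  show "\<exists>f. l2_eq f f"
    using square_integrable_zero by (auto simp: l2_eq_def)
  show "symp l2_eq"
    by (auto simp: symp_def l2_eq_def eq_commute)
  show "transp l2_eq"
  proof (rule transpI)
    fix f g h
    assume "l2_eq f g" "l2_eq g h"
    then have "AE x in lebesgue. f x = g x" "AE x in lebesgue. g x = h x"
      by (auto simp: l2_eq_def)
    then have "AE x in lebesgue. f x = h x"
      by eventually_elim simp
    then show "l2_eq f h"
      using \<open>l2_eq f g\<close> \<open>l2_eq g h\<close> by (simp add: l2_eq_def)
  qed
qed

lemma l2_eq_fun_of: "l2_eq (fun_of f) (fun_of f)"
  by (rule Quotient3_rep_reflp[OF Quotient3_l2])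

lemma square_integrable_fun_of: "square_integrable (fun_of f)"
  using l2_eq_fun_of[of f] by (simp add: l2_eq_def)

lemma fun_of_l2_of:
  assumes "square_integrable f"
  shows "AE x in lebesgue. fun_of (l2_of f) x = f x"
proof -
  have "l2_eq (fun_of (l2_of f)) f"
    by (rule rep_abs_rsp_left[OF Quotient3_l2]) (use assms in \<open>simp add: l2_eq_def\<close>)
  then show ?thesis
    by (simp add: l2_eq_def)
qed

lemma l2_eqI:
  assumes "AE x in lebesgue. fun_of f x = fun_of g x"
  shows "f = g"
  using Quotient3_rel_rep[OF Quotient3_l2, of f g] assms
  by (simp add: l2_eq_def square_integrable_fun_of)

instantiation l2 :: complex_normed_vector
begin

lift_definition zero_l2 :: l2 is "\<lambda>x. 0"
  by (simp add: l2_eq_def square_integrable_zero)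

lift_definition plus_l2 :: "l2 \<Rightarrow> l2 \<Rightarrow> l2" is "\<lambda>f g x. f x + g x"
proof -
  fix f f' g g'
  assume "l2_eq f f'" "l2_eq g g'"
  then have "AE x in lebesgue. f x = f' x" "AE x in lebesgue. g x = g' x"
    by (auto simp: l2_eq_def)
  then have "AE x in lebesgue. f x + g x = f' x + g' x"
    by eventually_elim simp
  then show "l2_eq (\<lambda>x. f x + g x) (\<lambda>x. f' x + g' x)"
    using \<open>l2_eq f f'\<close> \<open>l2_eq g g'\<close> by (simp add: l2_eq_def square_integrable_add)
qed

lift_definition minus_l2 :: "l2 \<Rightarrow> l2 \<Rightarrow> l2" is "\<lambda>f g x. f x - g x"
proof -
  fix f f' g g'
  assume "l2_eq f f'" "l2_eq g g'"
  then have "AE x in lebesgue. f x = f' x" "AE x in lebesgue. g x = g' x"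
    by (auto simp: l2_eq_def)
  then have "AE x in lebesgue. f x - g x = f' x - g' x"
    by eventually_elim simp
  then show "l2_eq (\<lambda>x. f x - g x) (\<lambda>x. f' x - g' x)"
    using \<open>l2_eq f f'\<close> \<open>l2_eq g g'\<close> by (simp add: l2_eq_def square_integrable_diff)
qed

lift_definition uminus_l2 :: "l2 \<Rightarrow> l2" is "\<lambda>f x. - f x"
  unfolding l2_eq_def
  by (intro conjI square_integrable_uminus; (elim conjE)?; (erule eventually_mono)?; simp)

lift_definition scaleC_l2 :: "complex \<Rightarrow> l2 \<Rightarrow> l2" is "\<lambda>c f x. c * f x"
  unfolding l2_eq_def
  by (intro conjI square_integrable_scale; (elim conjE)?; (erule eventually_mono)?; simp)

lift_definition norm_l2 :: "l2 \<Rightarrow> real" is l2_norm_fun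
  by (rule l2_norm_fun_cong)

definition scaleR_l2 :: "real \<Rightarrow> l2 \<Rightarrow> l2" where "scaleR_l2 r f = complex_of_real r *\<^sub>C f"
definition dist_l2 :: "l2 \<Rightarrow> l2 \<Rightarrow> real" where "dist_l2 f g = norm (f - g)"
definition sgn_l2 :: "l2 \<Rightarrow> l2" where "sgn_l2 f = inverse (norm f) *\<^sub>R f"
definition uniformity_l2 :: "(l2 \<times> l2) filter" where
  "uniformity_l2 = (INF e\<in>{0<..}. principal {(f, g). dist f g < e})"
definition open_l2 :: "l2 set \<Rightarrow> bool" where
  "open_l2 U = (\<forall>x\<in>U. eventually (\<lambda>(x', y). x' = x \<longrightarrow> y \<in> U) uniformity)"

instance
proof
  fix a b :: complex and r s :: real and f g h :: l2
  show add: "a *\<^sub>C (f + g) = a *\<^sub>C f + a *\<^sub>C g" for a and f g :: l2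
    by transfer (auto simp: l2_eq_def square_integrable_add square_integrable_scale distrib_left)
  show add': "(a + b) *\<^sub>C f = a *\<^sub>C f + b *\<^sub>C f" for a b and f :: l2
    by transfer (auto simp: l2_eq_def square_integrable_add square_integrable_scale distrib_right)
  show assoc: "a *\<^sub>C b *\<^sub>C f = (a * b) *\<^sub>C f" for a b and f :: l2
    by transfer (auto simp: l2_eq_def square_integrable_scale mult.assoc)
  show "complex_of_real r *\<^sub>C f = r *\<^sub>R f"
    by (simp add: scaleR_l2_def)
  show norm: "norm (a *\<^sub>C f) = cmod a * norm f" for a and f :: l2
    by transfer (rule l2_norm_fun_scale)
  show "f + g + h = f + (g + h)"
    by transfer (auto simp: l2_eq_def square_integrable_add add.assoc)
  show "f + g = g + f"
    by transfer (auto simp: l2_eq_def square_integrable_add add.commute)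
  show "0 + f = f"
    by transfer (auto simp: l2_eq_def)
  show "- f + f = 0"
    by transfer (auto simp: l2_eq_def square_integrable_zero)
  show "f - g = f + - g"
    by transfer (auto simp: l2_eq_def square_integrable_diff)
  show "r *\<^sub>R (f + g) = r *\<^sub>R f + r *\<^sub>R g"
    by (simp add: scaleR_l2_def add)
  show "(r + s) *\<^sub>R f = r *\<^sub>R f + s *\<^sub>R f"
    by (simp add: scaleR_l2_def add')
  show "r *\<^sub>R s *\<^sub>R f = (r * s) *\<^sub>R f"
    by (simp add: scaleR_l2_def assoc)
  show "1 *\<^sub>R f = f"
    unfolding scaleR_l2_def by transfer (auto simp: l2_eq_def)
  show "norm (r *\<^sub>R f) = \<bar>r\<bar> * norm f"
    by (simp add: scaleR_l2_def norm)
  show "norm (f + g) \<le> norm f + norm g"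
    by transfer (auto simp: l2_eq_def l2_norm_fun_triangle)
  show "norm f = 0 \<longleftrightarrow> f = 0"
    by transfer (auto simp: l2_eq_def l2_norm_fun_eq_0 square_integrable_zero)
qed (simp_all add: dist_l2_def sgn_l2_def uniformity_l2_def open_l2_def)

end

lemma fun_of_zero: "AE x in lebesgue. fun_of 0 x = 0"
  unfolding zero_l2_def using fun_of_l2_of[OF square_integrable_zero] by simp

lemma fun_of_add: "AE x in lebesgue. fun_of (f + g) x = fun_of f x + fun_of g x"
  unfolding plus_l2_def
  using fun_of_l2_of[OF square_integrable_add[OF square_integrable_fun_of square_integrable_fun_of]]
  by simp

lemma fun_of_scaleC: "AE x in lebesgue. fun_of (c *\<^sub>C f) x = c * fun_of f x"
  unfolding scaleC_l2_def
  using fun_of_l2_of[OF square_integrable_scale[OF square_integrable_fun_of]] by simp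


section \<open>The space \<open>L\<^sup>2\<close> of the half-line\<close>

text \<open>
  \<open>L\<^sup>2(0,\<infinity>)\<close>, viewed as a subspace of \<open>L\<^sup>2(\<real>)\<close> by extension by zero; the morphism
  \<open>ext_zero\<close> is the inclusion.
\<close>

typedef l2_plus = "{f :: l2. AE x in lebesgue. x \<le> 0 \<longrightarrow> fun_of f x = 0}"
  morphisms ext_zero restr_plus
proof
  show "0 \<in> {f :: l2. AE x in lebesgue. x \<le> 0 \<longrightarrow> fun_of f x = 0}"
    unfolding mem_Collect_eq by (rule eventually_mono[OF fun_of_zero]) simp
qed

setup_lifting type_definition_l2_plus

instantiation l2_plus :: complex_normed_vector
begin

lift_definition zero_l2_plus :: l2_plus is 0
  by (rule eventually_mono[OF fun_of_zero]) simp

lift_definition plus_l2_plus :: "l2_plus \<Rightarrow> l2_plus \<Rightarrow> l2_plus" is "(+)"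
proof -
  fix f g :: l2
  assume "AE x in lebesgue. x \<le> 0 \<longrightarrow> fun_of f x = 0" "AE x in lebesgue. x \<le> 0 \<longrightarrow> fun_of g x = 0"
  then show "AE x in lebesgue. x \<le> 0 \<longrightarrow> fun_of (f + g) x = 0"
    using fun_of_add[of f g] by eventually_elim simp
qed

lift_definition scaleC_l2_plus :: "complex \<Rightarrow> l2_plus \<Rightarrow> l2_plus" is "(*\<^sub>C)"
proof -
  fix c and f :: l2
  assume "AE x in lebesgue. x \<le> 0 \<longrightarrow> fun_of f x = 0"
  then show "AE x in lebesgue. x \<le> 0 \<longrightarrow> fun_of (c *\<^sub>C f) x = 0"
    using fun_of_scaleC[of c f] by eventually_elim simp
qed

lift_definition norm_l2_plus :: "l2_plus \<Rightarrow> real" is norm .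

definition scaleR_l2_plus :: "real \<Rightarrow> l2_plus \<Rightarrow> l2_plus"
  where "scaleR_l2_plus r f = complex_of_real r *\<^sub>C f"
definition uminus_l2_plus :: "l2_plus \<Rightarrow> l2_plus" where "uminus_l2_plus f = (- 1) *\<^sub>C f"
definition minus_l2_plus :: "l2_plus \<Rightarrow> l2_plus \<Rightarrow> l2_plus" where "minus_l2_plus f g = f + - g"
definition dist_l2_plus :: "l2_plus \<Rightarrow> l2_plus \<Rightarrow> real" where "dist_l2_plus f g = norm (f - g)"
definition sgn_l2_plus :: "l2_plus \<Rightarrow> l2_plus" where "sgn_l2_plus f = inverse (norm f) *\<^sub>R f"
definition uniformity_l2_plus :: "(l2_plus \<times> l2_plus) filter" where
  "uniformity_l2_plus = (INF e\<in>{0<..}. principal {(f, g). dist f g < e})"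
definition open_l2_plus :: "l2_plus set \<Rightarrow> bool" where
  "open_l2_plus U = (\<forall>x\<in>U. eventually (\<lambda>(x', y). x' = x \<longrightarrow> y \<in> U) uniformity)"

instance
proof
  fix a b :: complex and r s :: real and f g h :: l2_plus
  show add: "a *\<^sub>C (f + g) = a *\<^sub>C f + a *\<^sub>C g" for a and f g :: l2_plus
    by transfer (rule scaleC_add_right)
  show add': "(a + b) *\<^sub>C f = a *\<^sub>C f + b *\<^sub>C f" for a b and f :: l2_plus
    by transfer (rule scaleC_add_left)
  show assoc: "a *\<^sub>C b *\<^sub>C f = (a * b) *\<^sub>C f" for a b and f :: l2_plus
    by transfer (rule scaleC_scaleC)
  show "complex_of_real r *\<^sub>C f = r *\<^sub>R f"
    by (simp add: scaleR_l2_plus_def)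
  show norm: "norm (a *\<^sub>C f) = cmod a * norm f" for a and f :: l2_plus
    by transfer (rule norm_scaleC)
  show "f + g + h = f + (g + h)" "f + g = g + f" "0 + f = f"
    by (transfer, simp add: add.assoc add.commute)+
  have "(- 1) *\<^sub>C f + f = 0"
    using scaleC_of_real[of "- 1" "ext_zero f"] by transfer simp
  then show "- f + f = 0"
    by (simp add: uminus_l2_plus_def)
  show "r *\<^sub>R (f + g) = r *\<^sub>R f + r *\<^sub>R g"
    by (simp add: scaleR_l2_plus_def add)
  show "(r + s) *\<^sub>R f = r *\<^sub>R f + s *\<^sub>R f"
    by (simp add: scaleR_l2_plus_def add')
  show "r *\<^sub>R s *\<^sub>R f = (r * s) *\<^sub>R f"
    by (simp add: scaleR_l2_plus_def assoc)
  show "1 *\<^sub>R f = f"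
    unfolding scaleR_l2_plus_def by transfer (simp only: scaleC_of_real scaleR_one)
  show "norm (r *\<^sub>R f) = \<bar>r\<bar> * norm f"
    by (simp add: scaleR_l2_plus_def norm)
  show "norm (f + g) \<le> norm f + norm g"
    by transfer (rule norm_triangle_ineq)
  show "norm f = 0 \<longleftrightarrow> f = 0"
    by transfer simp
qed (simp_all add: minus_l2_plus_def dist_l2_plus_def sgn_l2_plus_def uniformity_l2_plus_def
       open_l2_plus_def)

end


section \<open>Hausdorff operators, the Cesaro operator and the Mellin transform\<close>

text \<open>\<open>(H\<^sub>K f)(x) = \<integral> K(u) f(ux) du\<close>, which for almost every \<open>x\<close> is an absolutely convergent integral
  that does not depend on the representative of \<open>f\<close>.\<close>

definition hausdorff_op :: "(real \<Rightarrow> complex) \<Rightarrow> (l2 \<Rightarrow>\<^sub>L l2)" where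
  "hausdorff_op K = (THE T. \<forall>f. AE x in lebesgue.
      fun_of (blinfun_apply T f) x = (LINT u|lebesgue. K u * fun_of f (u * x)))"

text \<open>
  The restriction of \<open>H\<^sub>K\<close> to \<open>L\<^sup>2(0,\<infinity>)\<close>, which is invariant when \<open>K\<close> is supported in \<open>(0,\<infinity>)\<close>.
\<close>

definition hausdorff_op_plus :: "(real \<Rightarrow> complex) \<Rightarrow> (l2_plus \<Rightarrow>\<^sub>L l2_plus)" where
  "hausdorff_op_plus K = (THE T. \<forall>f.
      ext_zero (blinfun_apply T f) = blinfun_apply (hausdorff_op K) (ext_zero f))"

definition cesaro_plus :: "l2_plus \<Rightarrow>\<^sub>L l2_plus" where
  "cesaro_plus = (THE T. \<forall>f. AE x in lebesgue. 0 < x \<longrightarrow>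
      fun_of (ext_zero (blinfun_apply T f)) x
        = 1 / complex_of_real x * (LINT t:{0..x}|lebesgue. fun_of (ext_zero f) t))"

definition mellin :: "(real \<Rightarrow> complex) \<Rightarrow> complex \<Rightarrow> complex" where
  "mellin K z = (LINT u:{0<..}|lebesgue. K u * complex_of_real u powr (z - 1))"

text \<open>
  Measurability of \<open>K\<close> is implied: almost everywhere it vanishes on the negative half-line, and it
  is measurable on the positive one by the integrability condition.
\<close>

definition kernel_for :: "(complex \<Rightarrow> complex) \<Rightarrow> (real \<Rightarrow> complex) \<Rightarrow> bool" where
  "kernel_for F K \<longleftrightarrow>
     (AE u in lebesgue. u < 0 \<longrightarrow> K u = 0) \<and>
     set_integrable lebesgue {0<..} (\<lambda>u. K u * complex_of_real (u powr (- 1 / 2))) \<and>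
     (\<forall>z. Re z = 1 / 2 \<longrightarrow> mellin K z = F (inverse z))"

end

theory Submission
  imports Defs "HOL-Probability.Levy"
begin

text \<open>
  The Cesaro operator \<open>C\<close> is the Hausdorff operator whose kernel is the indicator function of
  \<open>(0, 1)\<close>.  A kernel \<open>K\<close> with \<open>u\<^sup>-\<^sup>1\<^sup>/\<^sup>2 K(u)\<close> integrable gives a bounded operator
  \<open>H\<^sub>K\<close>; such operators commute, and composition is convolution of the kernels
  (\<open>hausdorff_op_plus_compose\<close>, \<open>hausdorff_op_plus_commute\<close>).  So the resolvent of \<open>C\<close> can be
  guessed from its symbol.  At \<open>w = 1 / s\<close> the function \<open>1 / (z - w)\<close> equals
  \<open>a + a\<^sup>2 / (s - a)\<close> with \<open>a = 1 / z\<close>, and on the line \<open>Re s = 1 / 2\<close> the second summand is the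
  Mellin transform of \<open>a\<^sup>2 u\<^sup>-\<^sup>a\<close> on \<open>(0, 1)\<close> or of \<open>- a\<^sup>2 u\<^sup>-\<^sup>a\<close> on \<open>(1, \<infinity>)\<close>, depending on
  whether \<open>Re a\<close> is less or greater than \<open>1 / 2\<close>, that is, whether \<open>z\<close> lies outside or inside the
  circle.  Hence \<open>(z - C)\<^sup>-\<^sup>1 = 1 / z + H\<^sub>k\<close> for an explicit kernel \<open>k\<close> (\<open>resolvent_inverse\<close>).  On the
  circle there is no inverse, because truncated powers of \<open>x\<close> are approximate eigenvectors
  (\<open>circle_subset_spectrum\<close>); so the spectrum is the circle, and every admissible cycle avoids it.

  Integrating \<open>F(z) (z - C)\<^sup>-\<^sup>1\<close> over a cycle yields \<open>F(C) = F(0) + H\<^sub>K\<close>, where \<open>K\<close> is the contour integral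
  of \<open>F(z) k(u)\<close> for each \<open>u\<close>, and the scalar \<open>F(0)\<close> comes from the summand \<open>1 / z\<close> and Cauchy's formula
  at the point 0 of the circle.  In the same way the Mellin transform of \<open>K\<close> at \<open>s\<close> is the integral of
  \<open>F(z) (1 / (z - 1 / s) - 1 / z)\<close>, which is \<open>F(1 / s) - F(0)\<close>
  (\<open>holomorphic_calculus_cesaro_plus\<close>).  For \<open>F(0) = 0\<close> this is the first half of the theorem.

  Two points need care.  A cycle consists of several curves, possibly in different components of \<open>U\<close>,
  so Cauchy's formula is needed for cycles (\<open>Cauchy_integral_formula_cycle\<close>).  And the curves may have
  infinite length, so that the operator integral may converge only conditionally; it is
  evaluated by local primitives of the kernel, taken with respect to the weighted norm
  (\<open>kernel_functional_contour_integral\<close>).  This takes place in the space of bounded operators, which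
  is a Banach space since \<open>L\<^sup>2\<close> is complete.

  For the converse let \<open>K\<close> satisfy the three conditions and subtract the kernel found above.  The
  difference has the constant Mellin transform \<open>F(0)\<close> on the line.  An integrable function whose Fourier
  transform is constant vanishes almost everywhere (\<open>mellin_uniqueness\<close>), which gives both
  \<open>F(0) = 0\<close> and the equality of the operators.
\<close>

section \<open>Cauchy's integral formula for cycles\<close>

definition divided_difference :: "(complex \<Rightarrow> complex) \<Rightarrow> complex \<Rightarrow> complex \<Rightarrow> complex" where
  "divided_difference f w z = (if z = w then deriv f w else (f z - f w) / (z - w))"

lemma divided_difference_commute: "divided_difference f w z = divided_difference f z w"
  using minus_divide_divide[of "f z - f w" "z - w"] by (simp add: divided_difference_def)

lemma divided_difference_holomorphic:
  assumes "open U" "f holomorphic_on U" "w \<in> U"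
  shows "divided_difference f w holomorphic_on U"
  using pole_lemma_open[OF assms(2,1), of w] by (simp add: divided_difference_def[abs_def])

text \<open>
  Off the diagonal this is clear.  Near it the quotient is the average of the derivative over the
  segment from \<open>w\<close> to \<open>z\<close>, which depends continuously on both end points.
\<close>

lemma divided_difference_continuous:
  assumes U: "open U" and f: "f holomorphic_on U"
  shows "continuous_on (U \<times> U) (\<lambda>(w, z). divided_difference f w z)"
proof -
  have cf: "continuous_on U f"
    using f by (rule holomorphic_on_imp_continuous_on)
  have df: "continuous_on U (deriv f)"
    using holomorphic_deriv[OF f U] by (rule holomorphic_on_imp_continuous_on)
  have "continuous (at p) (\<lambda>(w, z). divided_difference f w z)" if pU: "p \<in> U \<times> U" for p
  proof -
    obtain a b where p: "p = (a, b)" "a \<in> U" "b \<in> U"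
      using pU by (cases p) auto
    show ?thesis
    proof (cases "a = b")
      case False
      define W where "W = (U \<times> U) - {p. fst p = snd p}"
      have "closed {p :: complex \<times> complex. fst p = snd p}"
        by (intro closed_Collect_eq continuous_intros)
      then have W: "open W"
        unfolding W_def using U by (intro open_Diff open_Times) auto
      have "continuous_on W (\<lambda>p. (f (snd p) - f (fst p)) / (snd p - fst p))"
        by (intro continuous_intros continuous_on_compose2[OF cf]) (auto simp: W_def)
      then have "continuous_on W (\<lambda>(w, z). divided_difference f w z)"
        by (rule continuous_on_eq) (auto simp: W_def divided_difference_def)
      then show ?thesis
        using W p False by (auto simp: continuous_on_eq_continuous_at W_def)
    next
      case True
      obtain r where r: "r > 0" "cball a r \<subseteq> U"
        using U p(2) open_contains_cball by blast
      have seg: "w + of_real t * (z - w) \<in> ball a r"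
        if "w \<in> ball a r" "z \<in> ball a r" "t \<in> {0..1}" for w z and t :: real
      proof -
        have "(1 - t) *\<^sub>R w + t *\<^sub>R z \<in> ball a r"
          using convex_ball[of a r] that by (auto simp: convex_alt)
        then show ?thesis
          by (simp add: scaleR_conv_of_real algebra_simps)
      qed
      have segU: "w + of_real t * (z - w) \<in> U"
        if "w \<in> ball a r" "z \<in> ball a r" "t \<in> {0..1}" for w z and t :: real
        using seg[OF that] r ball_subset_cball by blast
      have avg: "divided_difference f w z = integral (cbox 0 1) (\<lambda>t. deriv f (w + of_real t * (z - w)))"
        if wz: "w \<in> ball a r" "z \<in> ball a r" for w z
      proof (cases "z = w")
        case True
        then show ?thesis
          by (simp add: divided_difference_def)
      next
        case False
        have "((\<lambda>t. f (w + of_real t * (z - w))) has_vector_derivative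
            (z - w) * deriv f (w + of_real t * (z - w))) (at t within {0..1})" if t: "t \<in> {0..1}" for t
        proof -
          have "w + of_real t * (z - w) \<in> U"
            using wz t by (rule segU)
          then have D: "(f has_field_derivative deriv f (w + of_real t * (z - w))) (at (w + of_real t * (z - w)))"
            using f U by (rule holomorphic_derivI[rotated 2])
          have "((\<lambda>t. w + of_real t * (z - w)) has_vector_derivative (z - w)) (at t within {0..1})"
            by (auto intro!: derivative_eq_intros simp: has_vector_derivative_def scaleR_conv_of_real)
          from field_vector_diff_chain_within[OF this has_field_derivative_at_within[OF D]]
          show ?thesis
            by (simp add: o_def)
        qed
        from fundamental_theorem_of_calculus[OF _ this]
        have "((\<lambda>t. (z - w) * deriv f (w + of_real t * (z - w))) has_integral (f z - f w)) {0..1}"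
          by simp
        from has_integral_mult_right[OF this, of "1 / (z - w)"] False
        have "((\<lambda>t. deriv f (w + of_real t * (z - w))) has_integral (f z - f w) / (z - w)) {0..1}"
          by simp
        then show ?thesis
          using False by (simp add: divided_difference_def integral_unique)
      qed
      have "continuous_on (ball a r \<times> ball a r)
          (\<lambda>p. integral (cbox 0 1) (\<lambda>t. deriv f (fst p + of_real t * (snd p - fst p))))"
      proof (rule integral_continuous_on_param)
        show "continuous_on ((ball a r \<times> ball a r) \<times> cbox (0::real) 1)
            (\<lambda>(p, t). deriv f (fst p + of_real t * (snd p - fst p)))"
          unfolding case_prod_unfold
          by (rule continuous_on_compose2[OF df])
            (use segU in \<open>auto intro!: continuous_intros\<close>)
      qed
      then have "continuous_on (ball a r \<times> ball a r) (\<lambda>(w, z). divided_difference f w z)"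
        by (rule continuous_on_eq) (auto simp: avg)
      then show ?thesis
        using r p True by (auto simp: continuous_on_eq_continuous_at open_Times)
    qed
  qed
  then show ?thesis
    by (simp add: continuous_at_imp_continuous_on)
qed

lemma contour_integral_divided_difference_continuous:
  assumes U: "open U" and f: "f holomorphic_on U"
    and p: "\<And>t. (p has_vector_derivative p' t) (at t)" "continuous_on {0..1} p'"
    and pU: "path_image p \<subseteq> U"
  shows "continuous_on U (\<lambda>w. contour_integral p (divided_difference f w))"
proof -
  have cp: "continuous_on {0..1} p"
    by (intro continuous_at_imp_continuous_on ballI has_vector_derivative_continuous[OF p(1)])
  have eq: "contour_integral p (divided_difference f w)
      = integral (cbox 0 1) (\<lambda>t. divided_difference f w (p t) * p' t)" for w
    by (simp add: contour_integral_integral vector_derivative_at[OF p(1)])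
  have "continuous_on (U \<times> {0..1}) (\<lambda>x. (case (fst x, p (snd x)) of (w, z) \<Rightarrow> divided_difference f w z))"
    by (rule continuous_on_compose2[OF divided_difference_continuous[OF U f]])
      (use pU in \<open>auto intro!: continuous_intros continuous_on_compose2[OF cp] simp: path_image_def\<close>)
  then have "continuous_on (U \<times> cbox 0 1) (\<lambda>(w, t). divided_difference f w (p t) * p' t)"
    unfolding case_prod_unfold fst_conv snd_conv
    by (intro continuous_intros continuous_on_compose2[OF p(2)]) auto
  then show ?thesis
    unfolding eq by (rule integral_continuous_on_param)
qed

text \<open>
  By Morera's theorem: the integral over a triangle may be taken first, and then vanishes, because
  the divided difference is holomorphic in either variable.  The exchange of the two integrals needs
  a continuous derivative, so \<open>\<gamma>\<close> is first replaced by a nearby polynomial curve, which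
  does not affect integrals of functions that are holomorphic on \<open>U\<close>.
\<close>

lemma contour_integral_divided_difference_holomorphic:
  assumes U: "open U" and f: "f holomorphic_on U"
    and \<gamma>: "valid_path \<gamma>" "path_image \<gamma> \<subseteq> U"
  shows "(\<lambda>w. contour_integral \<gamma> (divided_difference f w)) holomorphic_on U"
proof -
  have "path \<gamma>"
    using \<gamma>(1) by (rule valid_path_imp_path)
  from contour_integral_nearby_ends[OF U this \<gamma>(2)] obtain d where d: "d > 0"
      "\<And>g h. \<lbrakk>valid_path g; valid_path h; \<forall>t\<in>{0..1}. cmod (g t - \<gamma> t) < d \<and> cmod (h t - \<gamma> t) < d;
         pathstart h = pathstart g \<and> pathfinish h = pathfinish g\<rbrakk>
        \<Longrightarrow> path_image h \<subseteq> U \<and> (\<forall>f. f holomorphic_on U \<longrightarrow> contour_integral h f = contour_integral g f)"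
    by metis
  obtain p where p: "polynomial_function p" "pathstart p = pathstart \<gamma>" "pathfinish p = pathfinish \<gamma>"
      "\<And>t. t \<in> {0..1} \<Longrightarrow> cmod (p t - \<gamma> t) < d"
    using path_approx_polynomial_function[OF \<open>path \<gamma>\<close> d(1)] by metis
  have vp: "valid_path p"
    using p(1) by (rule valid_path_polynomial_function)
  have pU: "path_image p \<subseteq> U" and eq: "contour_integral p g = contour_integral \<gamma> g" if "g holomorphic_on U" for g
    using d(2)[OF \<gamma>(1) vp] p d(1) that by auto
  obtain p' where p': "polynomial_function p'" "\<And>t. (p has_vector_derivative p' t) (at t)"
    using has_vector_derivative_polynomial_function[OF p(1)] by blast
  have cp': "continuous_on {0..1} p'"
    using p'(1) by (rule continuous_on_polymonial_function)
  have cp: "continuous_on {0..1} p"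
    using p(1) by (rule continuous_on_polymonial_function)
  define h where "h w = contour_integral p (divided_difference f w)" for w
  note pU = pU[OF f]
  have line': "(linepath a b has_vector_derivative (b - a)) (at t)" for a b :: complex and t
    unfolding linepath_def has_vector_derivative_def
    by (auto intro!: derivative_eq_intros simp: algebra_simps)
  have h_cont: "continuous_on U h"
    unfolding h_def using U f p'(2) cp' pU by (rule contour_integral_divided_difference_continuous)
  have swap: "contour_integral (linepath a b) h
      = contour_integral p (\<lambda>z. contour_integral (linepath a b) (divided_difference f z))"
    and int: "(\<lambda>z. contour_integral (linepath a b) (divided_difference f z)) contour_integrable_on p"
    if ab: "closed_segment a b \<subseteq> U" for a b
  proof -
    have "contour_integral (linepath a b) h
        = contour_integral p (\<lambda>z. contour_integral (linepath a b) (\<lambda>w. divided_difference f w z))"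
      unfolding h_def
    proof (rule contour_integral_swap)
      show "continuous_on (path_image (linepath a b) \<times> path_image p) (\<lambda>(y1, y2). divided_difference f y1 y2)"
        using ab pU by (intro continuous_on_subset[OF divided_difference_continuous[OF U f]]) auto
      show "continuous_on {0..1} (\<lambda>t. vector_derivative p (at t))"
        using cp' by (simp add: vector_derivative_at[OF p'(2)])
    qed (use vp in auto)
    then show "contour_integral (linepath a b) h
        = contour_integral p (\<lambda>z. contour_integral (linepath a b) (divided_difference f z))"
      by (subst (asm) divided_difference_commute)
    have c: "continuous_on U (\<lambda>z. contour_integral (linepath a b) (divided_difference f z))"
      by (rule contour_integral_divided_difference_continuous[OF U f line']) (use ab in auto)
    have "continuous_on {0..1} (\<lambda>t. contour_integral (linepath a b) (divided_difference f (p t)) * p' t)"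
      by (intro continuous_intros cp' continuous_on_compose2[OF c cp])
        (use pU in \<open>auto simp: path_image_def\<close>)
    then show "(\<lambda>z. contour_integral (linepath a b) (divided_difference f z)) contour_integrable_on p"
      by (simp add: contour_integrable_on vector_derivative_at[OF p'(2)] integrable_continuous_real)
  qed
  have "h analytic_on U"
  proof (rule Morera_triangle[OF h_cont U], rule impI)
    fix a b c
    assume hull: "convex hull {a, b, c} \<subseteq> U"
    have seg: "closed_segment x y \<subseteq> U" if "x \<in> {a, b, c}" "y \<in> {a, b, c}" for x y
      using hull closed_segment_subset_convex_hull[of x "{a, b, c}" y] that hull_subset[of "{a, b, c}" convex]
      by blast
    let ?I = "\<lambda>x y z. contour_integral (linepath x y) (divided_difference f z)"
    have "contour_integral (linepath a b) h + contour_integral (linepath b c) h + contour_integral (linepath c a) h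
        = contour_integral p (?I a b) + contour_integral p (?I b c) + contour_integral p (?I c a)"
      using swap[OF seg] by simp
    also have "\<dots> = contour_integral p (\<lambda>z. ?I a b z + ?I b c z + ?I c a z)"
      using int[OF seg] by (simp add: contour_integral_add contour_integrable_add)
    also have "\<dots> = contour_integral p (\<lambda>z. 0)"
    proof (rule contour_integral_eq)
      fix z assume "z \<in> path_image p"
      then have "divided_difference f z holomorphic_on convex hull {a, b, c}"
        using divided_difference_holomorphic[OF U f] pU hull holomorphic_on_subset by blast
      from Cauchy_theorem_triangle[OF this] show "?I a b z + ?I b c z + ?I c a z = 0"
        by (rule has_chain_integral_chain_integral3)
    qed
    finally show "contour_integral (linepath a b) h + contour_integral (linepath b c) h
        + contour_integral (linepath c a) h = 0"
      by simp
  qed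
  then have "h holomorphic_on U"
    by (rule analytic_imp_holomorphic)
  then show ?thesis
    by (rule holomorphic_transform) (auto simp: h_def eq divided_difference_holomorphic[OF U f])
qed

text \<open>
  The curve may have infinite length, so the integrand is estimated on a compact neighbourhood of
  the curve, where integrals of holomorphic functions are bounded by a multiple of their supremum.
\<close>

lemma tendsto_contour_integral_cauchy_kernel_at_infinity:
  assumes U: "open U" and f: "f holomorphic_on U"
    and \<gamma>: "valid_path \<gamma>" "path_image \<gamma> \<subseteq> U"
  shows "((\<lambda>w. contour_integral \<gamma> (\<lambda>z. f z / (z - w))) \<longlongrightarrow> 0) at_infinity"
proof -
  have "compact (path_image \<gamma>)"
    using \<gamma>(1) by (rule compact_valid_path_image)
  then obtain e where e: "e > 0" "(\<Union>x\<in>path_image \<gamma>. cball x e) \<subseteq> U"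
    using compact_subset_open_imp_cball_epsilon_subset U \<gamma>(2) by metis
  define K where "K = (\<Union>x\<in>path_image \<gamma>. \<Union>y\<in>cball 0 e. {x + y})"
  define S where "S = (\<Union>x\<in>path_image \<gamma>. ball x e)"
  have K: "compact K"
    unfolding K_def by (rule compact_sums') (use \<open>compact (path_image \<gamma>)\<close> in auto)
  have "S \<subseteq> K"
  proof
    fix z assume "z \<in> S"
    then obtain x where x: "x \<in> path_image \<gamma>" "z \<in> ball x e"
      by (auto simp: S_def)
    then have "z - x \<in> cball 0 e"
      by (simp add: dist_norm norm_minus_commute)
    moreover have "z = x + (z - x)"
      by simp
    ultimately show "z \<in> K"
      using x(1) unfolding K_def by blast
  qed
  have "K \<subseteq> U"
  proof
    fix z assume "z \<in> K"
    then obtain x y where "x \<in> path_image \<gamma>" "y \<in> cball 0 e" "z = x + y"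
      by (auto simp: K_def)
    then have "x \<in> path_image \<gamma>" "z \<in> cball x e"
      by (auto simp: dist_norm)
    then show "z \<in> U"
      using e(2) by blast
  qed
  have S: "open S" "path_image \<gamma> \<subseteq> S"
    using e(1) by (auto simp: S_def)
  from contour_integral_bound_exists[OF S(1) \<gamma>(1) S(2)] obtain L where L: "L > 0"
      "\<And>f B. f holomorphic_on S \<Longrightarrow> (\<And>z. z \<in> S \<Longrightarrow> cmod (f z) \<le> B) \<Longrightarrow> cmod (contour_integral \<gamma> f) \<le> L * B"
    by blast
  have "bounded (f ` K)"
    using K \<open>K \<subseteq> U\<close> f by (meson compact_continuous_image compact_imp_bounded continuous_on_subset holomorphic_on_imp_continuous_on)
  then obtain M where M: "M > 0" "\<And>z. z \<in> K \<Longrightarrow> cmod (f z) \<le> M"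
    by (auto simp: bounded_pos)
  obtain C where C: "C > 0" "\<And>z. z \<in> K \<Longrightarrow> cmod z \<le> C"
    using compact_imp_bounded[OF K] by (auto simp: bounded_pos)
  have ev: "eventually (\<lambda>w. cmod (contour_integral \<gamma> (\<lambda>z. f z / (z - w))) \<le> L * M / (cmod w - C)) at_infinity"
  proof -
    have "cmod (contour_integral \<gamma> (\<lambda>z. f z / (z - w))) \<le> L * M / (cmod w - C)" if w: "cmod w > C" for w
    proof -
      have "cmod (contour_integral \<gamma> (\<lambda>z. f z / (z - w))) \<le> L * (M / (cmod w - C))"
      proof (rule L(2))
        show "(\<lambda>z. f z / (z - w)) holomorphic_on S"
          using f \<open>S \<subseteq> K\<close> \<open>K \<subseteq> U\<close> C(2)[of w] w
          by (intro holomorphic_intros) (auto intro: holomorphic_on_subset)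
        show "cmod (f z / (z - w)) \<le> M / (cmod w - C)" if "z \<in> S" for z
        proof -
          have "z \<in> K"
            using that \<open>S \<subseteq> K\<close> by blast
          moreover have "cmod w - cmod z \<le> cmod (z - w)"
            using norm_triangle_ineq2[of w z] by (simp add: norm_minus_commute)
          ultimately show ?thesis
            unfolding norm_divide using M C(2)[of z] w by (intro frac_le) auto
        qed
      qed
      then show ?thesis
        by simp
    qed
    then show ?thesis
      unfolding eventually_at_infinity by (intro exI[of _ "C + 1"]) auto
  qed
  have "((\<lambda>w::complex. L * M / (cmod w - C)) \<longlongrightarrow> 0) at_infinity"
    by (rule real_tendsto_divide_at_top[OF tendsto_const])
      (use filterlim_tendsto_add_at_top[OF tendsto_const[of "- C"] filterlim_norm_at_top] in \<open>simp add: add.commute\<close>)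
  then show ?thesis
    by (rule Lim_null_comparison[OF ev])
qed

text \<open>
  Dixon's proof.  The sum of the integrals of the divided difference is holomorphic on \<open>U\<close>; the sum
  of the Cauchy integrals is holomorphic on the set of points off the curves around which the cycle
  does not wind.  The two sets cover the plane and the two functions agree where both are defined, so
  they form an entire function.  It tends to 0 at infinity and hence vanishes, and on \<open>U\<close> this is
  the formula.  The argument has to be about the sum: a single curve of the cycle may well wind
  around points outside \<open>U\<close>.
\<close>

theorem Cauchy_integral_formula_cycle:
  assumes U: "open U" and f: "f holomorphic_on U"
    and \<Gamma>: "\<And>\<gamma>. \<gamma> \<in> set \<Gamma> \<Longrightarrow> valid_path \<gamma> \<and> pathfinish \<gamma> = pathstart \<gamma> \<and> path_image \<gamma> \<subseteq> U"
    and zero: "\<And>w. w \<notin> U \<Longrightarrow> (\<Sum>\<gamma>\<leftarrow>\<Gamma>. winding_number \<gamma> w) = 0"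
    and w: "w \<in> U" "\<And>\<gamma>. \<gamma> \<in> set \<Gamma> \<Longrightarrow> w \<notin> path_image \<gamma>"
  shows "(\<Sum>\<gamma>\<leftarrow>\<Gamma>. contour_integral \<gamma> (\<lambda>z. f z / (z - w)))
    = 2 * of_real pi * \<i> * (\<Sum>\<gamma>\<leftarrow>\<Gamma>. winding_number \<gamma> w) * f w"
proof -
  define D where "D w = (\<Sum>\<gamma>\<leftarrow>\<Gamma>. contour_integral \<gamma> (divided_difference f w))" for w
  define E where "E w = (\<Sum>\<gamma>\<leftarrow>\<Gamma>. contour_integral \<gamma> (\<lambda>z. f z / (z - w)))" for w
  define V where "V = {w. (\<forall>\<gamma>\<in>set \<Gamma>. w \<notin> path_image \<gamma>) \<and> (\<Sum>\<gamma>\<leftarrow>\<Gamma>. winding_number \<gamma> w) = 0}"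
  have UV: "U \<union> V = UNIV"
    using \<Gamma> zero by (auto simp: V_def)
  have DE: "D w = E w - 2 * of_real pi * \<i> * (\<Sum>\<gamma>\<leftarrow>\<Gamma>. winding_number \<gamma> w) * f w"
    if w: "w \<in> U" "\<forall>\<gamma>\<in>set \<Gamma>. w \<notin> path_image \<gamma>" for w
  proof -
    have "contour_integral \<gamma> (divided_difference f w)
        = contour_integral \<gamma> (\<lambda>z. f z / (z - w)) - 2 * of_real pi * \<i> * f w * winding_number \<gamma> w"
      if "\<gamma> \<in> set \<Gamma>" for \<gamma>
    proof -
      note \<gamma> = \<Gamma>[OF that]
      have n: "w \<notin> path_image \<gamma>"
        using that w by blast
      have "contour_integral \<gamma> (divided_difference f w) = contour_integral \<gamma> (\<lambda>z. f z / (z - w) - f w * (1 / (z - w)))"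
        by (rule contour_integral_eq) (use n in \<open>auto simp: divided_difference_def diff_divide_distrib\<close>)
      also have "\<dots> = contour_integral \<gamma> (\<lambda>z. f z / (z - w)) - contour_integral \<gamma> (\<lambda>z. f w * (1 / (z - w)))"
        by (rule contour_integral_diff; rule contour_integrable_holomorphic_simple[where S = "U - {w}"])
          (use U f n \<gamma> in \<open>auto intro!: holomorphic_intros intro: holomorphic_on_subset\<close>)
      also have "contour_integral \<gamma> (\<lambda>z. f w * (1 / (z - w))) = 2 * of_real pi * \<i> * f w * winding_number \<gamma> w"
        using winding_number_valid_path[of \<gamma> w] \<gamma> n
        by (subst contour_integral_lmul)
          (auto intro!: contour_integrable_holomorphic_simple[where S = "- {w}"] holomorphic_intros)
      finally show ?thesis .
    qed
    then have "D w = (\<Sum>\<gamma>\<leftarrow>\<Gamma>. contour_integral \<gamma> (\<lambda>z. f z / (z - w)) - 2 * of_real pi * \<i> * f w * winding_number \<gamma> w)"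
      unfolding D_def by (intro arg_cong[of _ _ sum_list] map_cong) auto
    also have "\<dots> = E w - 2 * of_real pi * \<i> * f w * (\<Sum>\<gamma>\<leftarrow>\<Gamma>. winding_number \<gamma> w)"
      by (simp add: E_def sum_list_subtractf sum_list_const_mult)
    finally show ?thesis
      by simp
  qed
  have "open V"
  proof (subst open_subopen, rule ballI)
    fix w assume w: "w \<in> V"
    define W where "W = (\<Inter>\<gamma>\<in>set \<Gamma>. {z. z \<notin> path_image \<gamma> \<and> winding_number \<gamma> z = winding_number \<gamma> w})"
    have "open W"
      unfolding W_def using \<Gamma> by (intro open_INT ballI open_winding_number_levelsets) (auto simp: valid_path_imp_path)
    moreover have "w \<in> W"
      using w by (auto simp: W_def V_def)
    moreover have "W \<subseteq> V"
    proof
      fix z assume z: "z \<in> W"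
      then have "(\<Sum>\<gamma>\<leftarrow>\<Gamma>. winding_number \<gamma> z) = (\<Sum>\<gamma>\<leftarrow>\<Gamma>. winding_number \<gamma> w)"
        by (intro arg_cong[of _ _ sum_list] map_cong) (auto simp: W_def)
      then show "z \<in> V"
        using z w by (auto simp: W_def V_def)
    qed
    ultimately show "\<exists>T. open T \<and> w \<in> T \<and> T \<subseteq> V"
      by blast
  qed
  define H where "H w = (if w \<in> U then D w else E w)" for w
  have HE: "H w = E w" if "w \<in> V" for w
    using that DE by (auto simp: H_def V_def)
  have sum_hol: "(\<lambda>w. \<Sum>\<gamma>\<leftarrow>\<Delta>. g \<gamma> w) holomorphic_on S"
    if "\<And>\<gamma>. \<gamma> \<in> set \<Delta> \<Longrightarrow> (\<lambda>w. g \<gamma> w) holomorphic_on S" for S \<Delta> and g :: "(real \<Rightarrow> complex) \<Rightarrow> complex \<Rightarrow> complex"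
    using that by (induction \<Delta>) (auto intro!: holomorphic_intros)
  have "D holomorphic_on U"
    unfolding D_def using \<Gamma> by (intro sum_hol contour_integral_divided_difference_holomorphic[OF U f]) auto
  then have HU: "H holomorphic_on U"
    by (rule holomorphic_transform) (simp add: H_def)
  have "E holomorphic_on V"
    unfolding E_def
  proof (rule sum_hol)
    fix \<gamma> assume "\<gamma> \<in> set \<Gamma>"
    then have \<gamma>: "valid_path \<gamma>" "path_image \<gamma> \<subseteq> U" "V \<subseteq> - path_image \<gamma>"
      using \<Gamma> by (auto simp: V_def)
    show "(\<lambda>w. contour_integral \<gamma> (\<lambda>z. f z / (z - w))) holomorphic_on V"
    proof (rule holomorphic_on_subset[OF _ \<gamma>(3)])
      have "(\<lambda>w. contour_integral \<gamma> (\<lambda>z. f z / (z - w))) field_differentiable at a"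
        if a: "a \<in> - path_image \<gamma>" for a
      proof -
        have "open (- path_image \<gamma>)"
          using \<gamma>(1) by (simp add: closed_valid_path_image open_Compl)
        then obtain r where r: "r > 0" "cball a r \<subseteq> - path_image \<gamma>"
          using a open_contains_cball by metis
        \<comment> \<open>Setting \<open>f\<close> to 0 near \<open>a\<close> turns the Cauchy integral into one of divided differences.\<close>
        define g where "g z = (if z \<in> ball a r then 0 else f z)" for z
        define U' where "U' = (U - cball a r) \<union> ball a r"
        have "open (U - cball a r)"
          using U by (simp add: open_Diff)
        moreover have "g holomorphic_on U - cball a r"
          by (rule holomorphic_transform[OF holomorphic_on_subset[OF f]]) (auto simp: g_def)
        moreover have "g holomorphic_on ball a r"
          by (rule holomorphic_transform[OF holomorphic_on_const[of 0]]) (auto simp: g_def)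
        ultimately have g: "g holomorphic_on U'" and U': "open U'"
          unfolding U'_def by (auto intro!: holomorphic_on_Un)
        have im: "path_image \<gamma> \<subseteq> U - cball a r"
          using \<gamma>(2) r(2) by blast
        have "(\<lambda>w. contour_integral \<gamma> (divided_difference g w)) holomorphic_on U'"
          by (rule contour_integral_divided_difference_holomorphic[OF U' g \<gamma>(1)]) (use im in \<open>auto simp: U'_def\<close>)
        then have "(\<lambda>w. contour_integral \<gamma> (divided_difference g w)) holomorphic_on ball a r"
          by (rule holomorphic_on_subset) (simp add: U'_def)
        then have "(\<lambda>w. contour_integral \<gamma> (\<lambda>z. f z / (z - w))) holomorphic_on ball a r"
        proof (rule holomorphic_transform)
          fix w assume w: "w \<in> ball a r"
          have "divided_difference g w z = f z / (z - w)" if "z \<in> path_image \<gamma>" for z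
          proof -
            have "z \<notin> cball a r"
              using that im by blast
            then show ?thesis
              using w by (auto simp: divided_difference_def g_def)
          qed
          then show "contour_integral \<gamma> (divided_difference g w) = contour_integral \<gamma> (\<lambda>z. f z / (z - w))"
            by (intro contour_integral_eq) auto
        qed
        then show ?thesis
          using r(1) by (intro holomorphic_on_imp_differentiable_at[of _ "ball a r"]) auto
      qed
      then show "(\<lambda>w. contour_integral \<gamma> (\<lambda>z. f z / (z - w))) holomorphic_on - path_image \<gamma>"
        by (auto simp: holomorphic_on_def field_differentiable_at_within)
    qed
  qed
  then have HV: "H holomorphic_on V"
    by (rule holomorphic_transform) (simp add: HE)
  have hol: "H holomorphic_on UNIV"
    using holomorphic_on_Un[OF HU HV U \<open>open V\<close>] by (simp add: UV)
  have bdd: "bounded (\<Union>\<gamma>\<in>set \<Gamma>. path_image \<gamma>)"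
    using \<Gamma> by (intro bounded_UN) (auto simp: bounded_valid_path_image)
  have lim: "(H \<longlongrightarrow> 0) at_infinity"
  proof (rule Lim_transform_eventually)
    have "((\<lambda>w. \<Sum>\<gamma>\<leftarrow>\<Delta>. contour_integral \<gamma> (\<lambda>z. f z / (z - w))) \<longlongrightarrow> 0) at_infinity" if "set \<Delta> \<subseteq> set \<Gamma>" for \<Delta>
      using that
    proof (induction \<Delta>)
      case (Cons \<gamma> \<Delta>)
      then have "((\<lambda>w. contour_integral \<gamma> (\<lambda>z. f z / (z - w))) \<longlongrightarrow> 0) at_infinity"
        using \<Gamma>[of \<gamma>] by (intro tendsto_contour_integral_cauchy_kernel_at_infinity[OF U f]) auto
      from tendsto_add[OF this Cons.IH] Cons.prems show ?case
        by simp
    qed simp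
    then show "(E \<longlongrightarrow> 0) at_infinity"
      unfolding E_def by blast
    obtain B where B: "\<And>\<gamma> x. \<gamma> \<in> set \<Gamma> \<Longrightarrow> x \<in> path_image \<gamma> \<Longrightarrow> cmod x < B"
      using bdd by (auto simp: bounded_pos_less)
    have "w \<in> V" if "B \<le> cmod w" for w
    proof -
      have n: "w \<notin> path_image \<gamma>" if "\<gamma> \<in> set \<Gamma>" for \<gamma>
        using B[OF that, of w] \<open>B \<le> cmod w\<close> by auto
      have "winding_number \<gamma> w = 0" if "\<gamma> \<in> set \<Gamma>" for \<gamma>
      proof (rule winding_number_zero_outside)
        show "path_image \<gamma> \<subseteq> ball 0 B" "w \<notin> ball 0 B"
          using B[OF that] \<open>B \<le> cmod w\<close> by auto
      qed (use \<Gamma>[OF that] valid_path_imp_path in auto)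
      then have "(\<Sum>\<gamma>\<leftarrow>\<Gamma>. winding_number \<gamma> w) = (\<Sum>\<gamma>\<leftarrow>\<Gamma>. 0)"
        by (intro arg_cong[of _ _ sum_list] map_cong) auto
      then show ?thesis
        using n by (simp add: V_def)
    qed
    then show "eventually (\<lambda>w. E w = H w) at_infinity"
      using HE unfolding eventually_at_infinity by (intro exI[of _ B]) auto
  qed
  have "D w = 0"
    using Liouville_weak_0[OF hol lim, of w] w(1) by (simp add: H_def)
  then show ?thesis
    using DE[of w] w by (simp add: E_def)
qed

section \<open>Completeness of \<open>L\<^sup>2\<close>\<close>

lemma norm_l2: "norm f = l2_norm_fun (fun_of f)"
  by (simp add: norm_l2_def)

lemma fun_of_diff: "AE x in lebesgue. fun_of (f - g) x = fun_of f x - fun_of g x"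
  unfolding minus_l2_def
  using fun_of_l2_of[OF square_integrable_diff[OF square_integrable_fun_of square_integrable_fun_of]]
  by simp

lemma fun_of_measurable [measurable]: "fun_of f \<in> borel_measurable lebesgue"
  using square_integrable_fun_of[of f] by (simp add: square_integrable_def)

lemma nn_integral_fun_of: "(\<integral>\<^sup>+x. ennreal ((cmod (fun_of f x))\<^sup>2) \<partial>lebesgue) = ennreal ((norm f)\<^sup>2)"
  using square_integrable_fun_of[of f]
  by (simp add: norm_l2 l2_norm_fun_power2 square_integrable_def nn_integral_eq_integral)

lemma nn_integral_fun_of_diff:
  "(\<integral>\<^sup>+x. ennreal ((cmod (fun_of f x - fun_of g x))\<^sup>2) \<partial>lebesgue) = ennreal ((norm (f - g))\<^sup>2)"
proof -
  have "AE x in lebesgue. ennreal ((cmod (fun_of f x - fun_of g x))\<^sup>2) = ennreal ((cmod (fun_of (f - g) x))\<^sup>2)"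
    using fun_of_diff[of f g] by eventually_elim simp
  then show ?thesis
    using nn_integral_cong_AE nn_integral_fun_of by metis
qed

lemma square_integrable_iff_nn_integral:
  assumes [measurable]: "f \<in> borel_measurable lebesgue"
  shows "square_integrable f \<longleftrightarrow> (\<integral>\<^sup>+x. ennreal ((cmod (f x))\<^sup>2) \<partial>lebesgue) < \<infinity>"
  by (simp add: square_integrable_def integrable_iff_bounded)

text \<open>
  Every term of the series is at most its sum \<open>C\<close>, so the increments are at most \<open>sqrt C / 2 ^ n\<close>.
\<close>

lemma convergent_if_increments_square_summable:
  fixes a :: "nat \<Rightarrow> complex"
  assumes fin: "(\<Sum>n. ennreal (4 ^ n * (cmod (a (Suc n) - a n))\<^sup>2)) \<noteq> \<infinity>"
  shows "convergent a"
proof -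
  define h where "h n = 4 ^ n * (cmod (a (Suc n) - a n))\<^sup>2" for n
  define C where "C = enn2real (\<Sum>n. ennreal (h n))"
  have "summable (\<lambda>n. norm (a (Suc n) - a n))"
  proof (rule summable_comparison_test')
    show "summable (\<lambda>n. (1 / 2) ^ n * sqrt C)"
      by (rule summable_mult2) (rule summable_geometric, simp)
    fix n :: nat
    have "ennreal (h n) \<le> (\<Sum>n. ennreal (h n))"
      using sum_le_suminf[of "\<lambda>n. ennreal (h n)" "{n}"] by simp
    also have "\<dots> = ennreal C"
      using fin by (simp add: C_def h_def top.not_eq_extremum)
    finally have "h n \<le> C"
      by (subst (asm) ennreal_le_iff) (simp_all add: C_def)
    moreover have "h n = (2 ^ n * cmod (a (Suc n) - a n))\<^sup>2"
      by (simp add: h_def power_mult_distrib power_even_eq[symmetric] power_mult)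
    ultimately have "2 ^ n * cmod (a (Suc n) - a n) \<le> sqrt C"
      using real_le_rsqrt by metis
    then have "(1 / 2) ^ n * (2 ^ n * cmod (a (Suc n) - a n)) \<le> (1 / 2) ^ n * sqrt C"
      by (intro mult_left_mono) auto
    moreover have "(1 / 2) ^ n * (2 ^ n * t) = t" for t :: real
      by (simp add: mult.assoc[symmetric] flip: power_mult_distrib)
    ultimately show "norm (norm (a (Suc n) - a n)) \<le> (1 / 2) ^ n * sqrt C"
      by simp
  qed
  from summable_norm_cancel[OF this] have "convergent (\<lambda>n. \<Sum>k<n. a (Suc k) - a k)"
    unfolding summable_iff_convergent .
  then have "convergent (\<lambda>n. a n - a 0)"
    by (subst (asm) sum_lessThan_telescope)
  from convergent_add[OF this convergent_const[of "a 0"]] show "convergent a"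
    by simp
qed

text \<open>
  The theorem of Riesz and Fischer.  A subsequence with rapidly decreasing increments converges almost
  everywhere, and Fatou's lemma shows that its pointwise limit is also the limit in the norm.
\<close>

instance l2 :: banach
proof
  fix X :: "nat \<Rightarrow> l2"
  assume "Cauchy X"
  have "\<exists>N. \<forall>m\<ge>N. \<forall>k\<ge>N. norm (X m - X k) < (1 / 4) ^ n" for n
    using CauchyD[OF \<open>Cauchy X\<close>, of "(1 / 4) ^ n"] by simp
  then obtain N where N: "\<And>n m k. m \<ge> N n \<Longrightarrow> k \<ge> N n \<Longrightarrow> norm (X m - X k) < (1 / 4) ^ n"
    by metis
  \<comment> \<open>Partial sums, so that \<open>r m\<close> is at least each of \<open>N 0, \<dots>, N m\<close>.\<close>
  define r where "r n = (\<Sum>i\<le>n. N i)" for n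
  have r: "N n \<le> r m" if "n \<le> m" for n m
    unfolding r_def using that by (intro member_le_sum) auto
  define f where "f n = fun_of (X (r n))" for n
  have f_meas [measurable]: "f n \<in> borel_measurable lebesgue" for n
    by (simp add: f_def)
  have f_close: "(\<integral>\<^sup>+x. ennreal ((cmod (f m x - f n x))\<^sup>2) \<partial>lebesgue) \<le> ennreal ((1 / 16) ^ n)" if "n \<le> m" for n m
  proof -
    have "(norm (X (r m) - X (r n)))\<^sup>2 \<le> ((1 / 4) ^ n)\<^sup>2"
      using N[OF r[OF that] r[of n n]] by (intro power_mono) auto
    also have "((1 / 4) ^ n)\<^sup>2 = (1 / 16 :: real) ^ n"
      by (simp add: power2_eq_square flip: power_mult_distrib)
    finally show ?thesis
      by (simp add: f_def nn_integral_fun_of_diff)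
  qed
  \<comment> \<open>The squared increments have integral at most \<open>16\<^sup>-\<^sup>n\<close>, which leaves room for the weights \<open>4 ^ n\<close>.\<close>
  have "(\<integral>\<^sup>+x. (\<Sum>n. ennreal (4 ^ n * (cmod (f (Suc n) x - f n x))\<^sup>2)) \<partial>lebesgue)
      = (\<Sum>n. \<integral>\<^sup>+x. ennreal (4 ^ n * (cmod (f (Suc n) x - f n x))\<^sup>2) \<partial>lebesgue)"
    by (rule nn_integral_suminf) measurable
  also have "\<dots> \<le> (\<Sum>n. ennreal ((1 / 4) ^ n))"
  proof (intro suminf_le)
    fix n
    have "(\<integral>\<^sup>+x. ennreal (4 ^ n * (cmod (f (Suc n) x - f n x))\<^sup>2) \<partial>lebesgue)
        = ennreal (4 ^ n) * (\<integral>\<^sup>+x. ennreal ((cmod (f (Suc n) x - f n x))\<^sup>2) \<partial>lebesgue)"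
      by (subst nn_integral_cmult[symmetric]) (auto simp: ennreal_mult)
    also have "\<dots> \<le> ennreal (4 ^ n) * ennreal ((1 / 16) ^ n)"
      by (intro mult_left_mono f_close) auto
    also have "\<dots> = ennreal ((1 / 4) ^ n)"
      by (simp flip: ennreal_mult power_mult_distrib)
    finally show "(\<integral>\<^sup>+x. ennreal (4 ^ n * (cmod (f (Suc n) x - f n x))\<^sup>2) \<partial>lebesgue) \<le> ennreal ((1 / 4) ^ n)" .
  qed auto
  also have "\<dots> < \<infinity>"
    by (simp add: suminf_ennreal_eq[OF _ summable_sums[OF summable_geometric]])
  finally have sum_finite: "(\<integral>\<^sup>+x. (\<Sum>n. ennreal (4 ^ n * (cmod (f (Suc n) x - f n x))\<^sup>2)) \<partial>lebesgue) < \<infinity>" .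
  from sum_finite have "AE x in lebesgue. (\<Sum>n. ennreal (4 ^ n * (cmod (f (Suc n) x - f n x))\<^sup>2)) \<noteq> \<infinity>"
    by (intro nn_integral_PInf_AE) auto
  then have conv: "AE x in lebesgue. convergent (\<lambda>n. f n x)"
    by eventually_elim (rule convergent_if_increments_square_summable)
  define g where "g x = lim (\<lambda>n. f n x)" for x
  have [measurable]: "g \<in> borel_measurable lebesgue"
    unfolding g_def by measurable
  have g_close: "(\<integral>\<^sup>+x. ennreal ((cmod (g x - f n x))\<^sup>2) \<partial>lebesgue) \<le> ennreal ((1 / 16) ^ n)" for n
  proof -
    have "AE x in lebesgue. ennreal ((cmod (g x - f n x))\<^sup>2) = liminf (\<lambda>m. ennreal ((cmod (f m x - f n x))\<^sup>2))"
      using conv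
    proof eventually_elim
      fix x assume "convergent (\<lambda>n. f n x)"
      then have "(\<lambda>m. f m x) \<longlonglongrightarrow> g x"
        by (simp add: g_def convergent_LIMSEQ_iff)
      then have "(\<lambda>m. ennreal ((cmod (f m x - f n x))\<^sup>2)) \<longlonglongrightarrow> ennreal ((cmod (g x - f n x))\<^sup>2)"
        by (intro tendsto_ennrealI tendsto_intros)
      then show "ennreal ((cmod (g x - f n x))\<^sup>2) = liminf (\<lambda>m. ennreal ((cmod (f m x - f n x))\<^sup>2))"
        by (rule lim_imp_Liminf[OF sequentially_bot, symmetric])
    qed
    then have "(\<integral>\<^sup>+x. ennreal ((cmod (g x - f n x))\<^sup>2) \<partial>lebesgue)
        = (\<integral>\<^sup>+x. liminf (\<lambda>m. ennreal ((cmod (f m x - f n x))\<^sup>2)) \<partial>lebesgue)"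
      by (rule nn_integral_cong_AE)
    also have "\<dots> \<le> liminf (\<lambda>m. \<integral>\<^sup>+x. ennreal ((cmod (f m x - f n x))\<^sup>2) \<partial>lebesgue)"
      by (rule nn_integral_liminf) measurable
    also have "\<dots> \<le> ennreal ((1 / 16) ^ n)"
      by (rule order_trans[OF Liminf_le_Limsup Limsup_bounded])
        (auto intro!: eventually_sequentiallyI[of n] f_close)
    finally show ?thesis .
  qed
  have d: "square_integrable (\<lambda>x. g x - f n x)" for n
    by (subst square_integrable_iff_nn_integral) (auto intro: le_less_trans[OF g_close])
  have "square_integrable (\<lambda>x. (g x - f 0 x) + f 0 x)"
    by (intro square_integrable_add d) (simp add: f_def square_integrable_fun_of)
  then have g: "square_integrable g"
    by simp
  have lim: "norm (l2_of g - X (r n)) \<le> (1 / 4) ^ n" for n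
  proof -
    have "AE x in lebesgue. ennreal ((cmod (fun_of (l2_of g) x - fun_of (X (r n)) x))\<^sup>2) = ennreal ((cmod (g x - f n x))\<^sup>2)"
      using fun_of_l2_of[OF g] by eventually_elim (simp add: f_def)
    then have "ennreal ((norm (l2_of g - X (r n)))\<^sup>2) \<le> ennreal ((1 / 16) ^ n)"
      using g_close[of n] unfolding nn_integral_fun_of_diff[symmetric] by (subst nn_integral_cong_AE)
    then have "(norm (l2_of g - X (r n)))\<^sup>2 \<le> (1 / 16) ^ n"
      by (simp add: ennreal_le_iff)
    also have "\<dots> = ((1 / 4) ^ n)\<^sup>2"
      by (simp add: power2_eq_square flip: power_mult_distrib)
    finally show ?thesis
      by (rule power2_le_imp_le) simp
  qed
  have "X \<longlonglongrightarrow> l2_of g"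
  proof (rule LIMSEQ_I)
    fix e :: real assume "e > 0"
    then obtain n where n: "(1 / 4) ^ n < e / 2"
      using real_arch_pow_inv[of "e / 2" "1 / 4"] by auto
    have "norm (X m - l2_of g) < e" if "m \<ge> N n" for m
      using norm_triangle_ineq[of "X m - X (r n)" "X (r n) - l2_of g"] N[OF that r[of n n]] lim[of n] n
      by (simp add: norm_minus_commute)
    then show "\<exists>no. \<forall>m\<ge>no. norm (X m - l2_of g) < e"
      by blast
  qed
  then show "convergent X"
    by (auto simp: convergent_def)
qed

lemma ext_zero_add: "ext_zero (f + g) = ext_zero f + ext_zero g"
  by (rule plus_l2_plus.rep_eq)

lemma ext_zero_scaleC: "ext_zero (c *\<^sub>C f) = c *\<^sub>C ext_zero f"
  by (rule scaleC_l2_plus.rep_eq)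

lemma ext_zero_scaleR: "ext_zero (r *\<^sub>R f) = r *\<^sub>R ext_zero f"
  by (simp add: ext_zero_scaleC flip: scaleC_of_real)

lemma ext_zero_diff: "ext_zero (f - g) = ext_zero f - ext_zero g"
  using ext_zero_add[of "f - g" g] by (simp add: algebra_simps)

lemma norm_ext_zero: "norm (ext_zero f) = norm f"
  by (rule norm_l2_plus.rep_eq[symmetric])

lemma fun_of_ext_zero: "AE x in lebesgue. x \<le> 0 \<longrightarrow> fun_of (ext_zero f) x = 0"
  using ext_zero[of f] by simp

text \<open>
  The functions that vanish on the negative half-line form a closed subspace.
\<close>

instance l2_plus :: banach
proof
  fix X :: "nat \<Rightarrow> l2_plus"
  assume "Cauchy X"
  then have "Cauchy (\<lambda>n. ext_zero (X n))"
    by (simp add: Cauchy_def dist_norm norm_ext_zero flip: ext_zero_diff)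
  then obtain g where g: "(\<lambda>n. ext_zero (X n)) \<longlonglongrightarrow> g"
    using Cauchy_convergent_iff convergent_def by blast
  have [measurable]: "{..0::real} \<in> sets lebesgue"
    by simp
  have le: "(\<integral>\<^sup>+x. ennreal ((cmod (fun_of g x))\<^sup>2) * indicator {..0} x \<partial>lebesgue)
      \<le> ennreal ((norm (g - ext_zero (X n)))\<^sup>2)" for n
  proof -
    have "AE x in lebesgue. ennreal ((cmod (fun_of g x))\<^sup>2) * indicator {..0} x
        \<le> ennreal ((cmod (fun_of g x - fun_of (ext_zero (X n)) x))\<^sup>2)"
      using fun_of_ext_zero[of "X n"] by eventually_elim (auto simp: indicator_def)
    from nn_integral_mono_AE[OF this] show ?thesis
      by (simp add: nn_integral_fun_of_diff)
  qed
  have "(\<lambda>n. ennreal ((norm (g - ext_zero (X n)))\<^sup>2)) \<longlonglongrightarrow> ennreal ((norm (g - g))\<^sup>2)"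
    by (intro tendsto_ennrealI tendsto_intros g)
  from tendsto_lowerbound[OF this always_eventually[OF allI[OF le]]]
  have "(\<integral>\<^sup>+x. ennreal ((cmod (fun_of g x))\<^sup>2) * indicator {..0} x \<partial>lebesgue) = 0"
    by simp
  then have "AE x in lebesgue. ennreal ((cmod (fun_of g x))\<^sup>2) * indicator {..0} x = 0"
    by (subst (asm) nn_integral_0_iff_AE) measurable
  then have "AE x in lebesgue. x \<le> 0 \<longrightarrow> fun_of g x = 0"
    by eventually_elim (auto simp: indicator_def split: if_splits)
  then have "ext_zero (restr_plus g) = g"
    by (simp add: restr_plus_inverse)
  then have "norm (X n - restr_plus g) = norm (ext_zero (X n) - g)" for n
    by (simp add: ext_zero_diff flip: norm_ext_zero)
  then have "X \<longlonglongrightarrow> restr_plus g"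
    using g by (simp add: LIMSEQ_iff)
  then show "convergent X"
    by (auto simp: convergent_def)
qed

section \<open>Hausdorff operators on \<open>L\<^sup>2\<close>\<close>

text \<open>
  The weight \<open>u\<^sup>-\<^sup>1\<^sup>/\<^sup>2\<close> is the norm of the dilation \<open>f \<mapsto> f (u \<cdot>)\<close>
  on \<open>L\<^sup>2\<close>, so that the weighted norm of a kernel bounds the norm of its Hausdorff operator.
\<close>

definition mellin_kernel :: "(real \<Rightarrow> complex) \<Rightarrow> bool" where
  "mellin_kernel K \<longleftrightarrow> K \<in> borel_measurable lebesgue \<and> (AE u in lebesgue. u \<le> 0 \<longrightarrow> K u = 0) \<and>
     integrable lebesgue (\<lambda>u. cmod (K u) * u powr (- 1 / 2))"

definition kernel_norm :: "(real \<Rightarrow> complex) \<Rightarrow> real" where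
  "kernel_norm K = (LINT u|lebesgue. cmod (K u) * u powr (- 1 / 2))"

text \<open>
  For Lebesgue measurable \<open>f\<close> the function \<open>(u, x) \<mapsto> f (u x)\<close> need not be measurable for
  the product of the \<open>\<sigma>\<close>-algebras, as Tonelli's theorem requires; it is for Borel measurable \<open>f\<close>.
\<close>

lemma borel_representative:
  fixes f :: "real \<Rightarrow> complex"
  assumes [measurable]: "f \<in> borel_measurable lebesgue"
  obtains g where "g \<in> borel_measurable borel" "AE x in lborel. f x = g x"
proof -
  have "(\<lambda>x. Re (f x)) \<in> borel_measurable lebesgue" "(\<lambda>x. Im (f x)) \<in> borel_measurable lebesgue"
    by measurable
  from this[THEN completion_ex_borel_measurable_real] obtain a b
    where [measurable]: "a \<in> borel_measurable borel" "b \<in> borel_measurable borel"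
      and ab: "AE x in lborel. Re (f x) = a x" "AE x in lborel. Im (f x) = b x"
    by auto
  show thesis
  proof
    show "(\<lambda>x. complex_of_real (a x) + \<i> * complex_of_real (b x)) \<in> borel_measurable borel"
      by measurable
    show "AE x in lborel. f x = complex_of_real (a x) + \<i> * complex_of_real (b x)"
      using ab by eventually_elim (simp add: complex_eq_iff)
  qed
qed

lemma AE_lborel_scale:
  assumes "AE x in lborel. P x" "c \<noteq> (0::real)"
  shows "AE x in lborel. P (c * x)"
proof -
  from assms(1) obtain N where N: "{x. \<not> P x} \<subseteq> N" "N \<in> null_sets lborel"
    by (auto elim!: AE_E2 simp: eventually_ae_filter)
  then have "AE x in lborel. x \<notin> N"
    using AE_not_in by blast
  then have "AE x in lborel. 0 + c * x \<notin> N"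
    using N(2) by (intro AE_borel_affine[OF assms(2)]) (auto simp: null_sets_def)
  then show ?thesis
    by eventually_elim (use N(1) in auto)
qed

lemma AE_lborel_nonzero: "AE x in lborel. x \<noteq> (0::real)"
  using AE_lborel_singleton[of 0] by simp

lemma mellin_kernel_representative:
  assumes K: "mellin_kernel K"
  obtains K' where "K' \<in> borel_measurable borel" "\<And>u. u \<le> 0 \<Longrightarrow> K' u = 0" "AE u in lborel. K u = K' u"
    "(\<integral>\<^sup>+u. ennreal (cmod (K' u) * u powr (- 1 / 2)) \<partial>lborel) = ennreal (kernel_norm K)"
proof -
  have m: "K \<in> borel_measurable lebesgue" and z: "AE u in lborel. u \<le> 0 \<longrightarrow> K u = 0"
    and int: "integrable lebesgue (\<lambda>u. cmod (K u) * u powr (- 1 / 2))"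
    using K by (simp_all add: mellin_kernel_def AE_completion_iff)
  from borel_representative[OF m] obtain g
    where [measurable]: "g \<in> borel_measurable borel" and g: "AE u in lborel. K u = g u"
    by blast
  define K' where "K' u = (if u \<le> 0 then 0 else g u)" for u
  show thesis
  proof
    show "K' \<in> borel_measurable borel"
      unfolding K'_def by measurable
    show "K' u = 0" if "u \<le> 0" for u
      using that by (simp add: K'_def)
    show eq: "AE u in lborel. K u = K' u"
      using g z by eventually_elim (auto simp: K'_def)
    have "(\<integral>\<^sup>+u. ennreal (cmod (K' u) * u powr (- 1 / 2)) \<partial>lborel)
        = (\<integral>\<^sup>+u. ennreal (cmod (K u) * u powr (- 1 / 2)) \<partial>lborel)"
      by (rule nn_integral_cong_AE) (use eq in eventually_elim, simp)
    also have "\<dots> = (\<integral>\<^sup>+u. ennreal (cmod (K u) * u powr (- 1 / 2)) \<partial>lebesgue)"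
      by (simp add: nn_integral_completion)
    also have "\<dots> = ennreal (kernel_norm K)"
      unfolding kernel_norm_def by (rule nn_integral_eq_integral[OF int]) auto
    finally show "(\<integral>\<^sup>+u. ennreal (cmod (K' u) * u powr (- 1 / 2)) \<partial>lborel) = ennreal (kernel_norm K)" .
  qed
qed

lemma kernel_norm_nonneg: "0 \<le> kernel_norm K"
  by (simp add: kernel_norm_def)

lemma mellin_kernelI_borel:
  assumes "K \<in> borel_measurable borel" "\<And>u. u \<le> 0 \<Longrightarrow> K u = 0"
    and "integrable lborel (\<lambda>u. cmod (K u) * u powr (- 1 / 2))"
  shows "mellin_kernel K"
  using assms by (auto simp: mellin_kernel_def integrable_completion intro: measurable_completion)

text \<open>
  The Cauchy-Schwarz inequality for the factors \<open>k\<^sup>1\<^sup>/\<^sup>2 u\<^sup>-\<^sup>1\<^sup>/\<^sup>4\<close> and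
  \<open>k\<^sup>1\<^sup>/\<^sup>2 u\<^sup>1\<^sup>/\<^sup>4 f (u x)\<close>, followed by Tonelli's theorem: integration of
  \<open>(f (u x))\<^sup>2\<close> over \<open>x\<close> produces a factor \<open>1 / u\<close>, which turns the weight
  \<open>u\<^sup>1\<^sup>/\<^sup>2\<close> into \<open>u\<^sup>-\<^sup>1\<^sup>/\<^sup>2\<close>.
\<close>

lemma hausdorff_L2_bound:
  fixes k :: "real \<Rightarrow> real" and f :: "real \<Rightarrow> ennreal"
  assumes [measurable]: "k \<in> borel_measurable borel" "f \<in> borel_measurable borel"
    and k0: "\<And>u. 0 \<le> k u" "\<And>u. u \<le> 0 \<Longrightarrow> k u = 0"
  shows "(\<integral>\<^sup>+x. (\<integral>\<^sup>+u. ennreal (k u) * f (u * x) \<partial>lborel)\<^sup>2 \<partial>lborel)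
    \<le> (\<integral>\<^sup>+u. ennreal (k u * u powr (- 1 / 2)) \<partial>lborel)\<^sup>2 * (\<integral>\<^sup>+x. (f x)\<^sup>2 \<partial>lborel)"
proof -
  define W where "W = (\<integral>\<^sup>+u. ennreal (k u * u powr (- 1 / 2)) \<partial>lborel)"
  have 1: "(\<integral>\<^sup>+u. ennreal (k u) * f (u * x) \<partial>lborel)\<^sup>2
      \<le> W * (\<integral>\<^sup>+u. ennreal (k u * u powr (1 / 2)) * (f (u * x))\<^sup>2 \<partial>lborel)" for x
  proof -
    have "ennreal (k u) * f (u * x)
        = ennreal (sqrt (k u) * u powr (- 1 / 4)) * (ennreal (sqrt (k u) * u powr (1 / 4)) * f (u * x))" for u
    proof (cases "u \<le> 0")
      case False
      then have "sqrt (k u) * u powr (- 1 / 4) * (sqrt (k u) * u powr (1 / 4)) = k u * (u powr (- 1 / 4) * u powr (1 / 4))"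
        using k0(1)[of u] by simp
      also have "\<dots> = k u"
        using False by (simp flip: powr_add)
      finally show ?thesis
        using k0(1)[of u] by (simp add: mult.assoc[symmetric] ennreal_mult''[symmetric])
    qed (simp add: k0)
    then have "(\<integral>\<^sup>+u. ennreal (k u) * f (u * x) \<partial>lborel)\<^sup>2
        \<le> (\<integral>\<^sup>+u. (ennreal (sqrt (k u) * u powr (- 1 / 4)))\<^sup>2 \<partial>lborel)
          * (\<integral>\<^sup>+u. (ennreal (sqrt (k u) * u powr (1 / 4)) * f (u * x))\<^sup>2 \<partial>lborel)"
      by (simp only:) (rule Cauchy_Schwarz_nn_integral; measurable)
    also have "(\<integral>\<^sup>+u. (ennreal (sqrt (k u) * u powr (- 1 / 4)))\<^sup>2 \<partial>lborel) = W"
      unfolding W_def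
    proof (rule nn_integral_cong)
      fix u
      show "(ennreal (sqrt (k u) * u powr (- 1 / 4)))\<^sup>2 = ennreal (k u * u powr (- 1 / 2))"
        using k0[of u] by (cases "u \<le> 0") (simp_all add: ennreal_power power_mult_distrib powr_power)
    qed
    also have "(\<integral>\<^sup>+u. (ennreal (sqrt (k u) * u powr (1 / 4)) * f (u * x))\<^sup>2 \<partial>lborel)
        = (\<integral>\<^sup>+u. ennreal (k u * u powr (1 / 2)) * (f (u * x))\<^sup>2 \<partial>lborel)"
    proof (rule nn_integral_cong)
      fix u
      show "(ennreal (sqrt (k u) * u powr (1 / 4)) * f (u * x))\<^sup>2 = ennreal (k u * u powr (1 / 2)) * (f (u * x))\<^sup>2"
        using k0[of u] by (cases "u \<le> 0") (simp_all add: ennreal_power power_mult_distrib powr_power)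
    qed
    finally show ?thesis .
  qed
  have 2: "ennreal (k u * u powr (1 / 2)) * (\<integral>\<^sup>+x. (f (u * x))\<^sup>2 \<partial>lborel)
      = ennreal (k u * u powr (- 1 / 2)) * (\<integral>\<^sup>+x. (f x)\<^sup>2 \<partial>lborel)" for u
  proof (cases "u \<le> 0")
    case False
    then have "(\<integral>\<^sup>+x. (f x)\<^sup>2 \<partial>lborel) = ennreal u * (\<integral>\<^sup>+x. (f (u * x))\<^sup>2 \<partial>lborel)"
      using nn_integral_real_affine[of "\<lambda>x. (f x)\<^sup>2" u 0] by simp
    moreover have "u powr (- 1 / 2) * u = u powr (1 / 2)"
      using False powr_add[of u "- 1 / 2" 1] by simp
    ultimately show ?thesis
      using False k0(1)[of u]
      by (simp add: mult.assoc[symmetric] ennreal_mult''[symmetric]) (simp add: mult.assoc)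
  qed (simp add: k0)
  have "(\<integral>\<^sup>+x. (\<integral>\<^sup>+u. ennreal (k u) * f (u * x) \<partial>lborel)\<^sup>2 \<partial>lborel)
      \<le> (\<integral>\<^sup>+x. W * (\<integral>\<^sup>+u. ennreal (k u * u powr (1 / 2)) * (f (u * x))\<^sup>2 \<partial>lborel) \<partial>lborel)"
    by (intro nn_integral_mono 1)
  also have "\<dots> = W * (\<integral>\<^sup>+x. (\<integral>\<^sup>+u. ennreal (k u * u powr (1 / 2)) * (f (u * x))\<^sup>2 \<partial>lborel) \<partial>lborel)"
    by (rule nn_integral_cmult) measurable
  also have "(\<integral>\<^sup>+x. (\<integral>\<^sup>+u. ennreal (k u * u powr (1 / 2)) * (f (u * x))\<^sup>2 \<partial>lborel) \<partial>lborel)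
      = (\<integral>\<^sup>+u. (\<integral>\<^sup>+x. ennreal (k u * u powr (1 / 2)) * (f (u * x))\<^sup>2 \<partial>lborel) \<partial>lborel)"
    by (rule lborel_pair.Fubini') measurable
  also have "\<dots> = (\<integral>\<^sup>+u. ennreal (k u * u powr (1 / 2)) * (\<integral>\<^sup>+x. (f (u * x))\<^sup>2 \<partial>lborel) \<partial>lborel)"
    by (intro nn_integral_cong nn_integral_cmult) measurable
  also have "\<dots> = W * (\<integral>\<^sup>+x. (f x)\<^sup>2 \<partial>lborel)"
    unfolding 2 W_def by (rule nn_integral_multc) measurable
  finally show ?thesis
    by (simp add: W_def power2_eq_square mult.assoc)
qed

lemma hausdorff_integrand_scale:
  assumes "AE u in lborel. K u = K' u" "AE x in lborel. f x = f' x" "x \<noteq> (0::real)"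
  shows "AE u in lborel. K u * f (u * x) = (K' u * f' (u * x) :: complex)"
  using assms(1) AE_lborel_scale[OF assms(2,3)] by eventually_elim (simp add: mult.commute)

lemma lebesgue_measurable_scale:
  assumes [measurable]: "f \<in> borel_measurable lebesgue"
  shows "(\<lambda>u::real. f (u * x)) \<in> borel_measurable lebesgue"
proof -
  have "(\<lambda>u. f (x *\<^sub>R u)) \<in> borel_measurable lebesgue"
    by measurable
  then show ?thesis
    by (simp add: mult.commute)
qed

text \<open>
  A dilation by \<open>x \<noteq> 0\<close> preserves null sets, so the integral does not see the choice of the
  representatives.
\<close>

lemma hausdorff_integral_representative:
  fixes K f :: "real \<Rightarrow> complex"
  assumes [measurable]: "K \<in> borel_measurable lebesgue" "f \<in> borel_measurable lebesgue"
      "K' \<in> borel_measurable borel" "f' \<in> borel_measurable borel"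
    and ae: "AE u in lborel. K u = K' u" "AE x in lborel. f x = f' x" and x: "x \<noteq> 0"
  shows "integrable lebesgue (\<lambda>u. K u * f (u * x)) \<longleftrightarrow> integrable lborel (\<lambda>u. K' u * f' (u * x))"
    and "(LINT u|lebesgue. K u * f (u * x)) = (LINT u|lborel. K' u * f' (u * x))"
proof -
  note [measurable] = lebesgue_measurable_scale[of f]
  have m: "(\<lambda>u. K u * f (u * x)) \<in> borel_measurable lebesgue"
    by measurable
  have m': "(\<lambda>u. K' u * f' (u * x)) \<in> borel_measurable lborel"
    by measurable
  have eq: "AE u in lebesgue. K u * f (u * x) = K' u * f' (u * x)"
    unfolding AE_completion_iff by (rule hausdorff_integrand_scale[OF ae x])
  show "integrable lebesgue (\<lambda>u. K u * f (u * x)) \<longleftrightarrow> integrable lborel (\<lambda>u. K' u * f' (u * x))"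
    using integrable_cong_AE[OF m measurable_completion[OF m'] eq] integrable_completion[OF m'] by simp
  show "(LINT u|lebesgue. K u * f (u * x)) = (LINT u|lborel. K' u * f' (u * x))"
    using integral_cong_AE[OF m measurable_completion[OF m'] eq] integral_completion[OF m'] by simp
qed

lemma hausdorff_integral:
  assumes K: "mellin_kernel K" and f: "square_integrable f"
  shows "AE x in lebesgue. integrable lebesgue (\<lambda>u. K u * f (u * x))"
    and "square_integrable (\<lambda>x. LINT u|lebesgue. K u * f (u * x))"
    and "l2_norm_fun (\<lambda>x. LINT u|lebesgue. K u * f (u * x)) \<le> kernel_norm K * l2_norm_fun f"
proof -
  have Km: "K \<in> borel_measurable lebesgue"
    using K by (simp add: mellin_kernel_def)
  have fm: "f \<in> borel_measurable lebesgue" and fi: "integrable lebesgue (\<lambda>x. (cmod (f x))\<^sup>2)"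
    using f by (simp_all add: square_integrable_def)
  from mellin_kernel_representative[OF K] obtain K'
    where [measurable]: "K' \<in> borel_measurable borel"
      and K': "\<And>u. u \<le> 0 \<Longrightarrow> K' u = 0" "AE u in lborel. K u = K' u"
        "(\<integral>\<^sup>+u. ennreal (cmod (K' u) * u powr (- 1 / 2)) \<partial>lborel) = ennreal (kernel_norm K)"
    by blast
  from borel_representative[OF fm] obtain f'
    where [measurable]: "f' \<in> borel_measurable borel" and f': "AE x in lborel. f x = f' x"
    by blast
  note rep = hausdorff_integral_representative[OF Km fm \<open>K' \<in> borel_measurable borel\<close> \<open>f' \<in> borel_measurable borel\<close> K'(2) f']
  define h where "h x = (\<integral>\<^sup>+u. ennreal (cmod (K' u)) * ennreal (cmod (f' (u * x))) \<partial>lborel)" for x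
  define g where "g x = (LINT u|lborel. K' u * f' (u * x))" for x
  have [measurable]: "h \<in> borel_measurable borel" "g \<in> borel_measurable borel"
    unfolding h_def g_def by measurable
  have norm_f: "(\<integral>\<^sup>+x. (ennreal (cmod (f' x)))\<^sup>2 \<partial>lborel) = ennreal ((l2_norm_fun f)\<^sup>2)"
  proof -
    have "(\<integral>\<^sup>+x. (ennreal (cmod (f' x)))\<^sup>2 \<partial>lborel) = (\<integral>\<^sup>+x. ennreal ((cmod (f x))\<^sup>2) \<partial>lborel)"
      by (rule nn_integral_cong_AE) (use f' in eventually_elim, simp add: ennreal_power)
    also have "\<dots> = (\<integral>\<^sup>+x. ennreal ((cmod (f x))\<^sup>2) \<partial>lebesgue)"
      by (simp add: nn_integral_completion)
    also have "\<dots> = ennreal ((l2_norm_fun f)\<^sup>2)"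
      unfolding l2_norm_fun_power2 by (rule nn_integral_eq_integral[OF fi]) auto
    finally show ?thesis .
  qed
  have bound: "(\<integral>\<^sup>+x. (h x)\<^sup>2 \<partial>lborel) \<le> ennreal ((kernel_norm K * l2_norm_fun f)\<^sup>2)"
  proof -
    have "(\<integral>\<^sup>+x. (h x)\<^sup>2 \<partial>lborel)
        \<le> (\<integral>\<^sup>+u. ennreal (cmod (K' u) * u powr (- 1 / 2)) \<partial>lborel)\<^sup>2 * (\<integral>\<^sup>+x. (ennreal (cmod (f' x)))\<^sup>2 \<partial>lborel)"
      unfolding h_def by (rule hausdorff_L2_bound) (auto simp: K'(1))
    also have "\<dots> = ennreal ((kernel_norm K * l2_norm_fun f)\<^sup>2)"
      unfolding K'(3) norm_f by (simp add: ennreal_power ennreal_mult'' power_mult_distrib kernel_norm_nonneg)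
    finally show ?thesis .
  qed
  have "(\<integral>\<^sup>+x. (h x)\<^sup>2 \<partial>lborel) \<noteq> \<infinity>"
    using le_less_trans[OF bound ennreal_less_top] by simp
  then have "AE x in lborel. (h x)\<^sup>2 \<noteq> \<infinity>"
    by (intro nn_integral_PInf_AE) auto
  then have int: "AE x in lborel. integrable lborel (\<lambda>u. K' u * f' (u * x))"
  proof eventually_elim
    fix x assume "(h x)\<^sup>2 \<noteq> \<infinity>"
    then have "h x < \<infinity>"
      by (auto simp: less_top power2_eq_square ennreal_mult_eq_top_iff)
    then show "integrable lborel (\<lambda>u. K' u * f' (u * x))"
      by (simp add: integrable_iff_bounded h_def norm_mult ennreal_mult)
  qed
  show "AE x in lebesgue. integrable lebesgue (\<lambda>u. K u * f (u * x))"
    unfolding AE_completion_iff using int AE_lborel_nonzero by eventually_elim (simp add: rep)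
  have eq: "AE x in lborel. (LINT u|lebesgue. K u * f (u * x)) = g x"
    using AE_lborel_nonzero by eventually_elim (simp add: rep g_def)
  have gm: "g \<in> borel_measurable lebesgue"
    by (rule measurable_completion) measurable
  have m: "(\<lambda>x. LINT u|lebesgue. K u * f (u * x)) \<in> borel_measurable lebesgue"
    by (rule borel_measurable_AE[OF gm]) (use eq in \<open>auto simp: AE_completion_iff eq_commute\<close>)
  have "ennreal ((cmod (g x))\<^sup>2) \<le> (h x)\<^sup>2" for x
  proof -
    have "ennreal (cmod (g x)) \<le> h x"
      using integral_norm_bound_ennreal[of lborel "\<lambda>u. K' u * f' (u * x)"]
      unfolding g_def h_def
      by (cases "integrable lborel (\<lambda>u. K' u * f' (u * x))")
        (auto simp: norm_mult ennreal_mult not_integrable_integral_eq)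
    then show ?thesis
      by (simp add: power_mono flip: ennreal_power)
  qed
  then have "(\<integral>\<^sup>+x. ennreal ((cmod (g x))\<^sup>2) \<partial>lborel) \<le> ennreal ((kernel_norm K * l2_norm_fun f)\<^sup>2)"
    by (intro order_trans[OF nn_integral_mono bound])
  moreover have "(\<integral>\<^sup>+x. ennreal ((cmod (LINT u|lebesgue. K u * f (u * x)))\<^sup>2) \<partial>lebesgue)
      = (\<integral>\<^sup>+x. ennreal ((cmod (g x))\<^sup>2) \<partial>lborel)"
    unfolding nn_integral_completion
    by (rule nn_integral_cong_AE) (use eq in eventually_elim, simp)
  ultimately have fin: "(\<integral>\<^sup>+x. ennreal ((cmod (LINT u|lebesgue. K u * f (u * x)))\<^sup>2) \<partial>lebesgue)
      \<le> ennreal ((kernel_norm K * l2_norm_fun f)\<^sup>2)"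
    by simp
  show sq: "square_integrable (\<lambda>x. LINT u|lebesgue. K u * f (u * x))"
    using fin by (simp add: square_integrable_iff_nn_integral[OF m] le_less_trans[OF _ ennreal_less_top])
  have "ennreal ((l2_norm_fun (\<lambda>x. LINT u|lebesgue. K u * f (u * x)))\<^sup>2)
      = (\<integral>\<^sup>+x. ennreal ((cmod (LINT u|lebesgue. K u * f (u * x)))\<^sup>2) \<partial>lebesgue)"
    using sq by (simp add: l2_norm_fun_power2 square_integrable_def nn_integral_eq_integral)
  with fin have "ennreal ((l2_norm_fun (\<lambda>x. LINT u|lebesgue. K u * f (u * x)))\<^sup>2) \<le> ennreal ((kernel_norm K * l2_norm_fun f)\<^sup>2)"
    by (simp only:)
  then have "(l2_norm_fun (\<lambda>x. LINT u|lebesgue. K u * f (u * x)))\<^sup>2 \<le> (kernel_norm K * l2_norm_fun f)\<^sup>2"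
    by (subst (asm) ennreal_le_iff) auto
  then show "l2_norm_fun (\<lambda>x. LINT u|lebesgue. K u * f (u * x)) \<le> kernel_norm K * l2_norm_fun f"
    by (rule power2_le_imp_le) (simp add: kernel_norm_nonneg l2_norm_fun_nonneg)
qed

lemma blinfun_l2_eqI:
  assumes "\<And>f. AE x in lebesgue. fun_of (blinfun_apply S f) x = fun_of (blinfun_apply T f) x"
  shows "S = T"
  by (intro blinfun_eqI l2_eqI assms)

lemma fun_of_scaleR: "AE x in lebesgue. fun_of (r *\<^sub>R f) x = of_real r * fun_of f x"
  using fun_of_scaleC[of "of_real r" f] by (simp add: scaleC_of_real)

lemma AE_lebesgue_scale:
  assumes "AE x in lebesgue. P x" "c \<noteq> (0::real)"
  shows "AE x in lebesgue. P (x * c)"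
  using AE_lborel_scale[of P c] assms unfolding AE_completion_iff by (simp add: mult.commute)

lemma AE_lebesgue_nonzero: "AE x in lebesgue. x \<noteq> (0::real)"
  unfolding AE_completion_iff by (rule AE_lborel_nonzero)

lemma hausdorff_integral_cong:
  fixes K f :: "real \<Rightarrow> complex"
  assumes K: "AE u in lebesgue. K u = K' u" and f: "AE x in lebesgue. f x = f' x" and x: "x \<noteq> 0"
    and m: "K \<in> borel_measurable lebesgue" "f \<in> borel_measurable lebesgue"
  shows "(LINT u|lebesgue. K u * f (u * x)) = (LINT u|lebesgue. K' u * f' (u * x) :: complex)"
proof -
  have eq: "AE u in lebesgue. K u * f (u * x) = K' u * f' (u * x)"
    using K AE_lebesgue_scale[OF f x] by eventually_elim simp
  have m': "(\<lambda>u. K u * f (u * x)) \<in> borel_measurable lebesgue"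
    using m lebesgue_measurable_scale by (intro borel_measurable_times)
  show ?thesis
    by (rule integral_cong_AE[OF m' borel_measurable_AE[OF m' eq] eq])
qed

lemma hausdorff_op_exists:
  assumes K: "mellin_kernel K"
  shows "\<exists>T. (\<forall>f. AE x in lebesgue. fun_of (blinfun_apply T f) x = (LINT u|lebesgue. K u * fun_of f (u * x)))
    \<and> norm T \<le> kernel_norm K"
proof -
  define I where "I f x = (LINT u|lebesgue. K u * fun_of f (u * x))" for f x
  define H where "H f = l2_of (I f)" for f
  have Km: "K \<in> borel_measurable lebesgue"
    using K by (simp add: mellin_kernel_def)
  have sq: "square_integrable (I f)" and bound: "l2_norm_fun (I f) \<le> kernel_norm K * norm f"
    and int: "AE x in lebesgue. integrable lebesgue (\<lambda>u. K u * fun_of f (u * x))" for f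
    using hausdorff_integral[OF K square_integrable_fun_of[of f]] by (simp_all add: I_def[abs_def] norm_l2)
  have H: "AE x in lebesgue. fun_of (H f) x = I f x" for f
    unfolding H_def by (rule fun_of_l2_of[OF sq])
  have H_norm: "norm (H f) \<le> kernel_norm K * norm f" for f
  proof -
    have "l2_eq (fun_of (H f)) (I f)"
      using H by (simp add: l2_eq_def sq square_integrable_fun_of)
    from l2_norm_fun_cong[OF this] bound[of f] show ?thesis
      by (simp add: norm_l2)
  qed
  have bl: "bounded_linear H"
  proof (rule bounded_linear_intro)
    fix f g :: l2 and r :: real
    show "H (f + g) = H f + H g"
    proof (rule l2_eqI)
      have "AE x in lebesgue. I (f + g) x = I f x + I g x"
        using int[of f] int[of g] AE_lebesgue_nonzero
      proof eventually_elim
        case (elim x)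
        have "I (f + g) x = (LINT u|lebesgue. K u * (fun_of f (u * x) + fun_of g (u * x)))"
          unfolding I_def
          by (rule hausdorff_integral_cong[where f' = "\<lambda>x. fun_of f x + fun_of g x", OF _ fun_of_add elim(3) Km]) auto
        also have "\<dots> = I f x + I g x"
          using elim by (simp add: I_def distrib_left)
        finally show ?case .
      qed
      then show "AE x in lebesgue. fun_of (H (f + g)) x = fun_of (H f + H g) x"
        using H[of "f + g"] H[of f] H[of g] fun_of_add[of "H f" "H g"] by eventually_elim simp
    qed
    show "H (r *\<^sub>R f) = r *\<^sub>R H f"
    proof (rule l2_eqI)
      have "AE x in lebesgue. I (r *\<^sub>R f) x = of_real r * I f x"
        using AE_lebesgue_nonzero
      proof eventually_elim
        case (elim x)
        have "I (r *\<^sub>R f) x = (LINT u|lebesgue. K u * (of_real r * fun_of f (u * x)))"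
          unfolding I_def
          by (rule hausdorff_integral_cong[where f' = "\<lambda>x. of_real r * fun_of f x", OF _ fun_of_scaleR elim Km]) auto
        then show ?case
          by (simp add: I_def mult.left_commute[of _ "complex_of_real r"])
      qed
      then show "AE x in lebesgue. fun_of (H (r *\<^sub>R f)) x = fun_of (r *\<^sub>R H f) x"
        using H[of "r *\<^sub>R f"] H[of f] fun_of_scaleR[of r "H f"] by eventually_elim simp
    qed
    show "norm (H f) \<le> norm f * kernel_norm K"
      using H_norm[of f] by (simp add: mult.commute)
  qed
  show ?thesis
  proof (intro exI conjI allI)
    show "AE x in lebesgue. fun_of (blinfun_apply (Blinfun H) f) x = (LINT u|lebesgue. K u * fun_of f (u * x))" for f
      using H[of f] by (simp add: bounded_linear_Blinfun_apply[OF bl] I_def)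
    show "norm (Blinfun H) \<le> kernel_norm K"
      by (rule norm_blinfun_bound[OF kernel_norm_nonneg]) (simp add: bounded_linear_Blinfun_apply[OF bl] H_norm)
  qed
qed

lemma hausdorff_op:
  assumes "mellin_kernel K"
  shows "AE x in lebesgue. fun_of (blinfun_apply (hausdorff_op K) f) x = (LINT u|lebesgue. K u * fun_of f (u * x))"
    and "norm (hausdorff_op K) \<le> kernel_norm K"
proof -
  obtain T where T: "\<And>f. AE x in lebesgue. fun_of (blinfun_apply T f) x = (LINT u|lebesgue. K u * fun_of f (u * x))"
      "norm T \<le> kernel_norm K"
    using hausdorff_op_exists[OF assms] by blast
  have "hausdorff_op K = T"
    unfolding hausdorff_op_def
  proof (rule the_equality)
    fix S assume S: "\<forall>f. AE x in lebesgue. fun_of (blinfun_apply S f) x = (LINT u|lebesgue. K u * fun_of f (u * x))"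
    show "S = T"
    proof (rule blinfun_l2_eqI)
      show "AE x in lebesgue. fun_of (blinfun_apply S f) x = fun_of (blinfun_apply T f) x" for f
        using S[rule_format, of f] T(1)[of f] by eventually_elim simp
    qed
  qed (use T in blast)
  then show "AE x in lebesgue. fun_of (blinfun_apply (hausdorff_op K) f) x = (LINT u|lebesgue. K u * fun_of f (u * x))"
    and "norm (hausdorff_op K) \<le> kernel_norm K"
    using T by auto
qed

lemma l2_plus_eqI:
  assumes "AE x in lebesgue. 0 < x \<longrightarrow> fun_of (ext_zero f) x = fun_of (ext_zero g) x"
  shows "f = g"
proof -
  have "AE x in lebesgue. fun_of (ext_zero f) x = fun_of (ext_zero g) x"
    using assms fun_of_ext_zero[of f] fun_of_ext_zero[of g]
  proof eventually_elim
    case (elim x)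
    then show ?case
      by (cases "0 < x") auto
  qed
  then have "ext_zero f = ext_zero g"
    by (rule l2_eqI)
  then show ?thesis
    by (simp add: ext_zero_inject)
qed

lemma blinfun_l2_plus_eqI:
  assumes "\<And>f. AE x in lebesgue. 0 < x \<longrightarrow>
      fun_of (ext_zero (blinfun_apply S f)) x = fun_of (ext_zero (blinfun_apply T f)) x"
  shows "S = T"
  by (intro blinfun_eqI l2_plus_eqI assms)

text \<open>
  For \<open>x < 0\<close> and \<open>u > 0\<close> the argument \<open>u x\<close> is negative.
\<close>

lemma hausdorff_op_invariant:
  assumes K: "mellin_kernel K"
  shows "AE x in lebesgue. x \<le> 0 \<longrightarrow> fun_of (blinfun_apply (hausdorff_op K) (ext_zero f)) x = 0"
  using hausdorff_op(1)[OF K, of "ext_zero f"] AE_lebesgue_nonzero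
proof eventually_elim
  case (elim x)
  show ?case
  proof
    assume "x \<le> 0"
    with elim have "x < 0"
      by simp
    have "AE u in lebesgue. u \<le> 0 \<longrightarrow> K u = 0"
      using K by (simp add: mellin_kernel_def)
    then have "AE u in lebesgue. K u * fun_of (ext_zero f) (u * x) = 0"
      using AE_lebesgue_scale[OF fun_of_ext_zero[of f] elim(2)]
    proof eventually_elim
      case (elim u)
      then show ?case
        using \<open>x < 0\<close> by (cases "u \<le> 0") (auto simp: mult_le_0_iff)
    qed
    then show "fun_of (blinfun_apply (hausdorff_op K) (ext_zero f)) x = 0"
      unfolding elim(1) by (rule integral_eq_zero_AE)
  qed
qed

lemma hausdorff_op_plus:
  assumes K: "mellin_kernel K"
  shows "ext_zero (blinfun_apply (hausdorff_op_plus K) f) = blinfun_apply (hausdorff_op K) (ext_zero f)"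
    and "norm (hausdorff_op_plus K) \<le> kernel_norm K"
proof -
  define H where "H f = restr_plus (blinfun_apply (hausdorff_op K) (ext_zero f))" for f
  have ext_H: "ext_zero (H f) = blinfun_apply (hausdorff_op K) (ext_zero f)" for f
    unfolding H_def by (rule restr_plus_inverse) (use hausdorff_op_invariant[OF K] in simp)
  have H_norm: "norm (H f) \<le> norm f * kernel_norm K" for f
    using order_trans[OF norm_blinfun[of "hausdorff_op K" "ext_zero f"] mult_right_mono[OF hausdorff_op(2)[OF K]]]
    by (simp add: ext_H mult.commute flip: norm_ext_zero)
  have bl: "bounded_linear H"
  proof (rule bounded_linear_intro)
    show "H (f + g) = H f + H g" for f g
      by (simp add: ext_H ext_zero_add blinfun.add_right flip: ext_zero_inject)
    show "H (r *\<^sub>R f) = r *\<^sub>R H f" for r f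
      by (simp add: ext_H ext_zero_scaleR blinfun.scaleR_right flip: ext_zero_inject)
  qed (rule H_norm)
  have "hausdorff_op_plus K = Blinfun H"
    unfolding hausdorff_op_plus_def
  proof (rule the_equality)
    show "\<forall>f. ext_zero (blinfun_apply (Blinfun H) f) = blinfun_apply (hausdorff_op K) (ext_zero f)"
      by (simp add: bounded_linear_Blinfun_apply[OF bl] ext_H)
    show "S = Blinfun H" if "\<forall>f. ext_zero (blinfun_apply S f) = blinfun_apply (hausdorff_op K) (ext_zero f)" for S
      using that by (intro blinfun_eqI) (simp add: bounded_linear_Blinfun_apply[OF bl] ext_H flip: ext_zero_inject)
  qed
  then show "ext_zero (blinfun_apply (hausdorff_op_plus K) f) = blinfun_apply (hausdorff_op K) (ext_zero f)"
    and "norm (hausdorff_op_plus K) \<le> kernel_norm K"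
    using norm_blinfun_bound[OF kernel_norm_nonneg, of "Blinfun H" K] H_norm
    by (simp_all add: bounded_linear_Blinfun_apply[OF bl] ext_H mult.commute)
qed

lemma fun_of_hausdorff_op_plus:
  assumes "mellin_kernel K"
  shows "AE x in lebesgue. fun_of (ext_zero (blinfun_apply (hausdorff_op_plus K) f)) x
    = (LINT u|lebesgue. K u * fun_of (ext_zero f) (u * x))"
  using hausdorff_op(1)[OF assms] by (simp add: hausdorff_op_plus(1)[OF assms])

lemma hausdorff_op_plus_cong:
  assumes K: "mellin_kernel K" "mellin_kernel L" and eq: "AE u in lebesgue. K u = L u"
  shows "hausdorff_op_plus K = hausdorff_op_plus L"
proof (rule blinfun_l2_plus_eqI)
  fix f
  show "AE x in lebesgue. 0 < x \<longrightarrow> fun_of (ext_zero (blinfun_apply (hausdorff_op_plus K) f)) x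
      = fun_of (ext_zero (blinfun_apply (hausdorff_op_plus L) f)) x"
    using fun_of_hausdorff_op_plus[OF K(1), of f] fun_of_hausdorff_op_plus[OF K(2), of f] AE_lebesgue_nonzero
  proof eventually_elim
    case (elim x)
    have "(LINT u|lebesgue. K u * fun_of (ext_zero f) (u * x)) = (LINT u|lebesgue. L u * fun_of (ext_zero f) (u * x))"
      by (rule hausdorff_integral_cong[OF eq _ elim(3)]) (use K in \<open>auto simp: mellin_kernel_def\<close>)
    then show ?case
      using elim by simp
  qed
qed

lemma mellin_kernel_add:
  assumes "mellin_kernel K" "mellin_kernel L"
  shows "mellin_kernel (\<lambda>u. K u + L u)"
proof -
  have [measurable]: "K \<in> borel_measurable lebesgue" "L \<in> borel_measurable lebesgue"
    using assms by (simp_all add: mellin_kernel_def)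
  have [measurable]: "(\<lambda>u::real. u powr (- 1 / 2)) \<in> borel_measurable lebesgue"
    by (rule measurable_completion) measurable
  have "integrable lebesgue (\<lambda>u. cmod (K u + L u) * u powr (- 1 / 2))"
  proof (rule Bochner_Integration.integrable_bound)
    show "integrable lebesgue (\<lambda>u. cmod (K u) * u powr (- 1 / 2) + cmod (L u) * u powr (- 1 / 2))"
      using assms by (intro Bochner_Integration.integrable_add) (simp_all add: mellin_kernel_def)
    show "AE u in lebesgue. norm (cmod (K u + L u) * u powr (- 1 / 2))
        \<le> norm (cmod (K u) * u powr (- 1 / 2) + cmod (L u) * u powr (- 1 / 2))"
      by (intro AE_I2) (simp add: norm_triangle_ineq mult_right_mono flip: distrib_right)
  qed measurable
  moreover have "AE u in lebesgue. u \<le> 0 \<longrightarrow> K u + L u = 0"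
    using assms unfolding mellin_kernel_def by (elim conjE) (rule eventually_elim2, auto)
  ultimately show ?thesis
    by (simp add: mellin_kernel_def)
qed

lemma mellin_kernel_scale:
  assumes "mellin_kernel K"
  shows "mellin_kernel (\<lambda>u. c * K u)" "kernel_norm (\<lambda>u. c * K u) = cmod c * kernel_norm K"
  using assms by (auto simp: mellin_kernel_def kernel_norm_def norm_mult mult.assoc)

lemma hausdorff_op_plus_add:
  assumes K: "mellin_kernel K" "mellin_kernel L"
  shows "hausdorff_op_plus (\<lambda>u. K u + L u) = hausdorff_op_plus K + hausdorff_op_plus L"
proof (rule blinfun_l2_plus_eqI)
  fix f
  have "AE x in lebesgue. (LINT u|lebesgue. (K u + L u) * fun_of (ext_zero f) (u * x))
      = (LINT u|lebesgue. K u * fun_of (ext_zero f) (u * x)) + (LINT u|lebesgue. L u * fun_of (ext_zero f) (u * x))"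
    using hausdorff_integral(1)[OF K(1) square_integrable_fun_of[of "ext_zero f"]]
      hausdorff_integral(1)[OF K(2) square_integrable_fun_of[of "ext_zero f"]]
    by eventually_elim (simp add: distrib_right)
  then show "AE x in lebesgue. 0 < x \<longrightarrow> fun_of (ext_zero (blinfun_apply (hausdorff_op_plus (\<lambda>u. K u + L u)) f)) x
      = fun_of (ext_zero (blinfun_apply (hausdorff_op_plus K + hausdorff_op_plus L) f)) x"
    using fun_of_hausdorff_op_plus[OF K(1), of f] fun_of_hausdorff_op_plus[OF K(2), of f]
      fun_of_hausdorff_op_plus[OF mellin_kernel_add[OF K], of f]
      fun_of_add[of "ext_zero (blinfun_apply (hausdorff_op_plus K) f)" "ext_zero (blinfun_apply (hausdorff_op_plus L) f)"]
    unfolding blinfun.add_left ext_zero_add by eventually_elim simp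
qed

lemma hausdorff_op_plus_scale:
  assumes K: "mellin_kernel K"
  shows "hausdorff_op_plus (\<lambda>u. c * K u) = scalar_op c o\<^sub>L hausdorff_op_plus K"
proof (rule blinfun_l2_plus_eqI)
  fix f
  show "AE x in lebesgue. 0 < x \<longrightarrow> fun_of (ext_zero (blinfun_apply (hausdorff_op_plus (\<lambda>u. c * K u)) f)) x
      = fun_of (ext_zero (blinfun_apply (scalar_op c o\<^sub>L hausdorff_op_plus K) f)) x"
    using fun_of_hausdorff_op_plus[OF K, of f] fun_of_hausdorff_op_plus[OF mellin_kernel_scale(1)[OF K], of c f]
      fun_of_scaleC[of c "ext_zero (blinfun_apply (hausdorff_op_plus K) f)"]
    unfolding blinfun_apply_blinfun_compose scalar_op.rep_eq ext_zero_scaleC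
    by eventually_elim (simp add: mult.assoc)
qed

lemma hausdorff_op_plus_scale_right:
  assumes K: "mellin_kernel K"
  shows "hausdorff_op_plus K o\<^sub>L scalar_op c = scalar_op c o\<^sub>L hausdorff_op_plus K"
proof (rule blinfun_l2_plus_eqI)
  fix f
  have "AE x in lebesgue. (LINT u|lebesgue. K u * fun_of (c *\<^sub>C ext_zero f) (u * x))
      = c * (LINT u|lebesgue. K u * fun_of (ext_zero f) (u * x))"
    using AE_lebesgue_nonzero
  proof eventually_elim
    case (elim x)
    have "(LINT u|lebesgue. K u * fun_of (c *\<^sub>C ext_zero f) (u * x))
        = (LINT u|lebesgue. K u * (c * fun_of (ext_zero f) (u * x)))"
      by (rule hausdorff_integral_cong[where f' = "\<lambda>x. c * fun_of (ext_zero f) x", OF _ fun_of_scaleC elim])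
        (use K in \<open>auto simp: mellin_kernel_def\<close>)
    then show ?case
      by (simp add: mult.left_commute[of _ c])
  qed
  then show "AE x in lebesgue. 0 < x \<longrightarrow> fun_of (ext_zero (blinfun_apply (hausdorff_op_plus K o\<^sub>L scalar_op c) f)) x
      = fun_of (ext_zero (blinfun_apply (scalar_op c o\<^sub>L hausdorff_op_plus K) f)) x"
    using fun_of_hausdorff_op_plus[OF K, of f] fun_of_hausdorff_op_plus[OF K, of "c *\<^sub>C f"]
      fun_of_scaleC[of c "ext_zero (blinfun_apply (hausdorff_op_plus K) f)"]
    unfolding blinfun_apply_blinfun_compose scalar_op.rep_eq ext_zero_scaleC
    by eventually_elim simp
qed

section \<open>Composition of Hausdorff operators\<close>

text \<open>
  The kernels with good pointwise behaviour: they vanish on all of the negative half-line, and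
  convolutions and contour integrals of them can be computed at every point.
\<close>

definition borel_kernel :: "(real \<Rightarrow> complex) \<Rightarrow> bool" where
  "borel_kernel K \<longleftrightarrow> K \<in> borel_measurable borel \<and> (\<forall>u\<le>0. K u = 0) \<and>
     integrable lborel (\<lambda>u. cmod (K u) * u powr (- 1 / 2))"

lemma borel_kernel_mellin_kernel: "borel_kernel K \<Longrightarrow> mellin_kernel K"
  by (auto simp: borel_kernel_def intro: mellin_kernelI_borel)

text \<open>
  The bound on \<open>L\<^sup>2\<close>, applied twice to absolute values, shows that the double integral is square
  integrable as a function of \<open>x\<close>, hence finite almost everywhere.  This justifies Fubini's theorem
  in the next lemmas.
\<close>

lemma double_integrand_finite:
  assumes K: "borel_kernel K" and L: "borel_kernel L"
    and [measurable]: "f \<in> borel_measurable borel" and f: "(\<integral>\<^sup>+x. ennreal ((cmod (f x))\<^sup>2) \<partial>lborel) < \<infinity>"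
  shows "AE x in lborel. (\<integral>\<^sup>+u. (\<integral>\<^sup>+v. ennreal (cmod (K u * (L v * f (v * (u * x))))) \<partial>lborel) \<partial>lborel) < \<infinity>"
proof -
  have [measurable]: "K \<in> borel_measurable borel" "L \<in> borel_measurable borel"
    using K L by (simp_all add: borel_kernel_def)
  have fin: "(\<integral>\<^sup>+u. ennreal (cmod (M u) * u powr (- 1 / 2)) \<partial>lborel)\<^sup>2 < \<infinity>" if "borel_kernel M" for M
    using that by (auto simp: borel_kernel_def integrable_iff_bounded power2_eq_square ennreal_mult_less_top abs_mult)
  define h where "h y = (\<integral>\<^sup>+v. ennreal (cmod (L v)) * ennreal (cmod (f (v * y))) \<partial>lborel)" for y
  have [measurable]: "h \<in> borel_measurable borel"
    unfolding h_def by measurable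
  have "(\<integral>\<^sup>+x. (h x)\<^sup>2 \<partial>lborel) \<le> (\<integral>\<^sup>+u. ennreal (cmod (L u) * u powr (- 1 / 2)) \<partial>lborel)\<^sup>2
      * (\<integral>\<^sup>+x. (ennreal (cmod (f x)))\<^sup>2 \<partial>lborel)"
    unfolding h_def by (rule hausdorff_L2_bound) (use L in \<open>auto simp: borel_kernel_def\<close>)
  also have "\<dots> < \<infinity>"
    using fin[OF L] f by (simp add: ennreal_power ennreal_mult_less_top)
  finally have h: "(\<integral>\<^sup>+x. (h x)\<^sup>2 \<partial>lborel) < \<infinity>" .
  have "(\<integral>\<^sup>+x. (\<integral>\<^sup>+u. ennreal (cmod (K u)) * h (u * x) \<partial>lborel)\<^sup>2 \<partial>lborel)
      \<le> (\<integral>\<^sup>+u. ennreal (cmod (K u) * u powr (- 1 / 2)) \<partial>lborel)\<^sup>2 * (\<integral>\<^sup>+x. (h x)\<^sup>2 \<partial>lborel)"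
    by (rule hausdorff_L2_bound) (use K in \<open>auto simp: borel_kernel_def\<close>)
  also have "\<dots> < \<infinity>"
    using fin[OF K] h by (simp add: ennreal_mult_less_top)
  finally have "AE x in lborel. (\<integral>\<^sup>+u. ennreal (cmod (K u)) * h (u * x) \<partial>lborel)\<^sup>2 \<noteq> \<infinity>"
    by (intro nn_integral_PInf_AE) auto
  then show ?thesis
  proof eventually_elim
    case (elim x)
    have "(\<integral>\<^sup>+v. ennreal (cmod (K u * (L v * f (v * (u * x))))) \<partial>lborel) = ennreal (cmod (K u)) * h (u * x)" for u
      unfolding h_def by (subst nn_integral_cmult[symmetric]) (auto simp: norm_mult ennreal_mult)
    with elim show ?case
      by (auto simp: less_top power2_eq_square ennreal_mult_eq_top_iff)
  qed
qed

lemma fun_of_representative: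
  obtains f' where "f' \<in> borel_measurable borel" "AE x in lborel. fun_of f x = f' x"
    "(\<integral>\<^sup>+x. ennreal ((cmod (f' x))\<^sup>2) \<partial>lborel) < \<infinity>"
proof -
  from borel_representative[OF fun_of_measurable[of f]] obtain f'
    where f': "f' \<in> borel_measurable borel" "AE x in lborel. fun_of f x = f' x"
    by blast
  have "(\<integral>\<^sup>+x. ennreal ((cmod (f' x))\<^sup>2) \<partial>lborel) = (\<integral>\<^sup>+x. ennreal ((cmod (fun_of f x))\<^sup>2) \<partial>lborel)"
    by (rule nn_integral_cong_AE) (use f'(2) in eventually_elim, simp)
  also have "\<dots> < \<infinity>"
    using nn_integral_fun_of[of f] by (simp add: nn_integral_completion)
  finally show thesis
    using that f' by blast
qed

lemma fun_of_hausdorff_op_plus_borel: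
  assumes K: "borel_kernel K" and g: "g \<in> borel_measurable borel" "AE x in lborel. fun_of (ext_zero f) x = g x"
  shows "AE x in lborel. fun_of (ext_zero (blinfun_apply (hausdorff_op_plus K) f)) x = (LINT u|lborel. K u * g (u * x))"
proof -
  have Kb: "K \<in> borel_measurable borel"
    using K by (simp add: borel_kernel_def)
  then have Km: "K \<in> borel_measurable lebesgue"
    by (intro measurable_completion) simp
  have "AE x in lborel. fun_of (ext_zero (blinfun_apply (hausdorff_op_plus K) f)) x
      = (LINT u|lebesgue. K u * fun_of (ext_zero f) (u * x))"
    using fun_of_hausdorff_op_plus[OF borel_kernel_mellin_kernel[OF K]] by (simp add: AE_completion_iff)
  then show ?thesis
    using AE_lborel_nonzero
  proof eventually_elim
    case (elim x)
    then show ?case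
      using hausdorff_integral_representative(2)[OF Km fun_of_measurable Kb g(1) _ g(2) elim(2)] by simp
  qed
qed

lemma hausdorff_compose_representation:
  assumes K: "borel_kernel K" and L: "borel_kernel L"
    and f: "f' \<in> borel_measurable borel" "AE x in lborel. fun_of (ext_zero f) x = f' x"
  shows "AE x in lborel. fun_of (ext_zero (blinfun_apply (hausdorff_op_plus K o\<^sub>L hausdorff_op_plus L) f)) x
    = (LINT u|lborel. (LINT v|lborel. K u * (L v * f' (v * (u * x)))))"
proof -
  have [measurable]: "L \<in> borel_measurable borel" "f' \<in> borel_measurable borel"
    using L f by (simp_all add: borel_kernel_def)
  have "(\<lambda>y. LINT v|lborel. L v * f' (v * y)) \<in> borel_measurable borel"
    by measurable
  from fun_of_hausdorff_op_plus_borel[OF K this fun_of_hausdorff_op_plus_borel[OF L f]]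
  show ?thesis
    by simp
qed

lemma double_integrand_integrable:
  assumes K: "borel_kernel K" and L: "borel_kernel L" and [measurable]: "f \<in> borel_measurable borel"
    and fin: "(\<integral>\<^sup>+u. (\<integral>\<^sup>+v. ennreal (cmod (K u * (L v * f (v * (u * x))))) \<partial>lborel) \<partial>lborel) < \<infinity>"
  shows "integrable (lborel \<Otimes>\<^sub>M lborel) (\<lambda>(u, v). K u * (L v * f (v * (u * x))))"
proof -
  have [measurable]: "K \<in> borel_measurable borel" "L \<in> borel_measurable borel"
    using K L by (simp_all add: borel_kernel_def)
  show ?thesis
    unfolding integrable_iff_bounded
  proof
    show "(\<integral>\<^sup>+p. ennreal (norm (case p of (u, v) \<Rightarrow> K u * (L v * f (v * (u * x))))) \<partial>(lborel \<Otimes>\<^sub>M lborel)) < \<infinity>"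
      using fin by (subst lborel.nn_integral_fst[symmetric]) simp_all
  qed measurable
qed

text \<open>
  The two compositions are one double integral, taken in the two possible orders.
\<close>

lemma hausdorff_op_plus_commute:
  assumes K: "borel_kernel K" and L: "borel_kernel L"
  shows "hausdorff_op_plus K o\<^sub>L hausdorff_op_plus L = hausdorff_op_plus L o\<^sub>L hausdorff_op_plus K"
proof (rule blinfun_l2_plus_eqI)
  fix f
  from fun_of_representative[of "ext_zero f"] obtain f' where f': "f' \<in> borel_measurable borel"
      "AE x in lborel. fun_of (ext_zero f) x = f' x" "(\<integral>\<^sup>+x. ennreal ((cmod (f' x))\<^sup>2) \<partial>lborel) < \<infinity>"
    by blast
  show "AE x in lebesgue. 0 < x \<longrightarrow>
      fun_of (ext_zero (blinfun_apply (hausdorff_op_plus K o\<^sub>L hausdorff_op_plus L) f)) x =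
      fun_of (ext_zero (blinfun_apply (hausdorff_op_plus L o\<^sub>L hausdorff_op_plus K) f)) x"
    unfolding AE_completion_iff
    using hausdorff_compose_representation[OF K L f'(1,2)] hausdorff_compose_representation[OF L K f'(1,2)]
      double_integrand_finite[OF K L f'(1,3)]
  proof eventually_elim
    case (elim x)
    have "(LINT u|lborel. (LINT v|lborel. K u * (L v * f' (v * (u * x)))))
        = (LINT v|lborel. (LINT u|lborel. K u * (L v * f' (v * (u * x)))))"
      using double_integrand_integrable[OF K L f'(1) elim(3)] by (rule lborel_pair.Fubini_integral[symmetric])
    then show ?case
      using elim(1,2) by (simp add: mult.left_commute)
  qed
qed

text \<open>
  The kernel \<open>J\<close> is the multiplicative convolution of \<open>K\<close> and \<open>L\<close>.  It appears when \<open>w = u v\<close> is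
  substituted in the inner integral and the order of integration is exchanged.
\<close>

lemma hausdorff_op_plus_compose:
  assumes K: "borel_kernel K" and L: "borel_kernel L" and J: "borel_kernel J"
    and conv: "\<And>w. 0 < w \<Longrightarrow> J w = (LINT u|lborel. K u / of_real u * L (w / u))"
  shows "hausdorff_op_plus K o\<^sub>L hausdorff_op_plus L = hausdorff_op_plus J"
proof (rule blinfun_l2_plus_eqI)
  fix f
  have [measurable]: "K \<in> borel_measurable borel" "L \<in> borel_measurable borel"
    and K0: "\<And>u. u \<le> 0 \<Longrightarrow> K u = 0" and L0: "\<And>u. u \<le> 0 \<Longrightarrow> L u = 0" and J0: "\<And>u. u \<le> 0 \<Longrightarrow> J u = 0"
    using K L J by (simp_all add: borel_kernel_def)
  have J_eq: "J w = (LINT u|lborel. K u / of_real u * L (w / u))" for w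
  proof (cases "0 < w")
    case False
    then have "(\<lambda>u. K u / of_real u * L (w / u)) = (\<lambda>u. 0)"
      by (intro ext) (metis K0 L0 divide_eq_0_iff divide_nonpos_pos linorder_not_le mult_zero_left mult_zero_right)
    then show ?thesis
      using False by (simp add: J0)
  qed (rule conv)
  from fun_of_representative[of "ext_zero f"] obtain f' where f': "f' \<in> borel_measurable borel"
      "AE x in lborel. fun_of (ext_zero f) x = f' x" "(\<integral>\<^sup>+x. ennreal ((cmod (f' x))\<^sup>2) \<partial>lborel) < \<infinity>"
    by blast
  note [measurable] = f'(1)
  show "AE x in lebesgue. 0 < x \<longrightarrow>
      fun_of (ext_zero (blinfun_apply (hausdorff_op_plus K o\<^sub>L hausdorff_op_plus L) f)) x =
      fun_of (ext_zero (blinfun_apply (hausdorff_op_plus J) f)) x"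
    unfolding AE_completion_iff
    using hausdorff_compose_representation[OF K L f'(1,2)] fun_of_hausdorff_op_plus_borel[OF J f'(1,2)]
      double_integrand_finite[OF K L f'(1,3)]
  proof eventually_elim
    case (elim x)
    have 1: "(LINT v|lborel. K u * (L v * f' (v * (u * x)))) = (LINT w|lborel. K u / of_real u * L (w / u) * f' (w * x))" for u
    proof (cases "u \<le> 0")
      case False
      then have "(LINT v|lborel. K u * (L v * f' (v * (u * x))))
          = (1 / u) *\<^sub>R (LINT w|lborel. K u * (L (w / u) * f' (w * x)))"
        using lborel_integral_real_affine[of "1 / u" "\<lambda>v. K u * (L v * f' (v * (u * x)))" 0] by simp
      also have "\<dots> = (LINT w|lborel. (1 / u) *\<^sub>R (K u * (L (w / u) * f' (w * x))))"
        by simp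
      also have "\<dots> = (LINT w|lborel. K u / of_real u * L (w / u) * f' (w * x))"
        by (rule Bochner_Integration.integral_cong) (simp_all add: scaleR_conv_of_real)
      finally show ?thesis .
    qed (simp add: K0)
    have 2: "(\<integral>\<^sup>+w. ennreal (cmod (K u / of_real u * L (w / u) * f' (w * x))) \<partial>lborel)
        = (\<integral>\<^sup>+v. ennreal (cmod (K u * (L v * f' (v * (u * x))))) \<partial>lborel)" for u
    proof (cases "u \<le> 0")
      case False
      then have "(\<integral>\<^sup>+v. ennreal (cmod (K u * (L v * f' (v * (u * x))))) \<partial>lborel)
          = ennreal (1 / u) * (\<integral>\<^sup>+w. ennreal (cmod (K u * (L (w / u) * f' (w * x)))) \<partial>lborel)"
        using nn_integral_real_affine[of "\<lambda>v. ennreal (cmod (K u * (L v * f' (v * (u * x)))))" "1 / u" 0] by simp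
      also have "\<dots> = (\<integral>\<^sup>+w. ennreal (1 / u) * ennreal (cmod (K u * (L (w / u) * f' (w * x)))) \<partial>lborel)"
        by (rule nn_integral_cmult[symmetric]) measurable
      also have "\<dots> = (\<integral>\<^sup>+w. ennreal (cmod (K u / of_real u * L (w / u) * f' (w * x))) \<partial>lborel)"
        using False by (intro nn_integral_cong) (simp add: norm_mult norm_divide flip: ennreal_mult)
      finally show ?thesis
        by simp
    qed (simp add: K0)
    have int: "integrable (lborel \<Otimes>\<^sub>M lborel) (\<lambda>(u, w). K u / of_real u * L (w / u) * f' (w * x))"
      unfolding integrable_iff_bounded
    proof
      show "(\<integral>\<^sup>+p. ennreal (norm (case p of (u, w) \<Rightarrow> K u / of_real u * L (w / u) * f' (w * x))) \<partial>(lborel \<Otimes>\<^sub>M lborel)) < \<infinity>"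
        using elim(3) unfolding 2[symmetric] by (subst lborel.nn_integral_fst[symmetric]) simp_all
    qed measurable
    have "(LINT u|lborel. (LINT v|lborel. K u * (L v * f' (v * (u * x)))))
        = (LINT w|lborel. (LINT u|lborel. K u / of_real u * L (w / u) * f' (w * x)))"
      unfolding 1 using int by (rule lborel_pair.Fubini_integral[symmetric])
    also have "\<dots> = (LINT w|lborel. J w * f' (w * x))"
      by (simp only: J_eq integral_mult_left_zero)
    finally show ?case
      using elim(1,2) by simp
  qed
qed

section \<open>Integrals of complex powers\<close>

definition unit_kernel :: "real \<Rightarrow> complex" where
  "unit_kernel u = (if 0 < u \<and> u < 1 then 1 else 0)"

text \<open>
  With \<open>a = 1 / z\<close> this is \<open>a\<^sup>2 u\<^sup>-\<^sup>a\<close> on \<open>(0, 1)\<close> for \<open>z\<close> outside the circle and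
  \<open>- a\<^sup>2 u\<^sup>-\<^sup>a\<close> on \<open>[1, \<infinity>)\<close> for \<open>z\<close> inside: the inverse Mellin transform of
  \<open>a\<^sup>2 / (s - a)\<close> along the line \<open>Re s = 1 / 2\<close>.  The point 1 belongs to the second interval only,
  because this makes the convolution formula below hold at every point.
\<close>

definition resolvent_kernel :: "complex \<Rightarrow> real \<Rightarrow> complex" where
  "resolvent_kernel z u =
     (if 1 < cmod (z - 1)
      then if 0 < u \<and> u < 1 then (inverse z)\<^sup>2 * exp (- inverse z * of_real (ln u)) else 0
      else if 1 \<le> u then - (inverse z)\<^sup>2 * exp (- inverse z * of_real (ln u)) else 0)"

text \<open>
  For \<open>u > 0\<close> the complex power \<open>u\<^sup>p\<close> is written \<open>exp (p * of_real (ln u))\<close> throughout.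
\<close>

lemma norm_exp_of_real_ln: "0 < u \<Longrightarrow> cmod (exp (p * of_real (ln u))) = u powr Re p"
  by (simp add: norm_exp_eq_Re powr_def)

lemma borel_measurable_exp_ln [measurable]: "(\<lambda>u::real. exp (p * complex_of_real (ln u))) \<in> borel_measurable borel"
  by measurable

lemma integrable_if_of_absolutely_integrable:
  fixes f :: "real \<Rightarrow> real"
  assumes "(f has_integral I) A" "\<And>x. x \<in> A \<Longrightarrow> 0 \<le> f x" "f \<in> borel_measurable borel" "A \<in> sets borel" "B \<in> sets borel" "B \<subseteq> A"
  shows "integrable lborel (\<lambda>x. if x \<in> B then f x else 0)"
proof -
  have "f absolutely_integrable_on A"
    using assms(1,2) by (intro nonnegative_absolutely_integrable_1) (auto simp: integrable_on_def)
  then have "f absolutely_integrable_on B"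
    using assms by (rule_tac set_integrable_subset) (auto simp: lborelD)
  moreover have "(\<lambda>x. indicator B x *\<^sub>R f x) \<in> borel_measurable lborel"
    using assms by measurable
  ultimately have "integrable lborel (\<lambda>x. indicator B x *\<^sub>R f x)"
    unfolding set_integrable_def by (simp add: integrable_completion)
  moreover have "(\<lambda>x. indicator B x *\<^sub>R f x) = (\<lambda>x. if x \<in> B then f x else 0)"
    by (auto simp: indicator_def)
  ultimately show ?thesis
    by simp
qed

lemma integrable_powr_unit_interval:
  assumes "-1 < a"
  shows "integrable lborel (\<lambda>u::real. if 0 < u \<and> u < 1 then u powr a else 0)"
proof -
  have "integrable lborel (\<lambda>u::real. if u \<in> {0<..<1} then u powr a else 0)"
    by (rule integrable_if_of_absolutely_integrable[OF has_integral_powr_from_0[OF assms, of 1]]) auto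
  then show ?thesis
    by simp
qed

lemma integrable_powr_to_infinity:
  assumes "a < -1" "0 < c"
  shows "integrable lborel (\<lambda>u::real. if c \<le> u then u powr a else 0)"
proof -
  have "integrable lborel (\<lambda>u::real. if u \<in> {c..} then u powr a else 0)"
    by (rule integrable_if_of_absolutely_integrable[OF has_integral_powr_to_inf[OF assms]]) auto
  then show ?thesis
    by simp
qed

lemma integrable_exp_ln_unit_interval:
  assumes "-1 < Re p"
  shows "integrable lborel (\<lambda>u. if 0 < u \<and> u < 1 then exp (p * of_real (ln u)) else 0)"
  by (rule Bochner_Integration.integrable_bound[OF integrable_powr_unit_interval[OF assms]])
    (auto simp: powr_def)

lemma integrable_exp_ln_to_infinity:
  assumes "Re p < -1" "0 < c"
  shows "integrable lborel (\<lambda>u. if c \<le> u then exp (p * of_real (ln u)) else 0)"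
  by (rule Bochner_Integration.integrable_bound[OF integrable_powr_to_infinity[OF assms]])
    (use assms in \<open>auto simp: powr_def\<close>)

lemma exp_ln_has_vector_derivative:
  fixes p :: complex
  assumes "p \<noteq> 0" "0 < u"
  shows "((\<lambda>u. exp (p * of_real (ln u)) / p) has_vector_derivative exp ((p - 1) * of_real (ln u))) (at u)"
proof -
  have "((\<lambda>u. complex_of_real (ln u)) has_vector_derivative of_real (1 / u)) (at u)"
    using assms(2) by (intro has_vector_derivative_of_real DERIV_ln_divide) 
  from has_vector_derivative_mult_right[OF this, of p]
  have "((\<lambda>u. p * complex_of_real (ln u)) has_vector_derivative p * of_real (1 / u)) (at u)" .
  moreover have "((\<lambda>w. exp w / p) has_field_derivative exp (p * of_real (ln u)) / p) (at (p * of_real (ln u)))"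
    using assms(1) by (auto intro!: derivative_eq_intros)
  ultimately have "((\<lambda>w. exp w / p) \<circ> (\<lambda>u. p * complex_of_real (ln u)) has_vector_derivative
      p * of_real (1 / u) * (exp (p * of_real (ln u)) / p)) (at u)"
    by (rule field_vector_diff_chain_at)
  moreover have "p * of_real (1 / u) * (exp (p * of_real (ln u)) / p) = exp ((p - 1) * of_real (ln u))"
    using assms by (simp add: left_diff_distrib exp_diff exp_of_real)
  ultimately show ?thesis
    by (simp add: o_def)
qed

lemma exp_ln_isCont: "0 < u \<Longrightarrow> isCont (\<lambda>u. exp (p * complex_of_real (ln u))) u"
  by (intro continuous_intros) auto

lemma exp_ln_tendsto_at_right_0:
  assumes "0 < Re p"
  shows "((\<lambda>u. exp (p * complex_of_real (ln u))) \<longlongrightarrow> 0) (at_right 0)"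
proof (rule Lim_null_comparison)
  show "eventually (\<lambda>u. norm (exp (p * complex_of_real (ln u))) \<le> u powr Re p) (at_right 0)"
    using eventually_at_right_less by eventually_elim (simp add: powr_def)
  have "((\<lambda>u::real. u powr Re p) \<longlongrightarrow> 0 powr Re p) (at_right 0)"
    using assms by (intro tendsto_powr' tendsto_intros) (auto simp: eventually_at_filter)
  then show "((\<lambda>u::real. u powr Re p) \<longlongrightarrow> 0) (at_right 0)"
    by simp
qed

lemma exp_ln_tendsto_at_top:
  assumes "Re p < 0"
  shows "((\<lambda>u. exp (p * complex_of_real (ln u))) \<longlongrightarrow> 0) at_top"
proof (rule Lim_null_comparison)
  show "eventually (\<lambda>u. norm (exp (p * complex_of_real (ln u))) \<le> u powr Re p) at_top"
    using eventually_gt_at_top[of 0] by eventually_elim (simp add: powr_def)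
  show "((\<lambda>u::real. u powr Re p) \<longlongrightarrow> 0) at_top"
    using assms by (intro tendsto_neg_powr filterlim_ident)
qed

lemma integral_exp_ln_unit_interval:
  assumes "0 < Re p"
  shows "(LINT u|lborel. (if 0 < u \<and> u < 1 then exp ((p - 1) * of_real (ln u)) else 0)) = 1 / p"
proof -
  have p: "p \<noteq> 0"
    using assms by auto
  have eq: "(\<lambda>u. indicator (einterval 0 1) u *\<^sub>R exp ((p - 1) * complex_of_real (ln u)))
      = (\<lambda>u. if 0 < u \<and> u < 1 then exp ((p - 1) * of_real (ln u)) else 0)"
    by (intro ext) (simp add: einterval_iff indicator_def)
  have "(LBINT u=0..1. exp ((p - 1) * complex_of_real (ln u))) = exp (p * of_real (ln 1)) / p - 0 / p"
  proof (rule interval_integral_FTC_integrable[where F = "\<lambda>u. exp (p * of_real (ln u)) / p"])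
    show "set_integrable lborel (einterval 0 1) (\<lambda>u. exp ((p - 1) * complex_of_real (ln u)))"
      unfolding set_integrable_def eq using assms by (intro integrable_exp_ln_unit_interval) simp
    show "(((\<lambda>u. exp (p * complex_of_real (ln u)) / p) \<circ> real_of_ereal) \<longlongrightarrow> 0 / p) (at_right 0)"
      unfolding zero_ereal_def ereal_tendsto_simps
      by (intro tendsto_divide exp_ln_tendsto_at_right_0 assms tendsto_const p)
    have "isCont (\<lambda>u. exp (p * complex_of_real (ln u)) / p) 1"
      using p by (intro continuous_intros) auto
    then show "(((\<lambda>u. exp (p * complex_of_real (ln u)) / p) \<circ> real_of_ereal) \<longlongrightarrow> exp (p * complex_of_real (ln 1)) / p) (at_left 1)"
      unfolding one_ereal_def ereal_tendsto_simps isCont_def by (rule filterlim_mono[OF _ order_refl at_le]) simp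
  qed (use p in \<open>auto intro!: exp_ln_has_vector_derivative exp_ln_isCont simp: zero_ereal_def\<close>)
  then show ?thesis
    unfolding interval_lebesgue_integral_def set_lebesgue_integral_def eq by simp
qed

lemma integral_exp_ln_to_infinity:
  assumes "Re p < 0" "0 < c"
  shows "(LINT u|lborel. (if c \<le> u then exp ((p - 1) * of_real (ln u)) else 0)) = - exp (p * of_real (ln c)) / p"
proof -
  have p: "p \<noteq> 0"
    using assms by auto
  have eq: "(\<lambda>u. indicator (einterval (ereal c) \<infinity>) u *\<^sub>R exp ((p - 1) * complex_of_real (ln u)))
      = (\<lambda>u. if c < u then exp ((p - 1) * of_real (ln u)) else 0)"
    by (intro ext) (simp add: einterval_iff indicator_def)
  have ae: "AE u in lborel. (if c \<le> u then exp ((p - 1) * complex_of_real (ln u)) else 0)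
      = (if c < u then exp ((p - 1) * complex_of_real (ln u)) else 0)"
    using AE_lborel_singleton[of c] by eventually_elim auto
  have "integrable lborel (\<lambda>u. if c \<le> u then exp ((p - 1) * complex_of_real (ln u)) else 0)"
    using assms by (intro integrable_exp_ln_to_infinity) auto
  then have int: "integrable lborel (\<lambda>u. if c < u then exp ((p - 1) * complex_of_real (ln u)) else 0)"
    by (rule integrable_cong_AE_imp[OF _ _ ae]) measurable
  have "(LBINT u=ereal c..\<infinity>. exp ((p - 1) * complex_of_real (ln u))) = 0 / p - exp (p * of_real (ln c)) / p"
  proof (rule interval_integral_FTC_integrable[where F = "\<lambda>u. exp (p * of_real (ln u)) / p"])
    show "set_integrable lborel (einterval (ereal c) \<infinity>) (\<lambda>u. exp ((p - 1) * complex_of_real (ln u)))"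
      unfolding set_integrable_def eq by (rule int)
    show "(((\<lambda>u. exp (p * complex_of_real (ln u)) / p) \<circ> real_of_ereal) \<longlongrightarrow> 0 / p) (at_left \<infinity>)"
      unfolding ereal_tendsto_simps
      by (intro tendsto_divide exp_ln_tendsto_at_top assms tendsto_const p)
    have "isCont (\<lambda>u. exp (p * complex_of_real (ln u)) / p) c"
      using p assms by (intro continuous_intros) auto
    then show "(((\<lambda>u. exp (p * complex_of_real (ln u)) / p) \<circ> real_of_ereal) \<longlongrightarrow> exp (p * complex_of_real (ln c)) / p) (at_right (ereal c))"
      unfolding ereal_tendsto_simps isCont_def by (rule filterlim_mono[OF _ order_refl at_le]) simp
  qed (use p assms in \<open>auto intro!: exp_ln_has_vector_derivative exp_ln_isCont\<close>)
  then have "(LINT u|lborel. (if c < u then exp ((p - 1) * complex_of_real (ln u)) else 0)) = - exp (p * of_real (ln c)) / p"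
    unfolding interval_lebesgue_integral_def set_lebesgue_integral_def eq by simp
  moreover have "(LINT u|lborel. (if c \<le> u then exp ((p - 1) * complex_of_real (ln u)) else 0))
      = (LINT u|lborel. (if c < u then exp ((p - 1) * complex_of_real (ln u)) else 0))"
    by (rule integral_cong_AE[OF _ _ ae]) measurable
  ultimately show ?thesis
    by simp
qed

lemma integral_exp_ln_interval:
  fixes p :: complex
  assumes p: "p \<noteq> 0" and w: "0 < w" "w < 1"
  shows "(LINT u|lborel. (if w < u \<and> u < 1 then exp ((p - 1) * of_real (ln u)) else 0)) = (1 - exp (p * of_real (ln w))) / p"
proof -
  have "((\<lambda>u. exp ((p - 1) * complex_of_real (ln u))) has_integral
      exp (p * of_real (ln 1)) / p - exp (p * of_real (ln w)) / p) {w..1}"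
  proof (rule fundamental_theorem_of_calculus)
    show "((\<lambda>u. exp (p * complex_of_real (ln u)) / p) has_vector_derivative exp ((p - 1) * complex_of_real (ln u)))
        (at u within {w..1})" if "u \<in> {w..1}" for u
      by (rule has_vector_derivative_at_within[OF exp_ln_has_vector_derivative[OF p]]) (use that w in auto)
  qed (use w in simp)
  moreover have c: "continuous_on {w..1} (\<lambda>u. exp ((p - 1) * complex_of_real (ln u)))"
    using w by (intro continuous_intros) auto
  have "set_integrable lborel {w..1} (\<lambda>u. exp ((p - 1) * complex_of_real (ln u)))"
    by (rule borel_integrable_atLeastAtMost') (rule c)
  from set_borel_integral_eq_integral(2)[OF this]
  have "(LINT u:{w..1}|lborel. exp ((p - 1) * complex_of_real (ln u)))
      = integral {w..1} (\<lambda>u. exp ((p - 1) * complex_of_real (ln u)))" .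
  ultimately have "(LINT u:{w..1}|lborel. exp ((p - 1) * complex_of_real (ln u))) = (1 - exp (p * of_real (ln w))) / p"
    by (simp add: integral_unique flip: diff_divide_distrib)
  moreover have "(LINT u|lborel. (if w < u \<and> u < 1 then exp ((p - 1) * complex_of_real (ln u)) else 0))
      = (LINT u:{w..1}|lborel. exp ((p - 1) * complex_of_real (ln u)))"
    unfolding set_lebesgue_integral_def
  proof (rule integral_cong_AE)
    show "AE u in lborel. (if w < u \<and> u < 1 then exp ((p - 1) * complex_of_real (ln u)) else 0)
        = indicator {w..1} u *\<^sub>R exp ((p - 1) * complex_of_real (ln u))"
      using AE_lborel_singleton[of w] AE_lborel_singleton[of 1] by eventually_elim (auto simp: indicator_def)
  qed measurable
  ultimately show ?thesis
    by simp
qed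

section \<open>The resolvent of the Cesaro operator\<close>

text \<open>
  Inversion maps the circle around 1 of radius 1, without 0, onto the line \<open>Re = 1 / 2\<close>.
\<close>

lemma Re_inverse_outside:
  assumes "1 < cmod (z - 1)"
  shows "z \<noteq> 0" "Re (inverse z) < 1 / 2"
proof -
  show z: "z \<noteq> 0"
    using assms by auto
  have "1 < (cmod (z - 1))\<^sup>2"
    using assms by simp
  then have "2 * Re z < (Re z)\<^sup>2 + (Im z)\<^sup>2"
    unfolding cmod_power2 by (simp add: power2_eq_square algebra_simps)
  moreover have "0 < (Re z)\<^sup>2 + (Im z)\<^sup>2"
    using z by (auto simp: complex_eq_iff sum_power2_gt_zero_iff)
  ultimately show "Re (inverse z) < 1 / 2"
    unfolding inverse_complex.sel by (simp add: divide_simps)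
qed

lemma Re_inverse_inside:
  assumes "cmod (z - 1) < 1"
  shows "z \<noteq> 0" "1 / 2 < Re (inverse z)"
proof -
  show z: "z \<noteq> 0"
    using assms by auto
  have "(cmod (z - 1))\<^sup>2 < 1\<^sup>2"
    using assms by (intro power_strict_mono) auto
  then have "(Re z)\<^sup>2 + (Im z)\<^sup>2 < 2 * Re z"
    unfolding cmod_power2 by (simp add: power2_eq_square algebra_simps)
  moreover have "0 < (Re z)\<^sup>2 + (Im z)\<^sup>2"
    using z by (auto simp: complex_eq_iff sum_power2_gt_zero_iff)
  ultimately show "1 / 2 < Re (inverse z)"
    unfolding inverse_complex.sel by (simp add: divide_simps)
qed

lemma borel_kernel_unit_kernel: "borel_kernel unit_kernel"
proof -
  have "(\<lambda>u. cmod (unit_kernel u) * u powr (- 1 / 2)) = (\<lambda>u. if 0 < u \<and> u < 1 then u powr (- 1 / 2) else 0)"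
    by (auto simp: unit_kernel_def)
  then show ?thesis
    using integrable_powr_unit_interval[of "- 1 / 2"] by (auto simp: borel_kernel_def unit_kernel_def[abs_def])
qed

lemma borel_kernel_resolvent_kernel:
  assumes "cmod (z - 1) \<noteq> 1"
  shows "borel_kernel (resolvent_kernel z)"
proof -
  let ?a = "inverse z"
  have norm: "cmod (c * exp (- ?a * of_real (ln u))) * u powr (- 1 / 2) = cmod c * u powr (- Re ?a - 1 / 2)"
    if "0 < u" for c and u :: real
    unfolding norm_mult norm_exp_of_real_ln[OF that] mult.assoc powr_add[symmetric] by simp
  have "integrable lborel (\<lambda>u. cmod (resolvent_kernel z u) * u powr (- 1 / 2))"
  proof (cases "1 < cmod (z - 1)")
    case True
    have "(\<lambda>u. cmod (resolvent_kernel z u) * u powr (- 1 / 2))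
        = (\<lambda>u. cmod (?a\<^sup>2) * (if 0 < u \<and> u < 1 then u powr (- Re ?a - 1 / 2) else 0))"
      using True norm[of _ "?a\<^sup>2"] by (auto simp: resolvent_kernel_def)
    then show ?thesis
      using Re_inverse_outside(2)[OF True] by (simp only:) (intro integrable_mult_right integrable_powr_unit_interval, simp)
  next
    case False
    have "(\<lambda>u. cmod (resolvent_kernel z u) * u powr (- 1 / 2))
        = (\<lambda>u. cmod (- ?a\<^sup>2) * (if 1 \<le> u then u powr (- Re ?a - 1 / 2) else 0))"
      using False norm[of _ "- ?a\<^sup>2"] by (auto simp: resolvent_kernel_def)
    then show ?thesis
      using Re_inverse_inside(2)[of z] False assms
      by (simp only:) (intro integrable_mult_right integrable_powr_to_infinity, simp_all)
  qed
  moreover have "resolvent_kernel z \<in> borel_measurable borel"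
    unfolding resolvent_kernel_def[abs_def] by measurable
  ultimately show ?thesis
    by (auto simp: borel_kernel_def resolvent_kernel_def)
qed

lemma exp_ln_minus_one:
  "0 < u \<Longrightarrow> c * exp (p * complex_of_real (ln u)) / of_real u = c * exp ((p - 1) * of_real (ln u))"
  by (simp add: left_diff_distrib exp_diff exp_of_real)

text \<open>
  If \<open>H\<close> is the Hausdorff operator of the kernel and \<open>C\<close> the Cesaro operator, then this says
  \<open>H C = z H - C / z\<close>, that is, \<open>H (z - C) = C / z\<close>.
\<close>

lemma resolvent_kernel_convolution:
  assumes z: "cmod (z - 1) \<noteq> 1" and w: "0 < w"
  shows "(LINT u|lborel. resolvent_kernel z u / of_real u * unit_kernel (w / u))
    = z * resolvent_kernel z w - inverse z * unit_kernel w"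
proof -
  let ?a = "inverse z"
  have unit: "unit_kernel (w / u) = (if w < u then 1 else 0)" if "0 < u" for u
    using that w by (auto simp: unit_kernel_def)
  show ?thesis
  proof (cases "1 < cmod (z - 1)")
    case True
    note z0 = Re_inverse_outside(1)[OF True]
    have eq: "resolvent_kernel z u / of_real u * unit_kernel (w / u)
        = ?a\<^sup>2 * (if w < u \<and> u < 1 then exp ((- ?a - 1) * of_real (ln u)) else 0)" for u
    proof (cases "0 < u")
      case u: True
      show ?thesis
        using True exp_ln_minus_one[OF u, of "?a\<^sup>2" "- ?a"] by (simp add: resolvent_kernel_def unit[OF u] u)
    qed (use True w in \<open>auto simp: resolvent_kernel_def\<close>)
    show ?thesis
    proof (cases "w < 1")
      case w1: True
      have "(LINT u|lborel. resolvent_kernel z u / of_real u * unit_kernel (w / u))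
          = ?a\<^sup>2 * ((1 - exp (- ?a * of_real (ln w))) / - ?a)"
        unfolding eq integral_mult_right_zero by (subst integral_exp_ln_interval) (use z0 w w1 in auto)
      also have "\<dots> = z * (?a\<^sup>2 * exp (- ?a * of_real (ln w))) - ?a"
        using z0 by (simp add: field_simps power2_eq_square)
      finally show ?thesis
        using True w w1 by (simp add: resolvent_kernel_def unit_kernel_def)
    next
      case False
      then have "(\<lambda>u. ?a\<^sup>2 * (if w < u \<and> u < 1 then exp ((- ?a - 1) * of_real (ln u)) else 0)) = (\<lambda>u::real. 0)"
        by (intro ext) auto
      then show ?thesis
        using True w False unfolding eq by (simp add: resolvent_kernel_def unit_kernel_def)
    qed
  next
    case False
    then have ins: "cmod (z - 1) < 1"
      using z by simp
    note z0 = Re_inverse_inside[OF ins]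
    \<comment> \<open>The kernel lives on \<open>u \<ge> 1\<close> and the unit kernel on \<open>u > w\<close>.\<close>
    define c where "c = max w 1"
    have ae: "AE u in lborel. resolvent_kernel z u / of_real u * unit_kernel (w / u)
        = - ?a\<^sup>2 * (if c \<le> u then exp ((- ?a - 1) * of_real (ln u)) else 0)"
      using AE_lborel_singleton[of w]
    proof eventually_elim
      case (elim u)
      show ?case
      proof (cases "0 < u")
        case u: True
        show ?thesis
          using False elim exp_ln_minus_one[OF u, of "?a\<^sup>2" "- ?a"] by (auto simp: resolvent_kernel_def unit[OF u] c_def)
      qed (use False w in \<open>auto simp: resolvent_kernel_def c_def\<close>)
    qed
    have [measurable]: "resolvent_kernel z \<in> borel_measurable borel" "unit_kernel \<in> borel_measurable borel"
      using borel_kernel_resolvent_kernel[OF z] borel_kernel_unit_kernel by (simp_all add: borel_kernel_def)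
    have "(LINT u|lborel. resolvent_kernel z u / of_real u * unit_kernel (w / u))
        = (LINT u|lborel. - ?a\<^sup>2 * (if c \<le> u then exp ((- ?a - 1) * of_real (ln u)) else 0))"
      by (rule integral_cong_AE[OF _ _ ae]) measurable
    also have "\<dots> = - ?a\<^sup>2 * (- exp (- ?a * of_real (ln c)) / - ?a)"
      unfolding integral_mult_right_zero by (subst integral_exp_ln_to_infinity) (use z0 in \<open>auto simp: c_def simp del: inverse_complex.sel\<close>)
    also have "\<dots> = - ?a * exp (- ?a * of_real (ln c))"
      using z0 by (simp add: field_simps power2_eq_square)
    also have "\<dots> = z * resolvent_kernel z w - inverse z * unit_kernel w"
      using False w z0 by (auto simp: resolvent_kernel_def unit_kernel_def c_def max_def field_simps power2_eq_square)
    finally show ?thesis .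
  qed
qed

lemma mellin_eq:
  "mellin K s = (LINT u|lebesgue. indicator {0<..} u *\<^sub>R (K u * exp ((s - 1) * of_real (ln u))))"
  unfolding mellin_def set_lebesgue_integral_def
  by (intro Bochner_Integration.integral_cong refl) (auto simp: powr_def Ln_of_real indicator_def)

lemma mellin_borel:
  assumes [measurable]: "K \<in> borel_measurable borel"
  shows "mellin K s = (LINT u|lborel. (if 0 < u then K u * exp ((s - 1) * of_real (ln u)) else 0))"
proof -
  have "(LINT u|lebesgue. indicator {0<..} u *\<^sub>R (K u * exp ((s - 1) * of_real (ln u))))
      = (LINT u|lborel. indicator {0<..} u *\<^sub>R (K u * exp ((s - 1) * of_real (ln u))))"
    by (rule integral_completion) measurable
  also have "\<dots> = (LINT u|lborel. (if 0 < u then K u * exp ((s - 1) * of_real (ln u)) else 0))"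
    by (intro Bochner_Integration.integral_cong refl) simp
  finally show ?thesis
    by (simp only: mellin_eq)
qed

text \<open>
  The function \<open>w \<mapsto> 1 / (z - w)\<close> at \<open>w = 1 / s\<close>, less its value at \<open>w = 0\<close>: only functions
  that vanish at 0 come from kernels.
\<close>

lemma mellin_resolvent_kernel:
  assumes z: "cmod (z - 1) \<noteq> 1" and s: "Re s = 1 / 2"
  shows "mellin (resolvent_kernel z) s = 1 / (z - inverse s) - inverse z"
proof -
  let ?a = "inverse z"
  have km: "resolvent_kernel z \<in> borel_measurable borel"
    using borel_kernel_resolvent_kernel[OF z] by (simp add: borel_kernel_def)
  have s0: "s \<noteq> 0"
    using s by auto
  have mult: "exp (- ?a * of_real (ln u)) * exp ((s - 1) * of_real (ln u)) = exp (((s - ?a) - 1) * of_real (ln u))" for u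
    by (simp flip: exp_add add: algebra_simps)
  have final: "?a\<^sup>2 * (1 / (s - ?a)) = 1 / (z - inverse s) - ?a" if "z \<noteq> 0" "s \<noteq> ?a"
  proof -
    have "z * s \<noteq> 1"
      using that by (auto simp: inverse_unique)
    then show ?thesis
      using that s0 by (simp add: divide_simps power2_eq_square)
  qed
  show ?thesis
  proof (cases "1 < cmod (z - 1)")
    case True
    note z0 = Re_inverse_outside[OF True]
    have eq: "(if 0 < u then resolvent_kernel z u * exp ((s - 1) * of_real (ln u)) else 0)
        = ?a\<^sup>2 * (if 0 < u \<and> u < 1 then exp (((s - ?a) - 1) * of_real (ln u)) else 0)" for u
      using True mult[of u] by (simp add: resolvent_kernel_def mult.assoc)
    have "mellin (resolvent_kernel z) s = ?a\<^sup>2 * (1 / (s - ?a))"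
      unfolding mellin_borel[OF km] eq integral_mult_right_zero
      by (subst integral_exp_ln_unit_interval) (use z0 s in \<open>auto simp del: inverse_complex.sel\<close>)
    moreover have "s \<noteq> ?a"
      using z0 s by (auto simp del: inverse_complex.sel)
    ultimately show ?thesis
      using final[OF z0(1)] by simp
  next
    case False
    then have ins: "cmod (z - 1) < 1"
      using z by simp
    note z0 = Re_inverse_inside[OF ins]
    have eq: "(if 0 < u then resolvent_kernel z u * exp ((s - 1) * of_real (ln u)) else 0)
        = - ?a\<^sup>2 * (if 1 \<le> u then exp (((s - ?a) - 1) * of_real (ln u)) else 0)" for u
      using False mult[of u] by (simp add: resolvent_kernel_def mult.assoc)
    have "mellin (resolvent_kernel z) s = - ?a\<^sup>2 * (- exp ((s - ?a) * of_real (ln 1)) / (s - ?a))"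
      unfolding mellin_borel[OF km] eq integral_mult_right_zero
      by (subst integral_exp_ln_to_infinity) (use z0 s in \<open>auto simp del: inverse_complex.sel\<close>)
    moreover have "s \<noteq> ?a"
      using z0 s by (auto simp del: inverse_complex.sel)
    ultimately show ?thesis
      using final[OF z0(1)] by simp
  qed
qed

text \<open>
  The substitution \<open>t = u x\<close> turns the average over \<open>(0, x)\<close> into one over \<open>(0, 1)\<close>.
\<close>

lemma cesaro_average_eq:
  assumes "0 < x" "f \<in> borel_measurable lebesgue"
  shows "1 / complex_of_real x * (LINT t:{0..x}|lebesgue. f t) = (LINT u|lebesgue. unit_kernel u * f (u * x))"
proof -
  from borel_representative[OF assms(2)] obtain f'
    where [measurable]: "f' \<in> borel_measurable borel" and f': "AE x in lborel. f x = f' x"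
    by blast
  have [measurable]: "unit_kernel \<in> borel_measurable borel"
    using borel_kernel_unit_kernel by (simp add: borel_kernel_def)
  have um: "unit_kernel \<in> borel_measurable lebesgue"
    by (intro measurable_completion) simp
  have gm: "(\<lambda>t. indicator {0..x} t *\<^sub>R f' t) \<in> borel_measurable lborel"
    by measurable
  have "(LINT t:{0..x}|lebesgue. f t) = (LINT t|lebesgue. indicator {0..x} t *\<^sub>R f' t)"
    unfolding set_lebesgue_integral_def
  proof (rule integral_cong_AE)
    have [measurable]: "{0..x} \<in> sets lebesgue"
      by simp
    show "(\<lambda>t. indicator {0..x} t *\<^sub>R f t) \<in> borel_measurable lebesgue"
      using assms(2) by measurable
    show "(\<lambda>t. indicator {0..x} t *\<^sub>R f' t) \<in> borel_measurable lebesgue"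
      using gm by (rule measurable_completion)
    show "AE t in lebesgue. indicator {0..x} t *\<^sub>R f t = indicator {0..x} t *\<^sub>R f' t"
      unfolding AE_completion_iff using f' by eventually_elim simp
  qed
  also have "\<dots> = (LINT t|lborel. indicator {0..x} t *\<^sub>R f' t)"
    by (rule integral_completion[OF gm])
  also have "\<dots> = x *\<^sub>R (LINT u|lborel. indicator {0..x} (x * u) *\<^sub>R f' (x * u))"
    using lborel_integral_real_affine[of x "\<lambda>t. indicator {0..x} t *\<^sub>R f' t" 0] assms(1) by simp
  also have "(LINT u|lborel. indicator {0..x} (x * u) *\<^sub>R f' (x * u)) = (LINT u|lborel. unit_kernel u * f' (u * x))"
  proof (rule integral_cong_AE)
    show "AE u in lborel. indicator {0..x} (x * u) *\<^sub>R f' (x * u) = unit_kernel u * f' (u * x)"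
      using AE_lborel_singleton[of 0] AE_lborel_singleton[of 1]
      by eventually_elim (use assms(1) in \<open>auto simp: indicator_def unit_kernel_def mult.commute zero_le_mult_iff mult_le_cancel_right1\<close>)
  qed measurable
  also have "\<dots> = (LINT u|lebesgue. unit_kernel u * f (u * x))"
    by (rule hausdorff_integral_representative(2)[symmetric, OF um assms(2)]) (use assms(1) f' in auto)
  finally show ?thesis
    using assms(1) by (simp add: scaleR_conv_of_real)
qed

lemma cesaro_plus_eq: "cesaro_plus = hausdorff_op_plus unit_kernel"
  unfolding cesaro_plus_def
proof (rule the_equality)
  note K = borel_kernel_mellin_kernel[OF borel_kernel_unit_kernel]
  show *: "\<forall>f. AE x in lebesgue. 0 < x \<longrightarrow> fun_of (ext_zero (blinfun_apply (hausdorff_op_plus unit_kernel) f)) x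
      = 1 / complex_of_real x * (LINT t:{0..x}|lebesgue. fun_of (ext_zero f) t)"
  proof
    fix f
    show "AE x in lebesgue. 0 < x \<longrightarrow> fun_of (ext_zero (blinfun_apply (hausdorff_op_plus unit_kernel) f)) x
      = 1 / complex_of_real x * (LINT t:{0..x}|lebesgue. fun_of (ext_zero f) t)"
      using fun_of_hausdorff_op_plus[OF K, of f] by eventually_elim (auto simp: cesaro_average_eq[OF _ fun_of_measurable, symmetric])
  qed
  fix T assume T: "\<forall>f. AE x in lebesgue. 0 < x \<longrightarrow> fun_of (ext_zero (blinfun_apply T f)) x
      = 1 / complex_of_real x * (LINT t:{0..x}|lebesgue. fun_of (ext_zero f) t)"
  show "T = hausdorff_op_plus unit_kernel"
  proof (rule blinfun_l2_plus_eqI)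
    fix f
    show "AE x in lebesgue. 0 < x \<longrightarrow>
        fun_of (ext_zero (blinfun_apply T f)) x = fun_of (ext_zero (blinfun_apply (hausdorff_op_plus unit_kernel) f)) x"
      using T[rule_format, of f] *[rule_format, of f] by eventually_elim simp
  qed
qed

lemma scalar_op_apply: "blinfun_apply (scalar_op c) x = c *\<^sub>C x"
  by (simp add: scalar_op.rep_eq)

lemma scalar_op_compose: "scalar_op a o\<^sub>L scalar_op b = scalar_op (a * b)"
  by (rule blinfun_eqI) (simp add: scalar_op_apply scaleC_scaleC)

lemma scalar_op_one: "scalar_op 1 = (id_blinfun :: 'a::complex_normed_vector \<Rightarrow>\<^sub>L 'a)"
  using scaleC_of_real[of 1, where 'a = 'a] by (intro blinfun_eqI) (simp add: scalar_op_apply)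

text \<open>
  If \<open>H\<close> is the Hausdorff operator of the kernel and \<open>C\<close> the Cesaro operator, then
  \<open>H (z - C) = C / z\<close> gives \<open>(1 / z + H) (z - C) = 1 - C / z + C / z = 1\<close>.  The inverse is
  two-sided because \<open>H\<close>, \<open>C\<close> and the scalars commute.
\<close>

lemma resolvent_inverse:
  assumes z: "cmod (z - 1) \<noteq> 1"
  shows "op_inverses (scalar_op z - cesaro_plus) (scalar_op (inverse z) + hausdorff_op_plus (resolvent_kernel z))"
proof -
  let ?k = "resolvent_kernel z" and ?H = "hausdorff_op_plus (resolvent_kernel z)"
  have z0: "z \<noteq> 0"
    using z by auto
  note k = borel_kernel_resolvent_kernel[OF z] and u = borel_kernel_unit_kernel
  note mk = borel_kernel_mellin_kernel[OF k] and mu = borel_kernel_mellin_kernel[OF u]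
  define J where "J w = z * ?k w + (- inverse z) * unit_kernel w" for w
  have "borel_kernel J"
    unfolding borel_kernel_def
  proof (intro conjI allI impI)
    show "J \<in> borel_measurable borel" "\<And>w. w \<le> 0 \<Longrightarrow> J w = 0"
      using k u by (auto simp: J_def[abs_def] borel_kernel_def)
    have "integrable lebesgue (\<lambda>w. cmod (J w) * w powr (- 1 / 2))"
      using mellin_kernel_add[OF mellin_kernel_scale(1)[OF mk, of z] mellin_kernel_scale(1)[OF mu, of "- inverse z"]]
      by (simp add: J_def[abs_def] mellin_kernel_def)
    moreover have "(\<lambda>w. cmod (J w) * w powr (- 1 / 2)) \<in> borel_measurable lborel"
      using \<open>J \<in> borel_measurable borel\<close> by measurable
    ultimately show "integrable lborel (\<lambda>w. cmod (J w) * w powr (- 1 / 2))"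
      by (simp add: integrable_completion)
  qed
  then have "?H o\<^sub>L cesaro_plus = hausdorff_op_plus J"
    unfolding cesaro_plus_eq
  proof (rule hausdorff_op_plus_compose[OF k u])
    show "J w = (LINT u|lborel. ?k u / of_real u * unit_kernel (w / u))" if "0 < w" for w
      unfolding resolvent_kernel_convolution[OF z that] by (simp add: J_def)
  qed
  also have "\<dots> = (scalar_op z o\<^sub>L ?H) + (scalar_op (- inverse z) o\<^sub>L cesaro_plus)"
    unfolding J_def[abs_def] cesaro_plus_eq
    using hausdorff_op_plus_add[OF mellin_kernel_scale(1)[OF mk, of z] mellin_kernel_scale(1)[OF mu, of "- inverse z"]]
    by (simp only: hausdorff_op_plus_scale[OF mk] hausdorff_op_plus_scale[OF mu])
  finally have HC: "?H o\<^sub>L cesaro_plus = (scalar_op z o\<^sub>L ?H) + (scalar_op (- inverse z) o\<^sub>L cesaro_plus)" .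
  have CH: "cesaro_plus o\<^sub>L ?H = ?H o\<^sub>L cesaro_plus"
    unfolding cesaro_plus_eq by (rule hausdorff_op_plus_commute[OF u k])
  have Hz: "?H o\<^sub>L scalar_op c = scalar_op c o\<^sub>L ?H" and Cz: "cesaro_plus o\<^sub>L scalar_op c = scalar_op c o\<^sub>L cesaro_plus" for c
    unfolding cesaro_plus_eq by (rule hausdorff_op_plus_scale_right[OF mk] hausdorff_op_plus_scale_right[OF mu])+
  have neg: "scalar_op (- c) o\<^sub>L T = - (scalar_op c o\<^sub>L T)" for c and T :: "l2_plus \<Rightarrow>\<^sub>L l2_plus"
  proof (rule blinfun_eqI)
    fix x
    have "(- c) *\<^sub>C y + c *\<^sub>C y = 0" for y :: l2_plus
      using scaleC_add_left[of "- c" c y] scaleC_of_real[of 0 y] by simp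
    then show "blinfun_apply (scalar_op (- c) o\<^sub>L T) x = blinfun_apply (- (scalar_op c o\<^sub>L T)) x"
      by (simp add: scalar_op_apply blinfun.minus_left eq_neg_iff_add_eq_0)
  qed
  have one: "scalar_op z o\<^sub>L scalar_op (inverse z) = (id_blinfun :: l2_plus \<Rightarrow>\<^sub>L l2_plus)"
    "scalar_op (inverse z) o\<^sub>L scalar_op z = (id_blinfun :: l2_plus \<Rightarrow>\<^sub>L l2_plus)"
    using z0 by (simp_all add: scalar_op_compose scalar_op_one)
  have l: "(S - T) o\<^sub>L (A + B) = (S o\<^sub>L A) + (S o\<^sub>L B) - (T o\<^sub>L A) - (T o\<^sub>L B)"
    and r: "(A + B) o\<^sub>L (S - T) = (A o\<^sub>L S) - (A o\<^sub>L T) + (B o\<^sub>L S) - (B o\<^sub>L T)"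
    for A B S T :: "l2_plus \<Rightarrow>\<^sub>L l2_plus"
    by (auto intro!: blinfun_eqI simp: blinfun.add_left blinfun.diff_left blinfun.add_right blinfun.diff_right)
  show ?thesis
    unfolding op_inverses_def l r one CH HC Hz Cz neg by simp
qed

section \<open>The spectrum of the Cesaro operator\<close>

text \<open>
  The power \<open>x\<^sup>p\<^sup>-\<^sup>1\<close>, cut off at 1.  Without the cut-off it would be an eigenfunction of
  the Cesaro operator for the eigenvalue \<open>1 / p\<close>, but it would not be square integrable.
\<close>

definition power_profile :: "complex \<Rightarrow> real \<Rightarrow> complex" where
  "power_profile p x = (if 0 < x \<and> x < 1 then exp ((p - 1) * of_real (ln x)) else 0)"

definition reciprocal_tail :: "real \<Rightarrow> complex" where
  "reciprocal_tail x = (if 1 \<le> x then 1 / of_real x else 0)"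

lemma borel_measurable_power_profile [measurable]: "power_profile p \<in> borel_measurable borel"
  unfolding power_profile_def[abs_def] by measurable

lemma borel_measurable_reciprocal_tail [measurable]: "reciprocal_tail \<in> borel_measurable borel"
  unfolding reciprocal_tail_def[abs_def] by measurable

lemma square_integrableI_borel:
  assumes f: "f \<in> borel_measurable borel" and int: "integrable lborel (\<lambda>x. (cmod (f x))\<^sup>2)"
  shows "square_integrable f" "(l2_norm_fun f)\<^sup>2 = (LINT x|lborel. (cmod (f x))\<^sup>2)"
proof -
  have m: "(\<lambda>x. (cmod (f x))\<^sup>2) \<in> borel_measurable lborel"
    using f by measurable
  show "square_integrable f"
    using f int m by (auto simp: square_integrable_def integrable_completion intro!: measurable_completion)
  show "(l2_norm_fun f)\<^sup>2 = (LINT x|lborel. (cmod (f x))\<^sup>2)"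
    unfolding l2_norm_fun_power2 by (rule integral_completion[OF m])
qed

lemma cmod_power_profile_squared:
  "(cmod (power_profile p x))\<^sup>2 = (if 0 < x \<and> x < 1 then x powr (2 * Re p - 2) else 0)"
proof -
  have "(exp (Re (p - 1) * ln x))\<^sup>2 = exp ((2 * Re p - 2) * ln x)"
    by (simp add: power2_eq_square algebra_simps flip: exp_add)
  then show ?thesis
    by (simp add: power_profile_def powr_def)
qed

lemma power_profile_norm:
  assumes "1 / 2 < Re p"
  shows "square_integrable (power_profile p)" "(l2_norm_fun (power_profile p))\<^sup>2 = 1 / (2 * Re p - 1)"
proof -
  have int: "integrable lborel (\<lambda>x. (cmod (power_profile p x))\<^sup>2)"
    unfolding cmod_power_profile_squared by (rule integrable_powr_unit_interval) (use assms in simp)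
  note * = square_integrableI_borel[OF borel_measurable_power_profile int]
  show "square_integrable (power_profile p)"
    by (rule *)
  define q where "q = complex_of_real (2 * Re p - 1)"
  have "complex_of_real ((l2_norm_fun (power_profile p))\<^sup>2) = (LINT x|lborel. complex_of_real ((cmod (power_profile p x))\<^sup>2))"
    unfolding *(2) by (rule integral_complex_of_real[symmetric])
  also have "\<dots> = (LINT u|lborel. (if 0 < u \<and> u < 1 then exp ((q - 1) * of_real (ln u)) else 0))"
    unfolding cmod_power_profile_squared
    by (intro Bochner_Integration.integral_cong refl) (auto simp: powr_def q_def exp_of_real[symmetric])
  also have "\<dots> = 1 / q"
    by (rule integral_exp_ln_unit_interval) (use assms in \<open>simp add: q_def\<close>)
  finally have "complex_of_real ((l2_norm_fun (power_profile p))\<^sup>2) = complex_of_real (1 / (2 * Re p - 1))"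
    by (simp add: q_def)
  then show "(l2_norm_fun (power_profile p))\<^sup>2 = 1 / (2 * Re p - 1)"
    by (simp only: of_real_eq_iff)
qed

lemma square_integrable_reciprocal_tail: "square_integrable reciprocal_tail"
proof -
  have "(\<lambda>x. (cmod (reciprocal_tail x))\<^sup>2) = (\<lambda>x. if 1 \<le> x then x powr -2 else 0)"
    by (auto simp: reciprocal_tail_def norm_divide power_divide powr_minus powr_numeral divide_simps)
  then show ?thesis
    using integrable_powr_to_infinity[of "-2" 1] by (intro square_integrableI_borel(1)) auto
qed

definition l2_plus_of :: "(real \<Rightarrow> complex) \<Rightarrow> l2_plus" where
  "l2_plus_of f = restr_plus (l2_of f)"

lemma l2_plus_of:
  assumes "square_integrable f" "\<And>x. x \<le> 0 \<Longrightarrow> f x = 0"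
  shows "AE x in lebesgue. fun_of (ext_zero (l2_plus_of f)) x = f x" "norm (l2_plus_of f) = l2_norm_fun f"
proof -
  have "AE x in lebesgue. x \<le> 0 \<longrightarrow> fun_of (l2_of f) x = 0"
    using fun_of_l2_of[OF assms(1)] by eventually_elim (simp add: assms(2))
  then have "ext_zero (l2_plus_of f) = l2_of f"
    by (simp add: l2_plus_of_def restr_plus_inverse)
  then show *: "AE x in lebesgue. fun_of (ext_zero (l2_plus_of f)) x = f x"
    using fun_of_l2_of[OF assms(1)] by simp
  show "norm (l2_plus_of f) = l2_norm_fun f"
    unfolding norm_ext_zero[symmetric] norm_l2
    by (rule l2_norm_fun_cong) (use * assms(1) in \<open>simp add: l2_eq_def square_integrable_fun_of\<close>)
qed

lemma cesaro_power_profile: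
  assumes p: "1 / 2 < Re p"
  shows "blinfun_apply cesaro_plus (l2_plus_of (power_profile p))
    = inverse p *\<^sub>C (l2_plus_of (power_profile p) + l2_plus_of reciprocal_tail)"
proof (rule l2_plus_eqI)
  let ?f = "l2_plus_of (power_profile p)" and ?g = "l2_plus_of reciprocal_tail"
  have p': "0 < Re p" "p \<noteq> 0"
    using p by auto
  have f: "AE x in lborel. fun_of (ext_zero ?f) x = power_profile p x"
    using l2_plus_of(1)[OF power_profile_norm(1)[OF p]] by (simp add: power_profile_def AE_completion_iff)
  have g: "AE x in lborel. fun_of (ext_zero ?g) x = reciprocal_tail x"
    using l2_plus_of(1)[OF square_integrable_reciprocal_tail] by (simp add: reciprocal_tail_def AE_completion_iff)
  have C: "AE x in lborel. fun_of (ext_zero (blinfun_apply cesaro_plus ?f)) x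
      = (LINT u|lborel. unit_kernel u * power_profile p (u * x))"
    unfolding cesaro_plus_eq by (rule fun_of_hausdorff_op_plus_borel[OF borel_kernel_unit_kernel _ f]) measurable
  have I: "(LINT u|lborel. power_profile p u) = 1 / p"
    unfolding power_profile_def by (rule integral_exp_ln_unit_interval[OF p'(1)])
  have eval: "(LINT u|lborel. unit_kernel u * power_profile p (u * x)) = inverse p * (power_profile p x + reciprocal_tail x)"
    if x: "0 < x" for x
  proof (cases "x < 1")
    case True
    have "unit_kernel u * power_profile p (u * x) = power_profile p x * power_profile p u" for u
    proof (cases "0 < u \<and> u < 1")
      case u: True
      then have "u * x < 1"
        using True x by (metis mult_strict_mono' mult_1 less_imp_le)
      with u x True show ?thesis
        by (simp add: unit_kernel_def power_profile_def ln_mult algebra_simps flip: exp_add)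
    qed (auto simp: unit_kernel_def power_profile_def)
    then have "(LINT u|lborel. unit_kernel u * power_profile p (u * x)) = power_profile p x * (1 / p)"
      by (simp add: I)
    then show ?thesis
      using True by (simp add: reciprocal_tail_def field_simps)
  next
    case False
    have "unit_kernel u * power_profile p (u * x) = power_profile p (0 + x * u)" for u
    proof (cases "0 < u \<and> u < 1")
      case u: False
      then have "\<not> (0 < u * x \<and> u * x < 1)"
        using x False by (auto simp: zero_less_mult_iff not_less intro: order_trans[of _ u])
      then show ?thesis
        using u by (auto simp: unit_kernel_def power_profile_def mult.commute)
    qed (simp add: unit_kernel_def mult.commute)
    then have "of_real x * (LINT u|lborel. unit_kernel u * power_profile p (u * x)) = 1 / p"
      using lborel_integral_real_affine[of x "power_profile p" 0] x by (simp add: I scaleR_conv_of_real)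
    then have "(LINT u|lborel. unit_kernel u * power_profile p (u * x)) = 1 / p / of_real x"
      using x by (subst eq_divide_eq) (simp add: mult.commute)
    then show ?thesis
      using False x by (simp only:) (simp add: reciprocal_tail_def power_profile_def field_simps)
  qed
  show "AE x in lebesgue. 0 < x \<longrightarrow> fun_of (ext_zero (blinfun_apply cesaro_plus ?f)) x
      = fun_of (ext_zero (inverse p *\<^sub>C (?f + ?g))) x"
    using C f g fun_of_scaleC[of "inverse p" "ext_zero (?f + ?g)"] fun_of_add[of "ext_zero ?f" "ext_zero ?g"]
    unfolding AE_completion_iff ext_zero_scaleC ext_zero_add
    by eventually_elim (auto simp: eval)
qed

lemma scaleC_diff_left: "(a - b) *\<^sub>C x = a *\<^sub>C x - b *\<^sub>C (x :: 'a::complex_normed_vector)"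
  using scaleC_add_left[of "a - b" b x] by simp

text \<open>
  Let \<open>f\<close> be the power profile for \<open>p = 1 / \<mu>\<close> with \<open>\<mu>\<close> in the open disc, and \<open>g\<close> the reciprocal
  tail.  From \<open>C f = \<mu> (f + g)\<close> an inverse \<open>R\<close> of \<open>\<omega> - C\<close> would give
  \<open>\<parallel>f\<parallel> \<le> \<parallel>R\<parallel> (\<bar>\<omega> - \<mu>\<bar> \<parallel>f\<parallel> + \<bar>\<mu>\<bar> \<parallel>g\<parallel>)\<close>.  Here
  \<open>\<bar>\<mu>\<bar>\<^sup>2 / \<parallel>f\<parallel>\<^sup>2 = 1 - \<bar>\<mu> - 1\<bar>\<^sup>2\<close> tends to 0 at the circle, so that \<open>\<mu> \<rightarrow> \<omega>\<close> leads to
  \<open>1 \<le> 0\<close>.  This includes the point \<open>\<omega> = 0\<close>, where \<open>\<parallel>f\<parallel>\<close> tends to 0, but \<open>\<bar>\<mu>\<bar>\<close> does so faster.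
\<close>

lemma circle_subset_spectrum:
  assumes \<omega>: "cmod (\<omega> - 1) = 1"
  shows "\<omega> \<in> spectrum cesaro_plus"
proof (rule ccontr)
  assume "\<omega> \<notin> spectrum cesaro_plus"
  then obtain R where R: "op_inverses (scalar_op \<omega> - cesaro_plus) R"
    by (auto simp: spectrum_def)
  define G where "G = norm (l2_plus_of reciprocal_tail)"
  have key: "1 \<le> norm R * (cmod (\<omega> - \<mu>) + sqrt (1 - (cmod (\<mu> - 1))\<^sup>2) * G)" if \<mu>: "cmod (\<mu> - 1) < 1" for \<mu>
  proof -
    let ?p = "inverse \<mu>"
    let ?f = "l2_plus_of (power_profile ?p)" and ?g = "l2_plus_of reciprocal_tail"
    note p = Re_inverse_inside[OF \<mu>]
    have nf: "(norm ?f)\<^sup>2 = 1 / (2 * Re ?p - 1)"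
      using l2_plus_of(2)[OF power_profile_norm(1)[OF p(2)]] power_profile_norm(2)[OF p(2)]
      by (simp add: power_profile_def)
    have "0 < (norm ?f)\<^sup>2"
      unfolding nf using p(2) by (simp del: inverse_complex.sel)
    then have pos: "0 < norm ?f"
      by auto
    have "(cmod \<mu>)\<^sup>2 * (2 * Re ?p - 1) = 1 - (cmod (\<mu> - 1))\<^sup>2"
    proof -
      have "(cmod \<mu>)\<^sup>2 * Re ?p = Re \<mu>"
        using p(1) unfolding inverse_complex.sel cmod_power2 by (simp add: complex_eq_iff sum_power2_eq_zero_iff)
      moreover have "(cmod \<mu>)\<^sup>2 * (2 * Re ?p - 1) = 2 * ((cmod \<mu>)\<^sup>2 * Re ?p) - (cmod \<mu>)\<^sup>2"
        by (simp only: right_diff_distrib mult.left_commute[of _ 2] mult_1_right)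
      ultimately have "(cmod \<mu>)\<^sup>2 * (2 * Re ?p - 1) = 2 * Re \<mu> - (cmod \<mu>)\<^sup>2"
        by (simp only:)
      also have "\<dots> = 1 - (cmod (\<mu> - 1))\<^sup>2"
        unfolding cmod_power2 by (simp add: power2_eq_square algebra_simps)
      finally show ?thesis .
    qed
    then have "(cmod \<mu>)\<^sup>2 / (norm ?f)\<^sup>2 = 1 - (cmod (\<mu> - 1))\<^sup>2"
      unfolding nf by simp
    then have quot: "cmod \<mu> / norm ?f = sqrt (1 - (cmod (\<mu> - 1))\<^sup>2)"
      by (metis norm_ge_zero power_divide real_sqrt_unique divide_nonneg_nonneg)
    have "R o\<^sub>L (scalar_op \<omega> - cesaro_plus) = id_blinfun"
      using R by (simp add: op_inverses_def)
    then have "?f = blinfun_apply (R o\<^sub>L (scalar_op \<omega> - cesaro_plus)) ?f"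
      by simp
    also have "\<dots> = blinfun_apply R (\<omega> *\<^sub>C ?f - \<mu> *\<^sub>C (?f + ?g))"
      by (simp add: blinfun.diff_left scalar_op_apply cesaro_power_profile[OF p(2)])
    also have "\<omega> *\<^sub>C ?f - \<mu> *\<^sub>C (?f + ?g) = (\<omega> - \<mu>) *\<^sub>C ?f - \<mu> *\<^sub>C ?g"
      by (simp add: scaleC_add_right scaleC_diff_left)
    finally have "norm ?f \<le> norm R * norm ((\<omega> - \<mu>) *\<^sub>C ?f - \<mu> *\<^sub>C ?g)"
      by (metis norm_blinfun)
    also have "\<dots> \<le> norm R * (cmod (\<omega> - \<mu>) * norm ?f + cmod \<mu> * G)"
      using norm_triangle_ineq4[of "(\<omega> - \<mu>) *\<^sub>C ?f" "\<mu> *\<^sub>C ?g"]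
      by (intro mult_left_mono) (simp_all add: norm_scaleC G_def)
    finally have "norm ?f / norm ?f \<le> norm R * (cmod (\<omega> - \<mu>) * norm ?f + cmod \<mu> * G) / norm ?f"
      by (rule divide_right_mono) simp
    also have "\<dots> = norm R * (cmod (\<omega> - \<mu>) + cmod \<mu> / norm ?f * G)"
      using pos by (simp add: field_simps)
    finally show ?thesis
      using pos by (simp add: quot)
  qed
  \<comment> \<open>The point \<open>\<omega>\<close> is approached along the radius of the disc.\<close>
  define \<mu> where "\<mu> t = 1 + of_real t * (\<omega> - 1)" for t :: real
  have ev: "eventually (\<lambda>t. 1 \<le> norm R * (cmod (\<omega> - \<mu> t) + sqrt (1 - (cmod (\<mu> t - 1))\<^sup>2) * G)) (at_left 1)"
    using eventually_at_left_real[OF zero_less_one]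
  proof (rule eventually_mono)
    fix t :: real assume "t \<in> {0<..<1}"
    then have "cmod (\<mu> t - 1) < 1"
      by (simp add: \<mu>_def norm_mult \<omega>)
    then show "1 \<le> norm R * (cmod (\<omega> - \<mu> t) + sqrt (1 - (cmod (\<mu> t - 1))\<^sup>2) * G)"
      by (rule key)
  qed
  have "((\<lambda>t. norm R * (cmod (\<omega> - \<mu> t) + sqrt (1 - (cmod (\<mu> t - 1))\<^sup>2) * G))
      \<longlongrightarrow> norm R * (cmod (\<omega> - \<mu> 1) + sqrt (1 - (cmod (\<mu> 1 - 1))\<^sup>2) * G)) (at_left 1)"
    unfolding \<mu>_def by (intro tendsto_intros)
  from tendsto_lowerbound[OF this ev] have "1 \<le> norm R * (cmod (\<omega> - \<mu> 1) + sqrt (1 - (cmod (\<mu> 1 - 1))\<^sup>2) * G)"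
    by simp
  then show False
    by (simp add: \<mu>_def \<omega>)
qed

lemma spectrum_cesaro_plus: "spectrum cesaro_plus = sphere 1 1"
proof -
  have "z \<in> spectrum cesaro_plus \<longleftrightarrow> z \<in> sphere 1 1" for z
  proof (cases "cmod (z - 1) = 1")
    case True
    then show ?thesis
      using circle_subset_spectrum by (simp add: dist_norm norm_minus_commute)
  next
    case False
    then have "z \<notin> spectrum cesaro_plus"
      using resolvent_inverse unfolding spectrum_def by blast
    then show ?thesis
      using False by (simp add: dist_norm norm_minus_commute)
  qed
  then show ?thesis
    by blast
qed

lemma op_inverses_unique:
  assumes "op_inverses A R" "op_inverses A S"
  shows "R = S"
proof -
  have "R = R o\<^sub>L (A o\<^sub>L S)"
    using assms(2) by (auto simp: op_inverses_def intro!: blinfun_eqI)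
  also have "\<dots> = (R o\<^sub>L A) o\<^sub>L S"
    by (rule blinfun_eqI) simp
  also have "\<dots> = S"
    using assms(1) by (auto simp: op_inverses_def intro!: blinfun_eqI)
  finally show ?thesis .
qed

lemma resolvent_cesaro_plus:
  assumes "cmod (z - 1) \<noteq> 1"
  shows "resolvent cesaro_plus z = scalar_op (inverse z) + hausdorff_op_plus (resolvent_kernel z)"
  unfolding resolvent_def
  by (rule the_equality) (use resolvent_inverse[OF assms] op_inverses_unique in auto)

section \<open>Contour integrals of kernels\<close>

lemma borel_kernel_iff:
  "borel_kernel K \<longleftrightarrow> K \<in> borel_measurable borel \<and> (\<forall>u\<le>0. K u = 0) \<and> mellin_kernel K"
proof -
  have "integrable lborel (\<lambda>u. cmod (K u) * u powr (- 1 / 2))"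
    if K: "K \<in> borel_measurable borel" and mK: "mellin_kernel K"
  proof -
    have "(\<lambda>u. cmod (K u) * u powr (- 1 / 2)) \<in> borel_measurable lborel"
      using K by measurable
    then show ?thesis
      using mK by (simp add: mellin_kernel_def integrable_completion)
  qed
  then show ?thesis
    using borel_kernel_mellin_kernel by (auto simp: borel_kernel_def)
qed

lemma borel_kernel_add: "borel_kernel K \<Longrightarrow> borel_kernel L \<Longrightarrow> borel_kernel (\<lambda>u. K u + L u)"
  by (auto simp: borel_kernel_iff mellin_kernel_add)

lemma borel_kernel_scale: "borel_kernel K \<Longrightarrow> borel_kernel (\<lambda>u. c * K u)"
  by (auto simp: borel_kernel_iff mellin_kernel_scale)

lemma borel_kernel_diff: "borel_kernel K \<Longrightarrow> borel_kernel L \<Longrightarrow> borel_kernel (\<lambda>u. K u - L u)"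
  using borel_kernel_add[of K "\<lambda>u. -1 * L u"] borel_kernel_scale[of L "-1"] by simp

definition dominating :: "(real \<Rightarrow> real) \<Rightarrow> bool" where
  "dominating D \<longleftrightarrow> (\<forall>u\<le>0. D u = 0) \<and> integrable lborel (\<lambda>u. D u * u powr (- 1 / 2))"

definition dominating_norm :: "(real \<Rightarrow> real) \<Rightarrow> real" where
  "dominating_norm D = (LINT u|lborel. D u * u powr (- 1 / 2))"

lemma dominated_kernel:
  assumes D: "dominating D" and [measurable]: "K \<in> borel_measurable borel" and le: "\<And>u. cmod (K u) \<le> C * D u"
  shows "borel_kernel K" "kernel_norm K \<le> C * dominating_norm D"
proof -
  have int: "integrable lborel (\<lambda>u. C * (D u * u powr (- 1 / 2)))"
    using D by (intro integrable_mult_right) (simp add: dominating_def)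
  have bound: "cmod (K u) * u powr (- 1 / 2) \<le> C * (D u * u powr (- 1 / 2))" for u
    using mult_right_mono[OF le[of u], of "u powr (- 1 / 2)"] by (simp add: mult.assoc)
  have iK: "integrable lborel (\<lambda>u. cmod (K u) * u powr (- 1 / 2))"
    by (rule Bochner_Integration.integrable_bound[OF int]) (use bound in \<open>auto intro: order_trans[OF _ abs_ge_self]\<close>)
  have "K u = 0" if "u \<le> 0" for u
    using le[of u] D that by (simp add: dominating_def)
  then show "borel_kernel K"
    using iK by (simp add: borel_kernel_def)
  have "kernel_norm K = (LINT u|lborel. cmod (K u) * u powr (- 1 / 2))"
    unfolding kernel_norm_def by (rule integral_completion) measurable
  also have "\<dots> \<le> (LINT u|lborel. C * (D u * u powr (- 1 / 2)))"
    by (rule integral_mono[OF iK int bound])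
  finally show "kernel_norm K \<le> C * dominating_norm D"
    by (simp add: dominating_norm_def)
qed

text \<open>
  The maps that can be taken out of a contour integral of kernels.  There are two instances, the
  Hausdorff operator of a kernel and the value of its Mellin transform at a point of the line; with
  both, the operator and the symbol of one contour integral are found by the same argument.
\<close>

definition kernel_functional :: "((real \<Rightarrow> complex) \<Rightarrow> 'a::real_normed_vector) \<Rightarrow> bool" where
  "kernel_functional \<Phi> \<longleftrightarrow>
     (\<forall>K L. borel_kernel K \<longrightarrow> borel_kernel L \<longrightarrow> \<Phi> (\<lambda>u. K u + L u) = \<Phi> K + \<Phi> L) \<and>
     (\<forall>r K. borel_kernel K \<longrightarrow> \<Phi> (\<lambda>u. of_real r * K u) = r *\<^sub>R \<Phi> K) \<and>
     (\<exists>C\<ge>0. \<forall>K. borel_kernel K \<longrightarrow> norm (\<Phi> K) \<le> C * kernel_norm K)"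

lemma kernel_functional_diff:
  assumes "kernel_functional \<Phi>" "borel_kernel K" "borel_kernel L"
  shows "\<Phi> (\<lambda>u. K u - L u) = \<Phi> K - \<Phi> L"
proof -
  have "\<Phi> (\<lambda>u. (K u - L u) + L u) = \<Phi> (\<lambda>u. K u - L u) + \<Phi> L"
    using assms borel_kernel_diff unfolding kernel_functional_def by blast
  then show ?thesis
    by simp
qed

text \<open>
  The majorant does not depend on \<open>z\<close>.  The last condition says that primitives with respect to \<open>z\<close>
  are measurable in \<open>u\<close>.
\<close>

definition holomorphic_kernel_on :: "complex set \<Rightarrow> (real \<Rightarrow> real) \<Rightarrow> (complex \<Rightarrow> real \<Rightarrow> complex) \<Rightarrow> bool" where
  "holomorphic_kernel_on S D k \<longleftrightarrow> dominating D \<and>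
     (\<forall>u. (\<lambda>z. k z u) holomorphic_on S) \<and>
     (\<forall>z\<in>S. k z \<in> borel_measurable borel \<and> (\<forall>u. cmod (k z u) \<le> D u)) \<and>
     (\<forall>a b. closed_segment a b \<subseteq> S \<longrightarrow> (\<lambda>u. contour_integral (linepath a b) (\<lambda>z. k z u)) \<in> borel_measurable borel)"

text \<open>
  By Cauchy's estimate the derivative of \<open>k\<close> in \<open>z\<close> is bounded by a multiple of the majorant.  So the
  difference quotients of the primitive \<open>Q\<close> converge in the weighted norm, not just for each \<open>u\<close>, and
  the functional can be applied to the limit.
\<close>

lemma holomorphic_kernel_primitive:
  fixes \<Phi> :: "(real \<Rightarrow> complex) \<Rightarrow> 'a::real_normed_vector"
  assumes r: "0 < r" and k: "holomorphic_kernel_on (ball c r) D k" and \<Phi>: "kernel_functional \<Phi>"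
  defines "Q \<equiv> \<lambda>z u. contour_integral (linepath c z) (\<lambda>w. k w u)"
  shows "z \<in> ball c r \<Longrightarrow> borel_kernel (Q z)"
    and "z \<in> ball c r \<Longrightarrow> ((\<lambda>z. Q z u) has_field_derivative k z u) (at z)"
    and "z \<in> ball c (r / 2) \<Longrightarrow> ((\<lambda>z. \<Phi> (Q z)) has_derivative (\<lambda>h. \<Phi> (\<lambda>u. h * k z u))) (at z)"
proof -
  have D: "dominating D" and hol: "\<And>u. (\<lambda>z. k z u) holomorphic_on ball c r"
    and km: "\<And>z. z \<in> ball c r \<Longrightarrow> k z \<in> borel_measurable borel"
    and bound: "\<And>z u. z \<in> ball c r \<Longrightarrow> cmod (k z u) \<le> D u"
    and int_m: "\<And>a b. closed_segment a b \<subseteq> ball c r \<Longrightarrow>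
      (\<lambda>u. contour_integral (linepath a b) (\<lambda>z. k z u)) \<in> borel_measurable borel"
    using k by (auto simp: holomorphic_kernel_on_def)
  have seg: "closed_segment a b \<subseteq> ball c r" if "a \<in> ball c r" "b \<in> ball c r" for a b
    using that by (intro closed_segment_subset convex_ball)
  have cint: "(\<lambda>w. k w u) contour_integrable_on linepath a b" if "a \<in> ball c r" "b \<in> ball c r" for a b u
    using seg[OF that] hol[of u]
    by (intro contour_integrable_continuous_linepath)
      (auto intro: continuous_on_subset holomorphic_on_imp_continuous_on)
  have Q_diff: "Q b u - Q a u = contour_integral (linepath a b) (\<lambda>w. k w u)"
    if ab: "a \<in> ball c r" "b \<in> ball c r" for a b u
  proof -
    have "convex hull {c, a, b} \<subseteq> ball c r"
      using ab r by (intro hull_minimal) auto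
    then have "((\<lambda>w. k w u) has_contour_integral 0) (linepath c a +++ linepath a b +++ linepath b c)"
      using hol[of u] by (intro Cauchy_theorem_triangle) (rule holomorphic_on_subset)
    from has_chain_integral_chain_integral3[OF this]
    have "Q a u + contour_integral (linepath a b) (\<lambda>w. k w u) + contour_integral (linepath b c) (\<lambda>w. k w u) = 0"
      by (simp add: Q_def)
    moreover have "contour_integral (linepath b c) (\<lambda>w. k w u) = - Q b u"
      unfolding Q_def using cint[of c b u] ab r by (subst contour_integral_reversepath[symmetric]) (auto simp: contour_integral_reversepath)
    ultimately show ?thesis
      by (simp add: algebra_simps add_eq_0_iff)
  qed
  have D_nonneg: "0 \<le> D u" for u
    using bound[of c u] r order_trans[OF norm_ge_zero] by auto
  have Q_m: "Q z \<in> borel_measurable borel" if "z \<in> ball c r" for z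
    unfolding Q_def using that r by (intro int_m seg) auto
  show Qk: "borel_kernel (Q z)" if z: "z \<in> ball c r" for z
  proof (rule dominated_kernel(1)[OF D Q_m[OF z]])
    fix u
    have "norm (contour_integral (linepath c z) (\<lambda>w. k w u)) \<le> D u * norm (z - c)"
      by (rule contour_integral_bound_linepath[OF cint]) (use z r seg[of c z] bound D_nonneg in auto)
    then show "cmod (Q z u) \<le> norm (z - c) * D u"
      by (simp add: Q_def mult.commute)
  qed
  have kk: "borel_kernel (k z)" if z: "z \<in> ball c r" for z
    using bound[OF z] by (intro dominated_kernel(1)[OF D km[OF z], of 1]) simp
  have deriv: "cmod (deriv (\<lambda>z. k z u) z) \<le> 4 / r * D u" if z: "z \<in> ball c (r / 2)" for z u
  proof -
    have sub: "cball z (r / 4) \<subseteq> ball c r"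
    proof
      fix w assume "w \<in> cball z (r / 4)"
      then show "w \<in> ball c r"
        using z dist_triangle[of c w z] r by simp
    qed
    have "cmod ((deriv ^^ 1) (\<lambda>z. k z u) z) \<le> fact 1 * D u / (r / 4) ^ 1"
    proof (rule Cauchy_inequality)
      show "(\<lambda>z. k z u) holomorphic_on ball z (r / 4)" "continuous_on (cball z (r / 4)) (\<lambda>z. k z u)"
        using holomorphic_on_subset[OF hol order_trans[OF ball_subset_cball sub]]
          continuous_on_subset[OF holomorphic_on_imp_continuous_on[OF hol] sub] by auto
      show "cmod (k x u) \<le> D u" if "cmod (z - x) = r / 4" for x
        using that sub by (intro bound) (auto simp: dist_norm)
    qed (use r in simp)
    then show ?thesis
      by (simp add: mult.commute)
  qed
  have lip: "cmod (k w u - k z u) \<le> 4 / r * D u * cmod (w - z)" if "w \<in> ball c (r / 2)" "z \<in> ball c (r / 2)" for w z u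
  proof (rule field_differentiable_bound[where S = "ball c (r / 2)" and f' = "deriv (\<lambda>z. k z u)"])
    fix x assume "x \<in> ball c (r / 2)"
    moreover from this have "x \<in> ball c r"
      using r by simp
    ultimately show "((\<lambda>z. k z u) has_field_derivative deriv (\<lambda>z. k z u) x) (at x within ball c (r / 2))"
      using holomorphic_derivI[OF hol[of u]] by (auto intro: has_field_derivative_at_within)
  qed (use that deriv in auto)
  \<comment> \<open>A second-order remainder, uniform in \<open>u\<close> up to the majorant.\<close>
  have second: "cmod (Q w u - Q z u - (w - z) * k z u) \<le> (4 / r * (cmod (w - z))\<^sup>2) * D u"
    if wz: "w \<in> ball c (r / 2)" "z \<in> ball c (r / 2)" for w z u
  proof -
    have wz': "w \<in> ball c r" "z \<in> ball c r"
      using wz r by auto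
    have "((\<lambda>x. k x u - k z u) has_contour_integral (Q w u - Q z u - k z u * (w - z))) (linepath z w)"
      unfolding Q_diff[OF wz'(2,1)]
      by (intro has_contour_integral_diff has_contour_integral_integral cint wz' has_contour_integral_const_linepath)
    then have "cmod (Q w u - Q z u - k z u * (w - z)) \<le> (4 / r * D u * cmod (w - z)) * cmod (w - z)"
    proof (rule has_contour_integral_bound_linepath)
      fix x assume x: "x \<in> closed_segment z w"
      have "x \<in> ball c (r / 2)"
        using x wz closed_segment_subset[OF wz(2,1) convex_ball] by blast
      then have "cmod (k x u - k z u) \<le> 4 / r * D u * cmod (x - z)"
        by (rule lip[OF _ wz(2)])
      also have "\<dots> \<le> 4 / r * D u * cmod (w - z)"
        using segment_bound1[OF x] r D_nonneg by (intro mult_left_mono) auto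
      finally show "cmod (k x u - k z u) \<le> 4 / r * D u * cmod (w - z)" .
    qed (use r D_nonneg in auto)
    then show ?thesis
      by (simp add: power2_eq_square mult_ac)
  qed
  show "((\<lambda>z. Q z u) has_field_derivative k z u) (at z)" if z: "z \<in> ball c r"
  proof -
    have "((\<lambda>z. Q z u) has_field_derivative k z u) (at z within ball c r)"
      unfolding Q_def
    proof (rule triangle_contour_integrals_convex_primitive)
      show "continuous_on (ball c r) (\<lambda>z. k z u)"
        using hol by (rule holomorphic_on_imp_continuous_on)
      show "contour_integral (linepath c a) (\<lambda>z. k z u) + contour_integral (linepath a b) (\<lambda>z. k z u)
          + contour_integral (linepath b c) (\<lambda>z. k z u) = 0"
        if "a \<in> ball c r" "b \<in> ball c r" for a b
      proof -
        have "convex hull {c, a, b} \<subseteq> ball c r"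
          using that r by (intro hull_minimal) auto
        then show ?thesis
          using hol[of u] by (intro has_chain_integral_chain_integral3 Cauchy_theorem_triangle) (rule holomorphic_on_subset)
      qed
    qed (use z r in auto)
    then show ?thesis
      unfolding at_within_open[OF z open_ball] .
  qed
  obtain C where C: "0 \<le> C" "\<And>K. borel_kernel K \<Longrightarrow> norm (\<Phi> K) \<le> C * kernel_norm K"
    using \<Phi> by (auto simp: kernel_functional_def)
  have add: "\<Phi> (\<lambda>u. K u + L u) = \<Phi> K + \<Phi> L" if "borel_kernel K" "borel_kernel L" for K L
    using \<Phi> that by (auto simp: kernel_functional_def)
  have scale: "\<Phi> (\<lambda>u. of_real t * K u) = t *\<^sub>R \<Phi> K" if "borel_kernel K" for K t
    using \<Phi> that by (auto simp: kernel_functional_def)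
  show "((\<lambda>z. \<Phi> (Q z)) has_derivative (\<lambda>h. \<Phi> (\<lambda>u. h * k z u))) (at z)" if z: "z \<in> ball c (r / 2)"
  proof -
    have z': "z \<in> ball c r"
      using z r by auto
    have bl: "bounded_linear (\<lambda>h. \<Phi> (\<lambda>u. h * k z u))"
    proof (rule bounded_linear_intro)
      show "\<Phi> (\<lambda>u. (x + y) * k z u) = \<Phi> (\<lambda>u. x * k z u) + \<Phi> (\<lambda>u. y * k z u)" for x y
        using add[OF borel_kernel_scale[OF kk[OF z']] borel_kernel_scale[OF kk[OF z']]] by (simp add: distrib_right)
      show "\<Phi> (\<lambda>u. (t *\<^sub>R x) * k z u) = t *\<^sub>R \<Phi> (\<lambda>u. x * k z u)" for t x
        using scale[OF borel_kernel_scale[OF kk[OF z']]] by (simp add: scaleR_conv_of_real mult.assoc)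
      show "norm (\<Phi> (\<lambda>u. x * k z u)) \<le> norm x * (C * kernel_norm (k z))" for x
        using C(2)[OF borel_kernel_scale[OF kk[OF z'], of x]]
          mellin_kernel_scale(2)[OF borel_kernel_mellin_kernel[OF kk[OF z']], of x] by (simp add: mult_ac)
    qed
    define M where "M = C * (4 / r * dominating_norm D)"
    have est: "norm (\<Phi> (Q w) - \<Phi> (Q z) - \<Phi> (\<lambda>u. (w - z) * k z u)) \<le> M * (norm (w - z))\<^sup>2"
      if w: "w \<in> ball c (r / 2)" for w
    proof -
      have w': "w \<in> ball c r"
        using w r by auto
      have eq: "\<Phi> (Q w) - \<Phi> (Q z) - \<Phi> (\<lambda>u. (w - z) * k z u) = \<Phi> (\<lambda>u. Q w u - Q z u - (w - z) * k z u)"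
        using kernel_functional_diff[OF \<Phi> Qk[OF w'] Qk[OF z']]
          kernel_functional_diff[OF \<Phi> borel_kernel_diff[OF Qk[OF w'] Qk[OF z']] borel_kernel_scale[OF kk[OF z'], of "w - z"]]
        by simp
      have "norm (\<Phi> (\<lambda>u. Q w u - Q z u - (w - z) * k z u))
          \<le> C * kernel_norm (\<lambda>u. Q w u - Q z u - (w - z) * k z u)"
        by (intro C(2) borel_kernel_diff borel_kernel_scale Qk kk w' z')
      also have "\<dots> \<le> C * ((4 / r * (cmod (w - z))\<^sup>2) * dominating_norm D)"
      proof (rule mult_left_mono[OF _ C(1)])
        show "kernel_norm (\<lambda>u. Q w u - Q z u - (w - z) * k z u) \<le> (4 / r * (cmod (w - z))\<^sup>2) * dominating_norm D"
          by (rule dominated_kernel(2)[OF D _ second[OF w z]])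
            (intro borel_measurable_diff borel_measurable_times borel_measurable_const Q_m km w' z')
      qed
      finally show ?thesis
        unfolding eq by (simp add: M_def mult_ac)
    qed
    show ?thesis
      unfolding has_derivative_at_within has_derivative_def
    proof (intro conjI bl)
      have "((\<lambda>w. M * norm (w - z)) \<longlongrightarrow> M * norm (z - z)) (at z)"
        by (intro tendsto_intros)
      then have lim: "((\<lambda>w. M * norm (w - z)) \<longlongrightarrow> 0) (at z)"
        by simp
      have "eventually (\<lambda>w. w \<in> ball c (r / 2) \<and> w \<noteq> z) (at z)"
        using z eventually_at_in_open'[of "ball c (r / 2)" z] by (simp add: eventually_conj_iff eventually_neq_at_within)
      then have "eventually (\<lambda>w. norm ((\<Phi> (Q w) - \<Phi> (Q z) - \<Phi> (\<lambda>u. (w - z) * k z u)) /\<^sub>R norm (w - z)) \<le> M * norm (w - z)) (at z)"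
      proof eventually_elim
        case (elim w)
        have "inverse (norm (w - z)) * norm (\<Phi> (Q w) - \<Phi> (Q z) - \<Phi> (\<lambda>u. (w - z) * k z u))
            \<le> inverse (norm (w - z)) * (M * (norm (w - z))\<^sup>2)"
          using est elim by (intro mult_left_mono) auto
        also have "\<dots> = M * norm (w - z)"
          using elim by (simp add: power2_eq_square field_simps)
        finally show ?case
          by simp
      qed
      from Lim_null_comparison[OF this lim]
      show "((\<lambda>w. (\<Phi> (Q w) - \<Phi> (Q (Lim (at z) (\<lambda>x. x))) - \<Phi> (\<lambda>u. (w - Lim (at z) (\<lambda>x. x)) * k z u)) /\<^sub>R norm (w - Lim (at z) (\<lambda>x. x))) \<longlongrightarrow> 0) (at z)"
        by (simp add: Lim_ident_at)
    qed
  qed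
qed

text \<open>
  The derivative of a piecewise continuously differentiable curve may be unbounded near the
  exceptional points.  The fundamental theorem of calculus still applies, because the curve itself is
  continuous there.
\<close>

lemma integral_along_curve:
  fixes P :: "complex \<Rightarrow> 'a::banach"
  assumes \<gamma>: "valid_path \<gamma>" and st: "0 \<le> s" "s \<le> t" "t \<le> 1"
    and P: "\<And>\<tau>. \<tau> \<in> {s..t} \<Longrightarrow> (P has_derivative P' (\<gamma> \<tau>)) (at (\<gamma> \<tau>))"
  shows "((\<lambda>\<tau>. P' (\<gamma> \<tau>) (vector_derivative \<gamma> (at \<tau> within {0..1}))) has_integral P (\<gamma> t) - P (\<gamma> s)) {s..t}"
proof -
  obtain S where S: "finite S" "\<And>\<tau>. \<tau> \<in> {0..1} - S \<Longrightarrow> \<gamma> differentiable at \<tau>"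
    using \<gamma> by (auto simp: valid_path_def piecewise_C1_differentiable_on_def C1_differentiable_on_eq)
  have c: "continuous_on {0..1} \<gamma>"
    using \<gamma> valid_path_imp_path by (auto simp: path_def)
  have "((\<lambda>\<tau>. P' (\<gamma> \<tau>) (vector_derivative \<gamma> (at \<tau> within {0..1}))) has_integral (P \<circ> \<gamma>) t - (P \<circ> \<gamma>) s) {s..t}"
  proof (rule fundamental_theorem_of_calculus_interior_strong[OF S(1) st(2)])
    fix \<tau> assume \<tau>: "\<tau> \<in> {s<..<t} - S"
    then have "\<gamma> differentiable at \<tau>"
      using st by (intro S(2)) auto
    then have "(\<gamma> has_vector_derivative vector_derivative \<gamma> (at \<tau>)) (at \<tau>)"
      by (simp add: vector_derivative_works)
    moreover have "vector_derivative \<gamma> (at \<tau> within {0..1}) = vector_derivative \<gamma> (at \<tau>)"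
      using \<tau> st by (simp add: at_within_Icc_at)
    moreover have "(P has_derivative P' (\<gamma> \<tau>)) (at (\<gamma> \<tau>) within range \<gamma>)"
      using P[of \<tau>] \<tau> by (auto intro: has_derivative_at_withinI)
    ultimately show "(P \<circ> \<gamma> has_vector_derivative P' (\<gamma> \<tau>) (vector_derivative \<gamma> (at \<tau> within {0..1}))) (at \<tau>)"
      using vector_derivative_diff_chain_within[of \<gamma> _ \<tau> UNIV P] by simp
  next
    have "continuous_on (\<gamma> ` {s..t}) P"
      by (auto intro!: continuous_at_imp_continuous_on has_derivative_continuous[OF P])
    then show "continuous_on {s..t} (P \<circ> \<gamma>)"
      using st by (intro continuous_on_compose continuous_on_subset[OF c]) auto
  qed
  then show ?thesis
    by simp
qed

text \<open>
  The parameter interval splits into finitely many pieces on which the kernel has a primitive; on each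
  piece both integrals are differences of values of primitives.  Fubini's theorem would not do, since
  the curve may have infinite length.
\<close>

lemma kernel_functional_contour_integral:
  fixes \<Phi> :: "(real \<Rightarrow> complex) \<Rightarrow> 'a::banach"
  assumes \<gamma>: "valid_path \<gamma>" and \<Phi>: "kernel_functional \<Phi>"
    and local: "\<And>z. z \<in> path_image \<gamma> \<Longrightarrow> \<exists>r>0. \<exists>D. holomorphic_kernel_on (ball z r) D k"
  shows "borel_kernel (\<lambda>u. contour_integral \<gamma> (\<lambda>z. k z u))"
    and "((\<lambda>\<tau>. \<Phi> (\<lambda>u. vector_derivative \<gamma> (at \<tau> within {0..1}) * k (\<gamma> \<tau>) u))
      has_integral \<Phi> (\<lambda>u. contour_integral \<gamma> (\<lambda>z. k z u))) {0..1}"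
proof -
  let ?v = "\<lambda>\<tau>. vector_derivative \<gamma> (at \<tau> within {0..1})"
  define good where "good s t \<longleftrightarrow> (0 \<le> s \<and> t \<le> 1 \<longrightarrow> (\<exists>K. borel_kernel K \<and>
    (\<forall>u. ((\<lambda>\<tau>. ?v \<tau> * k (\<gamma> \<tau>) u) has_integral K u) {s..t}) \<and>
    ((\<lambda>\<tau>. \<Phi> (\<lambda>u. ?v \<tau> * k (\<gamma> \<tau>) u)) has_integral \<Phi> K) {s..t}))" for s t
  have cont: "continuous_on {0..1} \<gamma>"
    using \<gamma> valid_path_imp_path by (auto simp: path_def)
  have "good 0 1"
  proof (rule Bolzano)
    fix a b c assume ab: "good a b" and bc: "good b c" and le: "a \<le> b" "b \<le> c"
    show "good a c"
      unfolding good_def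
    proof
      assume "0 \<le> a \<and> c \<le> 1"
      then obtain K L where K: "borel_kernel K" "\<And>u. ((\<lambda>\<tau>. ?v \<tau> * k (\<gamma> \<tau>) u) has_integral K u) {a..b}"
          "((\<lambda>\<tau>. \<Phi> (\<lambda>u. ?v \<tau> * k (\<gamma> \<tau>) u)) has_integral \<Phi> K) {a..b}"
        and L: "borel_kernel L" "\<And>u. ((\<lambda>\<tau>. ?v \<tau> * k (\<gamma> \<tau>) u) has_integral L u) {b..c}"
          "((\<lambda>\<tau>. \<Phi> (\<lambda>u. ?v \<tau> * k (\<gamma> \<tau>) u)) has_integral \<Phi> L) {b..c}"
        using ab bc le unfolding good_def by (meson order_trans)
      have "\<Phi> (\<lambda>u. K u + L u) = \<Phi> K + \<Phi> L"
        using \<Phi> K(1) L(1) by (auto simp: kernel_functional_def)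
      then show "\<exists>K. borel_kernel K \<and> (\<forall>u. ((\<lambda>\<tau>. ?v \<tau> * k (\<gamma> \<tau>) u) has_integral K u) {a..c}) \<and>
          ((\<lambda>\<tau>. \<Phi> (\<lambda>u. ?v \<tau> * k (\<gamma> \<tau>) u)) has_integral \<Phi> K) {a..c}"
        using K L le
        by (intro exI[of _ "\<lambda>u. K u + L u"] conjI allI borel_kernel_add) (auto intro: has_integral_combine)
    qed
  next
    fix x :: real assume x: "0 \<le> x" "x \<le> 1"
    then have "\<gamma> x \<in> path_image \<gamma>"
      by (auto simp: path_image_def)
    from local[OF this] obtain r D where r: "0 < r" and hk: "holomorphic_kernel_on (ball (\<gamma> x) r) D k"
      by blast
    from cont x r obtain d where d: "0 < d" "\<And>\<tau>. \<tau> \<in> {0..1} \<Longrightarrow> dist \<tau> x < d \<Longrightarrow> dist (\<gamma> \<tau>) (\<gamma> x) < r / 2"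
      unfolding continuous_on_iff by (metis atLeastAtMost_iff half_gt_zero)
    define Q where "Q z u = contour_integral (linepath (\<gamma> x) z) (\<lambda>w. k w u)" for z u
    note prim = holomorphic_kernel_primitive[OF r hk \<Phi>, folded Q_def]
    show "\<exists>d>0. \<forall>a b. a \<le> x \<and> x \<le> b \<and> b - a < d \<longrightarrow> good a b"
    proof (intro exI[of _ d] conjI allI impI d(1))
      fix a b assume ab: "a \<le> x \<and> x \<le> b \<and> b - a < d"
      show "good a b"
        unfolding good_def
      proof
        assume 01: "0 \<le> a \<and> b \<le> 1"
        have near: "\<gamma> \<tau> \<in> ball (\<gamma> x) (r / 2)" if "\<tau> \<in> {a..b}" for \<tau>
          using d(2)[of \<tau>] that ab 01 by (auto simp: dist_commute dist_real_def)
        have near': "\<gamma> \<tau> \<in> ball (\<gamma> x) r" if "\<tau> \<in> {a..b}" for \<tau>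
          using near[OF that] r by simp
        have ends: "a \<in> {a..b}" "b \<in> {a..b}"
          using ab by auto
        have "((\<lambda>\<tau>. ?v \<tau> * k (\<gamma> \<tau>) u) has_integral (Q (\<gamma> b) u - Q (\<gamma> a) u)) {a..b}" for u
          using integral_along_curve[OF \<gamma>, of a b "\<lambda>z. Q z u" "\<lambda>z h. h * k z u"] 01 ab prim(2)[OF near']
          by (simp add: has_field_derivative_def mult_commute_abs)
        moreover have "((\<lambda>\<tau>. \<Phi> (\<lambda>u. ?v \<tau> * k (\<gamma> \<tau>) u)) has_integral (\<Phi> (Q (\<gamma> b)) - \<Phi> (Q (\<gamma> a)))) {a..b}"
          using integral_along_curve[OF \<gamma>, of a b "\<lambda>z. \<Phi> (Q z)" "\<lambda>z h. \<Phi> (\<lambda>u. h * k z u)"] 01 ab prim(3)[OF near]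
          by simp
        moreover have "\<Phi> (\<lambda>u. Q (\<gamma> b) u - Q (\<gamma> a) u) = \<Phi> (Q (\<gamma> b)) - \<Phi> (Q (\<gamma> a))"
          using kernel_functional_diff[OF \<Phi> prim(1)[OF near'[OF ends(2)]] prim(1)[OF near'[OF ends(1)]]] .
        ultimately show "\<exists>K. borel_kernel K \<and> (\<forall>u. ((\<lambda>\<tau>. ?v \<tau> * k (\<gamma> \<tau>) u) has_integral K u) {a..b}) \<and>
            ((\<lambda>\<tau>. \<Phi> (\<lambda>u. ?v \<tau> * k (\<gamma> \<tau>) u)) has_integral \<Phi> K) {a..b}"
          using borel_kernel_diff[OF prim(1)[OF near'[OF ends(2)]] prim(1)[OF near'[OF ends(1)]]]
          by (intro exI[of _ "\<lambda>u. Q (\<gamma> b) u - Q (\<gamma> a) u"]) simp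
      qed
    qed
  qed simp
  then obtain K where K: "borel_kernel K" "\<And>u. ((\<lambda>\<tau>. ?v \<tau> * k (\<gamma> \<tau>) u) has_integral K u) {0..1}"
      "((\<lambda>\<tau>. \<Phi> (\<lambda>u. ?v \<tau> * k (\<gamma> \<tau>) u)) has_integral \<Phi> K) {0..1}"
    by (auto simp: good_def)
  have "contour_integral \<gamma> (\<lambda>z. k z u) = K u" for u
    using K(2)[of u] by (intro contour_integral_unique) (simp add: has_contour_integral_def mult.commute)
  then show "borel_kernel (\<lambda>u. contour_integral \<gamma> (\<lambda>z. k z u))"
    and "((\<lambda>\<tau>. \<Phi> (\<lambda>u. ?v \<tau> * k (\<gamma> \<tau>) u)) has_integral \<Phi> (\<lambda>u. contour_integral \<gamma> (\<lambda>z. k z u))) {0..1}"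
    using K by simp_all
qed

text \<open>
  On a small closed disc off the circle, \<open>Re (1 / z)\<close> stays on one side of \<open>1 / 2\<close>.  Its extreme
  value \<open>\<alpha>\<close> on the disc gives the majorant \<open>u\<^sup>-\<^sup>\<alpha>\<close>, up to a constant, on the support of
  the kernel, which is integrable against the weight because \<open>\<alpha>\<close> is strictly on that side.
\<close>

lemma weighted_resolvent_kernel_locally_holomorphic:
  assumes U: "open U" and F: "F holomorphic_on U" and z0: "z0 \<in> U" "cmod (z0 - 1) \<noteq> 1"
  shows "\<exists>r>0. \<exists>D. holomorphic_kernel_on (ball z0 r) D (\<lambda>z u. F z * resolvent_kernel z u)"
proof -
  define e where "e z u = F z * (inverse z)\<^sup>2 * exp (- inverse z * complex_of_real (ln u))" for z u
  \<comment> \<open>Both sides of the circle at once: \<open>A\<close> is the support and \<open>\<sigma>\<close> the sign of the kernel.\<close>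
  have key: "\<exists>D. holomorphic_kernel_on (ball z0 r) D (\<lambda>z u. F z * resolvent_kernel z u)"
    if r: "0 < r" and sub: "cball z0 r \<subseteq> U - {0}"
      and res: "\<And>z u. z \<in> cball z0 r \<Longrightarrow> F z * resolvent_kernel z u = (if A u then \<sigma> * e z u else 0)"
      and A: "Measurable.pred borel A" "\<And>u. A u \<Longrightarrow> 0 < u"
      and \<alpha>: "integrable lborel (\<lambda>u. if A u then u powr (- \<alpha> - 1 / 2) else 0)"
        "\<And>z u. z \<in> cball z0 r \<Longrightarrow> A u \<Longrightarrow> u powr (- Re (inverse z)) \<le> u powr (- \<alpha>)"
    for r \<alpha> A and \<sigma> :: complex
  proof -
    have n0: "0 \<notin> ball z0 r"
      using sub ball_subset_cball by blast
    have F': "F holomorphic_on cball z0 r"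
      using F sub by (auto intro: holomorphic_on_subset)
    have cF: "continuous_on (cball z0 r) (\<lambda>z. F z * (inverse z)\<^sup>2)"
      using sub by (intro continuous_intros holomorphic_on_imp_continuous_on[OF F']) auto
    then have "bounded ((\<lambda>z. F z * (inverse z)\<^sup>2) ` cball z0 r)"
      by (intro compact_imp_bounded compact_continuous_image) auto
    then obtain M where M: "0 < M" "\<And>z. z \<in> cball z0 r \<Longrightarrow> cmod (F z * (inverse z)\<^sup>2) \<le> M"
      by (auto simp: bounded_pos)
    define D where "D u = (if A u then cmod \<sigma> * M * u powr (- \<alpha>) else 0)" for u
    have seg: "closed_segment a b \<subseteq> cball z0 r" if "closed_segment a b \<subseteq> ball z0 r" for a b
      using that ball_subset_cball by blast
    have "dominating D"
      unfolding dominating_def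
    proof (intro conjI allI impI)
      show "D u = 0" if "u \<le> 0" for u
        using A(2)[of u] that by (auto simp: D_def)
      have "(\<lambda>u. D u * u powr (- 1 / 2)) = (\<lambda>u. cmod \<sigma> * M * (if A u then u powr (- \<alpha> - 1 / 2) else 0))"
        by (auto simp: D_def simp flip: powr_add)
      then show "integrable lborel (\<lambda>u. D u * u powr (- 1 / 2))"
        using \<alpha>(1) by (simp only: integrable_mult_right)
    qed
    moreover have "(\<lambda>z. F z * resolvent_kernel z u) holomorphic_on ball z0 r" for u
    proof -
      have "(\<lambda>z. if A u then \<sigma> * e z u else 0) holomorphic_on ball z0 r"
        unfolding e_def using n0 F' ball_subset_cball[of z0 r]
        by (cases "A u") (auto intro!: holomorphic_intros intro: holomorphic_on_subset)
      then show ?thesis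
        by (rule holomorphic_transform) (simp add: res)
    qed
    moreover have "(\<lambda>u. F z * resolvent_kernel z u) \<in> borel_measurable borel" if "z \<in> ball z0 r" for z
    proof -
      have "(\<lambda>u. if A u then \<sigma> * e z u else 0) \<in> borel_measurable borel"
        unfolding e_def using A(1) by measurable
      then show ?thesis
        using res[of z] that by simp
    qed
    moreover have "cmod (F z * resolvent_kernel z u) \<le> D u" if z: "z \<in> ball z0 r" for z u
    proof (cases "A u")
      case True
      have "cmod (e z u) \<le> M * u powr (- \<alpha>)"
        unfolding e_def norm_mult[of "F z * (inverse z)\<^sup>2"] norm_exp_of_real_ln[OF A(2)[OF True]]
        using M(2)[of z] M(1) \<alpha>(2)[of z u] z True by (intro mult_mono) auto
      then show ?thesis
        using res[of z u] z True by (simp add: D_def norm_mult mult.assoc mult_left_mono)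
    qed (use res[of z u] z in \<open>simp add: D_def\<close>)
    moreover have "(\<lambda>u. contour_integral (linepath a b) (\<lambda>z. F z * resolvent_kernel z u)) \<in> borel_measurable borel"
      if ab: "closed_segment a b \<subseteq> ball z0 r" for a b
    proof -
      have lin: "linepath a b t \<in> cball z0 r" if "t \<in> {0..1}" for t
        using seg[OF ab] that linepath_in_path by blast
      have "continuous_on ({0<..} \<times> cbox 0 1) (\<lambda>(u, t). \<sigma> * e (linepath a b t) u * (b - a))"
      proof -
        let ?T = "{0<..} \<times> cbox 0 1 :: (real \<times> real) set"
        have l: "continuous_on ?T (\<lambda>x. linepath a b (snd x))"
          by (intro continuous_on_compose2[OF continuous_on_linepath continuous_on_snd[OF continuous_on_id]]) auto
        have "linepath a b (snd x) \<in> cball z0 r" if "x \<in> ?T" for x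
          using that by (intro lin) auto
        then have 1: "continuous_on ?T (\<lambda>x. F (linepath a b (snd x)) * (inverse (linepath a b (snd x)))\<^sup>2)"
          and ne: "\<forall>x\<in>?T. linepath a b (snd x) \<noteq> 0"
          using sub by (blast intro: continuous_on_compose2[OF cF l])+
        have 2: "continuous_on ?T (\<lambda>x. complex_of_real (ln (fst x)))"
          by (intro continuous_on_of_real continuous_on_ln continuous_on_fst continuous_on_id) auto
        show ?thesis
          unfolding e_def case_prod_unfold
          by (intro continuous_on_mult continuous_on_const continuous_on_exp continuous_on_minus
              continuous_on_inverse 1 2 l ne)
      qed
      from integral_continuous_on_param[OF this]
      have c: "continuous_on {0<..} (\<lambda>u. integral (cbox 0 1) (\<lambda>t. \<sigma> * e (linepath a b t) u * (b - a)))" .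
      have "(\<lambda>u. contour_integral (linepath a b) (\<lambda>z. F z * resolvent_kernel z u))
          = (\<lambda>u. if A u then indicator {0<..} u *\<^sub>R integral (cbox 0 1) (\<lambda>t. \<sigma> * e (linepath a b t) u * (b - a)) else 0)"
      proof
        fix u
        have "contour_integral (linepath a b) (\<lambda>z. F z * resolvent_kernel z u)
            = contour_integral (linepath a b) (\<lambda>z. if A u then \<sigma> * e z u else 0)"
        proof (rule contour_integral_eq)
          fix z assume "z \<in> path_image (linepath a b)"
          then have "z \<in> cball z0 r"
            using seg[OF ab] by auto
          then show "F z * resolvent_kernel z u = (if A u then \<sigma> * e z u else 0)"
            by (rule res)
        qed
        also have "\<dots> = (if A u then indicator {0<..} u *\<^sub>R integral (cbox 0 1) (\<lambda>t. \<sigma> * e (linepath a b t) u * (b - a)) else 0)"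
          using A(2)[of u] by (simp add: contour_integral_integral)
        finally show "contour_integral (linepath a b) (\<lambda>z. F z * resolvent_kernel z u)
            = (if A u then indicator {0<..} u *\<^sub>R integral (cbox 0 1) (\<lambda>t. \<sigma> * e (linepath a b t) u * (b - a)) else 0)" .
      qed
      moreover have "(\<lambda>u. indicator {0<..} u *\<^sub>R integral (cbox 0 1) (\<lambda>t. \<sigma> * e (linepath a b t) u * (b - a))) \<in> borel_measurable borel"
        using c by (intro borel_measurable_continuous_on_indicator) auto
      from measurable_If[OF this measurable_const, of 0 A] A(1)
      have "(\<lambda>u. if A u then indicator {0<..} u *\<^sub>R integral (cbox 0 1) (\<lambda>t. \<sigma> * e (linepath a b t) u * (b - a)) else 0)
          \<in> borel_measurable borel"
        by (simp only: pred_def space_borel UNIV_I)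
      ultimately show ?thesis
        by (simp only:)
    qed
    ultimately show ?thesis
      unfolding holomorphic_kernel_on_def by blast
  qed
  have Re_cont: "continuous_on (cball z0 r) (\<lambda>z. Re (inverse z))" if "cball z0 r \<subseteq> U - {0}" for r
    using that by (intro continuous_intros) auto
  show ?thesis
  proof (cases "1 < cmod (z0 - 1)")
    case True
    have "open (U \<inter> {z. 1 < cmod (z - 1)})"
      using U by (intro open_Int open_Collect_less continuous_intros)
    then obtain r where r: "0 < r" "cball z0 r \<subseteq> U \<inter> {z. 1 < cmod (z - 1)}"
      using z0(1) True open_contains_cball by (metis (no_types, lifting) IntI mem_Collect_eq)
    then have sub: "cball z0 r \<subseteq> U - {0}"
      using Re_inverse_outside(1) by blast
    obtain y where y: "y \<in> cball z0 r" "\<And>z. z \<in> cball z0 r \<Longrightarrow> Re (inverse z) \<le> Re (inverse y)"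
      using continuous_attains_sup[OF compact_cball _ Re_cont[OF sub]] r(1) by (auto simp del: inverse_complex.sel)
    have lt: "Re (inverse y) < 1 / 2"
      using y(1) r(2) Re_inverse_outside(2) by blast
    have "\<exists>D. holomorphic_kernel_on (ball z0 r) D (\<lambda>z u. F z * resolvent_kernel z u)"
    proof (rule key[OF r(1) sub, where A = "\<lambda>u. 0 < u \<and> u < 1" and \<sigma> = 1 and \<alpha> = "Re (inverse y)"])
      show "F z * resolvent_kernel z u = (if 0 < u \<and> u < 1 then 1 * e z u else 0)" if "z \<in> cball z0 r" for z u
        using that r(2) by (auto simp: resolvent_kernel_def e_def)
      show "integrable lborel (\<lambda>u. if 0 < u \<and> u < 1 then u powr (- Re (inverse y) - 1 / 2) else 0)"
        using lt by (intro integrable_powr_unit_interval) simp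
      show "u powr (- Re (inverse z)) \<le> u powr (- Re (inverse y))" if "z \<in> cball z0 r" "0 < u \<and> u < 1" for z u
        using y(2)[OF that(1)] that(2) by (intro powr_mono') (auto simp del: inverse_complex.sel)
    qed (use in auto)
    then show ?thesis
      using r(1) by blast
  next
    case False
    then have ins: "cmod (z0 - 1) < 1"
      using z0(2) by simp
    have "open (U \<inter> {z. cmod (z - 1) < 1})"
      using U by (intro open_Int open_Collect_less continuous_intros)
    then obtain r where r: "0 < r" "cball z0 r \<subseteq> U \<inter> {z. cmod (z - 1) < 1}"
      using z0(1) ins open_contains_cball by (metis (no_types, lifting) IntI mem_Collect_eq)
    then have sub: "cball z0 r \<subseteq> U - {0}"
      using Re_inverse_inside(1) by blast
    obtain y where y: "y \<in> cball z0 r" "\<And>z. z \<in> cball z0 r \<Longrightarrow> Re (inverse y) \<le> Re (inverse z)"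
      using continuous_attains_inf[OF compact_cball _ Re_cont[OF sub]] r(1) by (auto simp del: inverse_complex.sel)
    have lt: "1 / 2 < Re (inverse y)"
      using y(1) r(2) Re_inverse_inside(2) by blast
    have "\<exists>D. holomorphic_kernel_on (ball z0 r) D (\<lambda>z u. F z * resolvent_kernel z u)"
    proof (rule key[OF r(1) sub, where A = "\<lambda>u. 1 \<le> u" and \<sigma> = "- 1" and \<alpha> = "Re (inverse y)"])
      show "F z * resolvent_kernel z u = (if 1 \<le> u then - 1 * e z u else 0)" if "z \<in> cball z0 r" for z u
        using that r(2) by (auto simp: resolvent_kernel_def e_def)
      show "integrable lborel (\<lambda>u. if 1 \<le> u then u powr (- Re (inverse y) - 1 / 2) else 0)"
        using lt by (intro integrable_powr_to_infinity) auto
      show "u powr (- Re (inverse z)) \<le> u powr (- Re (inverse y))" if "z \<in> cball z0 r" "1 \<le> u" for z u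
        using y(2)[OF that(1)] that(2) by (intro powr_mono) (auto simp del: inverse_complex.sel)
    qed (use in auto)
    then show ?thesis
      using r(1) by blast
  qed
qed

section \<open>Uniqueness of the Mellin transform\<close>

text \<open>
  The positive and the negative part of \<open>h\<close> have the same total mass, the case \<open>t = 0\<close>.  Normalised and
  pushed forward by \<open>ln\<close>, they are probability distributions with the same characteristic function,
  so Levy's uniqueness theorem applies.
\<close>

lemma Levy_uniqueness_density:
  fixes h :: "real \<Rightarrow> real"
  assumes int: "integrable lborel h" and [measurable]: "h \<in> borel_measurable borel"
    and h0: "\<And>u. u \<le> 0 \<Longrightarrow> h u = 0"
    and char: "\<And>t. (LINT u|lborel. of_real (h u) * iexp (t * ln u)) = 0"
  shows "AE u in lborel. h u = 0"
proof -
  define p n where "p u = max 0 (h u)" and "n u = max 0 (- h u)" for u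
  have [measurable]: "p \<in> borel_measurable borel" "n \<in> borel_measurable borel"
    unfolding p_def n_def by measurable
  have pn: "0 \<le> p u" "0 \<le> n u" "h u = p u - n u" for u
    by (auto simp: p_def n_def)
  have pn0: "p u = 0" "n u = 0" if "u \<le> 0" for u
    using h0[OF that] by (simp_all add: p_def n_def)
  have int_p: "integrable lborel p" and int_n: "integrable lborel n"
    unfolding p_def n_def using int by (auto intro!: integrable_max)
  have ii: "complex_integrable lborel (\<lambda>u. of_real (q u) * iexp (t * ln u))"
    if "integrable lborel q" "q \<in> borel_measurable borel" for q :: "real \<Rightarrow> real" and t
    by (rule Bochner_Integration.integrable_bound[OF that(1)]) (use that(2) in \<open>auto simp: norm_mult\<close>)
  have eq: "(LINT u|lborel. of_real (p u) * iexp (t * ln u)) = (LINT u|lborel. of_real (n u) * iexp (t * ln u))" for t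
    using char[of t] ii[OF int_p] ii[OF int_n] by (simp add: pn(3) left_diff_distrib)
  define m where "m = (LINT u|lborel. p u)"
  have "complex_of_real m = of_real (LINT u|lborel. n u)"
    using eq[of 0] by (simp add: m_def)
  then have m: "(LINT u|lborel. n u) = m"
    by (simp only: of_real_eq_iff)
  show ?thesis
  proof (cases "m = 0")
    case True
    have "AE u in lborel. p u = 0" "AE u in lborel. n u = 0"
      using True m integral_nonneg_eq_0_iff_AE[OF int_p] integral_nonneg_eq_0_iff_AE[OF int_n] pn by (auto simp: m_def)
    then show ?thesis
      by eventually_elim (simp add: pn)
  next
    case False
    moreover have "0 \<le> m"
      unfolding m_def using pn by (intro integral_nonneg_AE) auto
    ultimately have "0 < m"
      by simp
    define D where "D q = density lborel (\<lambda>u. ennreal (q u / m))" for q :: "real \<Rightarrow> real"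
    have prob: "prob_space (D q)"
      if "integrable lborel q" "q \<in> borel_measurable borel" "\<And>u. 0 \<le> q u" "(LINT u|lborel. q u) = m" for q
    proof (rule prob_spaceI)
      have "emeasure (D q) (space (D q)) = (\<integral>\<^sup>+u. ennreal (q u / m) \<partial>lborel)"
        unfolding D_def using that(2) by (subst emeasure_density) auto
      also have "\<dots> = ennreal (LINT u|lborel. q u / m)"
        using that \<open>0 < m\<close> by (intro nn_integral_eq_integral) auto
      finally show "emeasure (D q) (space (D q)) = 1"
        using that(4) \<open>0 < m\<close> by simp
    qed
    have char_eq: "char (distr (D q) borel ln) t = (LINT u|lborel. of_real (q u) * iexp (t * ln u)) / of_real m"
      if [measurable]: "q \<in> borel_measurable borel" and "\<And>u. 0 \<le> q u" for q t
    proof -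
      have "char (distr (D q) borel ln) t = (LINT u|D q. iexp (t * ln u))"
        unfolding char_def D_def by (rule integral_distr) measurable
      also have "\<dots> = (LINT u|lborel. (q u / m) *\<^sub>R iexp (t * ln u))"
        unfolding D_def by (rule integral_density) (use that(2) \<open>0 < m\<close> in auto)
      also have "\<dots> = (LINT u|lborel. of_real (q u) * iexp (t * ln u) / of_real m)"
        by (intro Bochner_Integration.integral_cong refl) (simp add: scaleR_conv_of_real)
      finally show ?thesis
        by simp
    qed
    have rd: "real_distribution (distr (D q) borel ln)"
      if "integrable lborel q" "q \<in> borel_measurable borel" "\<And>u. 0 \<le> q u" "(LINT u|lborel. q u) = m" for q
    proof -
      interpret prob_space "D q"
        by (rule prob) (use that in auto)
      show ?thesis
        by (rule real_distribution_distr) (simp add: D_def)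
    qed
    have "distr (D p) borel ln = distr (D n) borel ln"
    proof (rule Levy_uniqueness)
      show "real_distribution (distr (D p) borel ln)" "real_distribution (distr (D n) borel ln)"
        using int_p int_n pn m by (auto intro!: rd simp: m_def)
      show "char (distr (D p) borel ln) = char (distr (D n) borel ln)"
      proof
      fix t
      have "char (distr (D p) borel ln) t = (LINT u|lborel. of_real (p u) * iexp (t * ln u)) / of_real m"
        by (rule char_eq) (simp_all add: pn)
      also have "\<dots> = char (distr (D n) borel ln) t"
        unfolding eq by (rule char_eq[symmetric]) (simp_all add: pn)
      finally show "char (distr (D p) borel ln) t = char (distr (D n) borel ln) t" .
    qed
    qed
    then have dd: "distr (distr (D p) borel ln) borel exp = distr (distr (D n) borel ln) borel exp"
      by simp
    \<comment> \<open>Both densities vanish for \<open>u \<le> 0\<close>, so \<open>exp\<close> undoes the push-forward by \<open>ln\<close>.\<close>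
    have pull_back: "distr (distr (D q) borel ln) borel exp = D q"
      if [measurable]: "q \<in> borel_measurable borel" and q0: "\<And>u. u \<le> 0 \<Longrightarrow> q u = 0" for q
    proof (rule measure_eqI)
      fix A :: "real set" assume "A \<in> sets (distr (distr (D q) borel ln) borel exp)"
      then have [measurable]: "A \<in> sets borel"
        by simp
      have "emeasure (distr (distr (D q) borel ln) borel exp) A = emeasure (D q) {u. exp (ln u) \<in> A}"
        by (subst emeasure_distr; (subst emeasure_distr)?) (auto simp: D_def vimage_def)
      also have "\<dots> = (\<integral>\<^sup>+u. ennreal (q u / m) * indicator {u. exp (ln u) \<in> A} u \<partial>lborel)"
        unfolding D_def by (rule emeasure_density) measurable
      also have "\<dots> = (\<integral>\<^sup>+u. ennreal (q u / m) * indicator A u \<partial>lborel)"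
      proof (rule nn_integral_cong)
        fix u
        show "ennreal (q u / m) * indicator {u. exp (ln u) \<in> A} u = ennreal (q u / m) * indicator A u"
          by (cases "u \<le> 0") (simp_all add: q0 indicator_def)
      qed
      also have "\<dots> = emeasure (D q) A"
        unfolding D_def by (rule emeasure_density[symmetric]) measurable
      finally show "emeasure (distr (distr (D q) borel ln) borel exp) A = emeasure (D q) A" .
    qed (simp add: D_def)
    have "D p = D n"
      using dd by (simp add: pull_back pn0)
    then have "AE u in lborel. ennreal (p u / m) = ennreal (n u / m)"
      unfolding D_def by (intro sigma_finite_measure.density_unique[OF sigma_finite_lborel]) auto
    then show ?thesis
      by eventually_elim (use \<open>0 < m\<close> pn in \<open>simp add: ennreal_inj\<close>)
  qed
qed

lemma Cesaro_mean_unit_circle: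
  fixes q :: complex
  assumes "cmod q = 1" "q \<noteq> 1"
  shows "(\<lambda>N. (\<Sum>n<N. q ^ n) / of_nat N) \<longlonglongrightarrow> 0"
proof (rule Lim_null_comparison)
  show "eventually (\<lambda>N. norm ((\<Sum>n<N. q ^ n) / of_nat N) \<le> 2 / cmod (1 - q) * (1 / real N)) sequentially"
  proof (rule always_eventually, rule allI)
    fix N
    have "(\<Sum>n<N. q ^ n) = (1 - q ^ N) / (1 - q)"
      using assms(2) by (simp add: sum_gp_strict)
    moreover have "cmod (1 - q ^ N) \<le> 2"
      using norm_triangle_ineq4[of 1 "q ^ N"] assms(1) by (simp add: norm_power)
    ultimately show "norm ((\<Sum>n<N. q ^ n) / of_nat N) \<le> 2 / cmod (1 - q) * (1 / real N)"
      by (simp add: norm_divide norm_mult divide_right_mono)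
  qed
  show "(\<lambda>N. 2 / cmod (1 - q) * (1 / real N)) \<longlonglongrightarrow> 0"
    by (rule tendsto_mult_right_zero) (rule lim_1_over_n)
qed

text \<open>
  Average over the frequencies \<open>t = 0, \<dots>, N - 1\<close>.  The averages of \<open>exp (\<i> t ln u)\<close> are bounded by 1 and
  tend to 0 unless \<open>ln u\<close> is a multiple of \<open>2 pi\<close>, which happens on a null set only; so by dominated
  convergence the average of the transform, which is \<open>c\<close> for all \<open>N > 0\<close>, tends to 0.
\<close>

lemma constant_transform_zero:
  fixes g :: "real \<Rightarrow> complex"
  assumes int: "integrable lborel g" and [measurable]: "g \<in> borel_measurable borel"
    and g0: "\<And>u. u \<le> 0 \<Longrightarrow> g u = 0"
    and const: "\<And>t. (LINT u|lborel. g u * iexp (t * ln u)) = c"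
  shows "c = 0"
proof -
  have ii: "integrable lborel (\<lambda>u. g u * iexp (t * ln u))" for t
    by (rule Bochner_Integration.integrable_bound[OF int]) (auto simp: norm_mult)
  define S where "S N u = (\<Sum>n<N. iexp (ln u) ^ n) / of_nat N" for N and u :: real
  have pow: "iexp (ln u) ^ n = iexp (real n * ln u)" for n u
    by (simp add: exp_of_nat_mult[symmetric] mult_ac)
  have avg: "(LINT u|lborel. g u * S N u) = c" if "0 < N" for N
  proof -
    have "(LINT u|lborel. g u * S N u) = (LINT u|lborel. (\<Sum>n<N. g u * iexp (real n * ln u)) / of_nat N)"
      by (simp add: S_def pow sum_distrib_left)
    also have "\<dots> = (\<Sum>n<N. LINT u|lborel. g u * iexp (real n * ln u)) / of_nat N"
      by (subst integral_divide_zero, subst Bochner_Integration.integral_sum) (rule ii, simp)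
    also have "\<dots> = c"
      using that by (simp only: const) simp
    finally show ?thesis .
  qed
  have "(\<lambda>N. LINT u|lborel. g u * S N u) \<longlonglongrightarrow> (LINT u::real|lborel. 0)"
  proof (rule integral_dominated_convergence[where w = "\<lambda>u. cmod (g u)"])
    show "AE u in lborel. (\<lambda>N. g u * S N u) \<longlonglongrightarrow> 0"
    proof (rule AE_I')
      have "countable (range (\<lambda>k::int. exp (2 * pi * of_int k)))"
        by simp
      then show "range (\<lambda>k::int. exp (2 * pi * of_int k)) \<in> null_sets lborel"
        by (rule countable_imp_null_set_lborel)
      show "{u \<in> space lborel. \<not> (\<lambda>N. g u * S N u) \<longlonglongrightarrow> 0} \<subseteq> range (\<lambda>k::int. exp (2 * pi * of_int k))"
      proof
        fix u assume "u \<in> {u \<in> space lborel. \<not> (\<lambda>N. g u * S N u) \<longlonglongrightarrow> 0}"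
        then have n: "\<not> (\<lambda>N. g u * S N u) \<longlonglongrightarrow> 0"
          by simp
        have u: "0 < u"
          using n g0[of u] by (cases "u \<le> 0") auto
        have "iexp (ln u) = 1"
        proof (rule ccontr)
          assume "iexp (ln u) \<noteq> 1"
          then have "(\<lambda>N. S N u) \<longlonglongrightarrow> 0"
            unfolding S_def by (intro Cesaro_mean_unit_circle) auto
          then show False
            using n tendsto_mult_right_zero by blast
        qed
        then obtain k :: int where "ln u = 2 * pi * of_int k"
          by (auto simp: exp_eq_1 mult_ac)
        then have "u = exp (2 * pi * of_int k)"
          using u by (metis exp_ln)
        then show "u \<in> range (\<lambda>k::int. exp (2 * pi * of_int k))"
          by blast
      qed
    qed
    show "AE u in lborel. norm (g u * S N u) \<le> cmod (g u)" for N
    proof (rule AE_I2)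
      fix u
      have "norm (\<Sum>n<N. iexp (ln u) ^ n) \<le> (\<Sum>n<N. norm (iexp (ln u) ^ n))"
        by (rule norm_sum)
      also have "\<dots> = real N"
        by (simp add: norm_power)
      finally have "norm (S N u) \<le> 1"
        by (cases "N = 0") (simp_all add: S_def norm_divide)
      then show "norm (g u * S N u) \<le> cmod (g u)"
        by (simp add: norm_mult mult_left_le)
    qed
    show "(\<lambda>u. g u * S N u) \<in> borel_measurable lborel" for N
      unfolding S_def by measurable
  qed (use int in auto)
  moreover have "eventually (\<lambda>N. (LINT u|lborel. g u * S N u) = c) sequentially"
    using eventually_gt_at_top[of 0] by eventually_elim (rule avg)
  ultimately have "(\<lambda>N::nat. c) \<longlonglongrightarrow> 0"
    using Lim_transform_eventually by fastforce
  then show "c = 0"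
    by (simp add: LIMSEQ_const_iff)
qed

text \<open>
  The transform of the complex conjugate vanishes as well, so the real and the imaginary part can be
  treated separately.
\<close>

lemma zero_transform_zero:
  fixes g :: "real \<Rightarrow> complex"
  assumes int: "integrable lborel g" and [measurable]: "g \<in> borel_measurable borel"
    and g0: "\<And>u. u \<le> 0 \<Longrightarrow> g u = 0"
    and zero: "\<And>t. (LINT u|lborel. g u * iexp (t * ln u)) = 0"
  shows "AE u in lborel. g u = 0"
proof -
  have ii: "integrable lborel (\<lambda>u. g u * iexp (t * ln u))" for t
    by (rule Bochner_Integration.integrable_bound[OF int]) (auto simp: norm_mult)
  have "cnj \<in> borel_measurable borel"
    by (intro borel_measurable_continuous_onI continuous_intros)
  from measurable_compose[OF assms(2) this] have [measurable]: "(\<lambda>u. cnj (g u)) \<in> borel_measurable borel" .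
  have ii': "integrable lborel (\<lambda>u. cnj (g u) * iexp (t * ln u))" for t
    by (rule Bochner_Integration.integrable_bound[OF int]) (auto simp: norm_mult)
  have cnj: "(LINT u|lborel. cnj (g u) * iexp (t * ln u)) = 0" for t
  proof -
    have "cnj (g u) * iexp (t * ln u) = cnj (g u * iexp (- t * ln u))" for u
      by (simp add: exp_cnj)
    then have "(LINT u|lborel. cnj (g u) * iexp (t * ln u)) = cnj (LINT u|lborel. g u * iexp (- t * ln u))"
      using integral_bounded_linear[OF bounded_linear_cnj ii[of "- t"]] by (simp only:)
    then show ?thesis
      by (simp only: zero complex_cnj_zero)
  qed
  have Re: "AE u in lborel. Re (g u) = 0"
  proof (rule Levy_uniqueness_density)
    show "(LINT u|lborel. of_real (Re (g u)) * iexp (t * ln u)) = 0" for t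
    proof -
      have "of_real (Re (g u)) * iexp (t * ln u) = (g u * iexp (t * ln u) + cnj (g u) * iexp (t * ln u)) / 2" for u
        by (simp add: complex_add_cnj flip: distrib_right)
      then show ?thesis
        using ii ii' by (simp only: integral_divide_zero Bochner_Integration.integral_add zero cnj) simp
    qed
  qed (use int g0 in auto)
  have Im: "AE u in lborel. Im (g u) = 0"
  proof (rule Levy_uniqueness_density)
    show "(LINT u|lborel. of_real (Im (g u)) * iexp (t * ln u)) = 0" for t
    proof -
      have "of_real (Im (g u)) * iexp (t * ln u) = (g u * iexp (t * ln u) - cnj (g u) * iexp (t * ln u)) / (2 * \<i>)" for u
        unfolding left_diff_distrib[symmetric] complex_diff_cnj by (simp add: field_simps)
      then show ?thesis
        using ii ii' by (simp only: integral_divide_zero Bochner_Integration.integral_diff zero cnj) simp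
    qed
  qed (use int g0 in auto)
  show ?thesis
    using Re Im by eventually_elim (simp add: complex_eq_iff)
qed

text \<open>
  On the line \<open>Re s = 1 / 2\<close> the Mellin transform is the Fourier transform of
  \<open>u\<^sup>-\<^sup>1\<^sup>/\<^sup>2 K(u)\<close> in the variable \<open>ln u\<close>.
\<close>

theorem mellin_uniqueness:
  assumes K: "mellin_kernel K" and const: "\<And>s. Re s = 1 / 2 \<Longrightarrow> mellin K s = c"
  shows "c = 0" "AE u in lebesgue. K u = 0"
proof -
  from mellin_kernel_representative[OF K] obtain L where [measurable]: "L \<in> borel_measurable borel"
    and L0: "\<And>u. u \<le> 0 \<Longrightarrow> L u = 0" and KL: "AE u in lborel. K u = L u"
    and fin: "(\<integral>\<^sup>+u. ennreal (cmod (L u) * u powr (- 1 / 2)) \<partial>lborel) = ennreal (kernel_norm K)"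
    by blast
  define g where "g u = L u * of_real (u powr (- 1 / 2))" for u
  have [measurable]: "g \<in> borel_measurable borel"
    unfolding g_def by measurable
  have g0: "g u = 0" if "u \<le> 0" for u
    using L0[OF that] by (simp add: g_def)
  have int: "integrable lborel g"
    unfolding integrable_iff_bounded using fin by (simp add: g_def norm_mult)
  have "(LINT u|lborel. g u * iexp (t * ln u)) = c" for t
  proof -
    let ?s = "1 / 2 + \<i> * of_real t"
    have [measurable]: "K \<in> borel_measurable lebesgue" "{0<..} \<in> sets (lebesgue :: real measure)"
      using K by (simp_all add: mellin_kernel_def)
    have gm: "(\<lambda>u. g u * iexp (t * ln u)) \<in> borel_measurable lborel"
      by measurable
    have eq: "AE u in lebesgue. g u * iexp (t * ln u) = indicator {0<..} u *\<^sub>R (K u * complex_of_real u powr (?s - 1))"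
      unfolding AE_completion_iff using KL
    proof eventually_elim
      case (elim u)
      show ?case
      proof (cases "0 < u")
        case True
        have "complex_of_real (u powr (- 1 / 2)) * iexp (t * ln u) = exp ((?s - 1) * of_real (ln u))"
          using True by (simp add: powr_def algebra_simps flip: exp_of_real exp_add)
        then show ?thesis
          using True elim by (simp add: g_def powr_def Ln_of_real mult.assoc)
      qed (simp add: g0)
    qed
    have "mellin K ?s = (LINT u|lebesgue. g u * iexp (t * ln u))"
      unfolding mellin_def set_lebesgue_integral_def
      by (rule integral_cong_AE[symmetric, OF measurable_completion[OF gm] borel_measurable_AE[OF measurable_completion[OF gm] eq] eq])
    also have "\<dots> = (LINT u|lborel. g u * iexp (t * ln u))"
      by (rule integral_completion[OF gm])
    finally show ?thesis
      using const[of ?s] by simp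
  qed
  note trans = this
  show "c = 0"
    by (rule constant_transform_zero[OF int _ g0 trans]) auto
  with trans have "AE u in lborel. g u = 0"
    by (intro zero_transform_zero[OF int _ g0]) auto
  then have "AE u in lborel. K u = 0"
    using KL
  proof eventually_elim
    case (elim u)
    then show ?case
      using L0[of u] by (cases "u \<le> 0") (auto simp: g_def)
  qed
  then show "AE u in lebesgue. K u = 0"
    by (simp add: AE_completion_iff)
qed

section \<open>The functional calculus of the Cesaro operator\<close>

lemma mellin_integrand:
  assumes K: "mellin_kernel K" and s: "Re s = 1 / 2"
  shows "integrable lebesgue (\<lambda>u. indicator {0<..} u *\<^sub>R (K u * exp ((s - 1) * of_real (ln u))))"
    and "cmod (mellin K s) \<le> kernel_norm K"
proof -
  have [measurable]: "K \<in> borel_measurable lebesgue" "{0<..} \<in> sets (lebesgue :: real measure)"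
    "(\<lambda>u. exp ((s - 1) * complex_of_real (ln u))) \<in> borel_measurable lebesgue"
    using K by (simp_all add: mellin_kernel_def measurable_completion)
  have intK: "integrable lebesgue (\<lambda>u. cmod (K u) * u powr (- 1 / 2))"
    using K by (simp add: mellin_kernel_def)
  have le: "cmod (indicator {0<..} u *\<^sub>R (K u * exp ((s - 1) * of_real (ln u)))) \<le> cmod (K u) * u powr (- 1 / 2)" for u
  proof (cases "0 < u")
    case True
    moreover have "Re (s - 1) = - 1 / 2"
      using s by simp
    ultimately show ?thesis
      unfolding norm_scaleR norm_mult norm_exp_of_real_ln[OF True] by simp
  qed simp
  show int: "integrable lebesgue (\<lambda>u. indicator {0<..} u *\<^sub>R (K u * exp ((s - 1) * of_real (ln u))))"
    by (rule Bochner_Integration.integrable_bound[OF intK]) (use le in \<open>auto intro: order_trans[OF _ abs_ge_self]\<close>)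
  have "cmod (mellin K s) \<le> (LINT u|lebesgue. cmod (indicator {0<..} u *\<^sub>R (K u * exp ((s - 1) * of_real (ln u)))))"
    unfolding mellin_eq by (rule integral_norm_bound)
  also have "\<dots> \<le> kernel_norm K"
    unfolding kernel_norm_def using int intK le by (intro integral_mono integrable_norm) auto
  finally show "cmod (mellin K s) \<le> kernel_norm K" .
qed

lemma mellin_add:
  assumes "mellin_kernel K" "mellin_kernel L" "Re s = 1 / 2"
  shows "mellin (\<lambda>u. K u + L u) s = mellin K s + mellin L s"
  unfolding mellin_eq
  using Bochner_Integration.integral_add[OF mellin_integrand(1)[OF assms(1,3)] mellin_integrand(1)[OF assms(2,3)]]
  by (simp add: distrib_right scaleR_add_right)

lemma mellin_scale: "mellin (\<lambda>u. c * K u) s = c * mellin K s"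
proof -
  have "indicator {0<..} u *\<^sub>R (c * K u * exp ((s - 1) * of_real (ln u)))
      = c * (indicator {0<..} u *\<^sub>R (K u * exp ((s - 1) * of_real (ln u))))" for u
    by simp
  then show ?thesis
    unfolding mellin_eq by (simp only: integral_mult_right_zero)
qed

lemma kernel_functional_mellin:
  assumes "Re s = 1 / 2"
  shows "kernel_functional (\<lambda>K. mellin K s)"
  unfolding kernel_functional_def
proof (intro conjI allI impI)
  show "mellin (\<lambda>u. K u + L u) s = mellin K s + mellin L s" if "borel_kernel K" "borel_kernel L" for K L
    using that assms by (intro mellin_add borel_kernel_mellin_kernel)
  show "mellin (\<lambda>u. of_real r * K u) s = r *\<^sub>R mellin K s" for r K
    by (simp add: mellin_scale scaleR_conv_of_real)
  show "\<exists>C\<ge>0. \<forall>K. borel_kernel K \<longrightarrow> norm (mellin K s) \<le> C * kernel_norm K"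
    using mellin_integrand(2)[OF borel_kernel_mellin_kernel assms] by (intro exI[of _ 1]) auto
qed

lemma scalar_op_of_real: "scalar_op (of_real r) o\<^sub>L T = r *\<^sub>R T"
  by (rule blinfun_eqI) (simp add: scalar_op_apply scaleC_of_real blinfun.scaleR_left)

lemma kernel_functional_hausdorff_op_plus: "kernel_functional hausdorff_op_plus"
  unfolding kernel_functional_def
proof (intro conjI allI impI)
  show "hausdorff_op_plus (\<lambda>u. K u + L u) = hausdorff_op_plus K + hausdorff_op_plus L"
    if "borel_kernel K" "borel_kernel L" for K L
    using that by (intro hausdorff_op_plus_add borel_kernel_mellin_kernel)
  show "hausdorff_op_plus (\<lambda>u. of_real r * K u) = r *\<^sub>R hausdorff_op_plus K" if "borel_kernel K" for r K
    using that by (simp add: hausdorff_op_plus_scale[OF borel_kernel_mellin_kernel] scalar_op_of_real)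
  show "\<exists>C\<ge>0. \<forall>K. borel_kernel K \<longrightarrow> norm (hausdorff_op_plus K) \<le> C * kernel_norm K"
    using hausdorff_op_plus(2)[OF borel_kernel_mellin_kernel] by (intro exI[of _ 1]) auto
qed

lemma scalar_op_add: "scalar_op (a + b) = (scalar_op a + scalar_op b :: 'a::complex_normed_vector \<Rightarrow>\<^sub>L 'a)"
  by (rule blinfun_eqI) (simp add: scalar_op_apply scaleC_add_left blinfun.add_left)

lemma bounded_linear_scalar_op: "bounded_linear (scalar_op :: complex \<Rightarrow> ('a::complex_normed_vector \<Rightarrow>\<^sub>L 'a))"
proof (rule bounded_linear_intro)
  show "scalar_op (r *\<^sub>R a) = (r *\<^sub>R scalar_op a :: 'a \<Rightarrow>\<^sub>L 'a)" for r a
    by (rule blinfun_eqI)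
      (simp add: scalar_op_apply blinfun.scaleR_left scaleR_conv_of_real flip: scaleC_scaleC scaleC_of_real)
  show "norm (scalar_op a :: 'a \<Rightarrow>\<^sub>L 'a) \<le> norm a * 1" for a
    by (rule norm_blinfun_bound) (simp_all add: scalar_op_apply norm_scaleC)
qed (rule scalar_op_add)

lemma inverse_on_circle:
  assumes "Re s = 1 / 2"
  shows "inverse s \<in> sphere 1 1"
proof -
  have "s \<noteq> 0"
    using assms by auto
  have "cmod (1 - s) = cmod s"
    using assms by (simp add: cmod_def)
  moreover have "inverse s - 1 = (1 - s) / s"
    using \<open>s \<noteq> 0\<close> by (simp add: field_simps)
  ultimately have "cmod (inverse s - 1) = 1"
    using \<open>s \<noteq> 0\<close> by (simp add: norm_divide)
  then show ?thesis
    by (simp add: dist_norm norm_minus_commute)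
qed

text \<open>
  Of the two summands of the resolvent, \<open>1 / z\<close> and the Hausdorff operator of the resolvent kernel, the
  first integrates to a scalar, and in the second the integral passes to the kernel.  The Mellin
  transform of that kernel then is the integral of the Mellin transforms.
\<close>

lemma resolvent_integral_cesaro_plus:
  assumes U: "open U" and F: "F holomorphic_on U" and \<gamma>: "valid_path \<gamma>" "path_image \<gamma> \<subseteq> U - sphere 1 1"
  defines "K \<equiv> \<lambda>u. contour_integral \<gamma> (\<lambda>z. F z * resolvent_kernel z u)"
  shows "borel_kernel K"
    and "resolvent_integral F cesaro_plus \<gamma> = scalar_op (contour_integral \<gamma> (\<lambda>z. F z / z)) + hausdorff_op_plus K"
    and "Re s = 1 / 2 \<Longrightarrow> mellin K s
      = contour_integral \<gamma> (\<lambda>z. F z / (z - inverse s)) - contour_integral \<gamma> (\<lambda>z. F z / z)"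
proof -
  let ?v = "\<lambda>t. vector_derivative \<gamma> (at t within {0..1})"
  have off: "cmod (z - 1) \<noteq> 1" if "z \<in> path_image \<gamma>" for z
    using \<gamma>(2) that by (auto simp: dist_norm norm_minus_commute)
  have on: "\<gamma> t \<in> path_image \<gamma>" if "t \<in> {0..1}" for t
    using that by (auto simp: path_image_def)
  have local: "\<exists>r>0. \<exists>D. holomorphic_kernel_on (ball z r) D (\<lambda>z u. F z * resolvent_kernel z u)"
    if "z \<in> path_image \<gamma>" for z
    using that off \<gamma>(2) by (intro weighted_resolvent_kernel_locally_holomorphic[OF U F]) auto
  show K: "borel_kernel K"
    unfolding K_def by (rule kernel_functional_contour_integral(1)[OF \<gamma>(1) kernel_functional_hausdorff_op_plus local])
  have O: "open (U - sphere 1 1)"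
    using U by (intro open_Diff) auto
  have pole: "(\<lambda>z. F z / (z - w)) contour_integrable_on \<gamma>" if "w \<in> sphere 1 1" for w
    using F that by (intro contour_integrable_holomorphic_simple[OF _ O \<gamma>])
      (auto intro!: holomorphic_intros intro: holomorphic_on_subset)
  have zero: "(0::complex) \<in> sphere 1 1"
    by simp
  have "((\<lambda>t. F (\<gamma> t) / \<gamma> t * ?v t) has_integral contour_integral \<gamma> (\<lambda>z. F z / z)) {0..1}"
    using has_contour_integral_integral[OF pole[OF zero]] by (simp add: has_contour_integral_def)
  from has_integral_linear[OF this bounded_linear_scalar_op]
  have 1: "((\<lambda>t. scalar_op (F (\<gamma> t) / \<gamma> t * ?v t)) has_integral
      (scalar_op (contour_integral \<gamma> (\<lambda>z. F z / z)) :: l2_plus \<Rightarrow>\<^sub>L l2_plus)) {0..1}"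
    by (simp add: o_def)
  have "((\<lambda>t. hausdorff_op_plus (\<lambda>u. ?v t * (F (\<gamma> t) * resolvent_kernel (\<gamma> t) u))) has_integral hausdorff_op_plus K) {0..1}"
    unfolding K_def by (rule kernel_functional_contour_integral(2)[OF \<gamma>(1) kernel_functional_hausdorff_op_plus local])
  from has_integral_add[OF 1 this]
  have "((\<lambda>t. scalar_op (F (\<gamma> t) * ?v t) o\<^sub>L resolvent cesaro_plus (\<gamma> t)) has_integral
      (scalar_op (contour_integral \<gamma> (\<lambda>z. F z / z)) + hausdorff_op_plus K)) {0..1}"
  proof (rule has_integral_eq[rotated])
    fix t :: real assume t: "t \<in> {0..1}"
    note off = off[OF on[OF t]]
    have "scalar_op (F (\<gamma> t) * ?v t) o\<^sub>L resolvent cesaro_plus (\<gamma> t)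
        = (scalar_op (F (\<gamma> t) * ?v t) o\<^sub>L scalar_op (inverse (\<gamma> t)))
          + (scalar_op (F (\<gamma> t) * ?v t) o\<^sub>L hausdorff_op_plus (resolvent_kernel (\<gamma> t)))"
      unfolding resolvent_cesaro_plus[OF off]
      by (rule blinfun_eqI) (simp add: blinfun.add_left blinfun.add_right)
    also have "\<dots> = scalar_op (F (\<gamma> t) / \<gamma> t * ?v t)
        + hausdorff_op_plus (\<lambda>u. ?v t * (F (\<gamma> t) * resolvent_kernel (\<gamma> t) u))"
      using hausdorff_op_plus_scale[OF borel_kernel_mellin_kernel[OF borel_kernel_resolvent_kernel[OF off]], of "F (\<gamma> t) * ?v t"]
      by (simp add: scalar_op_compose mult_ac divide_inverse)
    finally show "scalar_op (F (\<gamma> t) / \<gamma> t * ?v t) + hausdorff_op_plus (\<lambda>u. ?v t * (F (\<gamma> t) * resolvent_kernel (\<gamma> t) u))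
        = scalar_op (F (\<gamma> t) * ?v t) o\<^sub>L resolvent cesaro_plus (\<gamma> t)"
      by simp
  qed
  then show "resolvent_integral F cesaro_plus \<gamma> = scalar_op (contour_integral \<gamma> (\<lambda>z. F z / z)) + hausdorff_op_plus K"
    unfolding resolvent_integral_def by (rule integral_unique)
  assume s: "Re s = 1 / 2"
  have s_circle: "inverse s \<in> sphere 1 1"
    using inverse_on_circle[OF s] by simp
  have "((\<lambda>t. mellin (\<lambda>u. ?v t * (F (\<gamma> t) * resolvent_kernel (\<gamma> t) u)) s) has_integral mellin K s) {0..1}"
    unfolding K_def by (rule kernel_functional_contour_integral(2)[OF \<gamma>(1) kernel_functional_mellin[OF s] local])
  then have "((\<lambda>t. (F (\<gamma> t) / (\<gamma> t - inverse s) - F (\<gamma> t) / \<gamma> t) * ?v t) has_integral mellin K s) {0..1}"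
  proof (rule has_integral_eq[rotated])
    fix t :: real assume t: "t \<in> {0..1}"
    show "mellin (\<lambda>u. ?v t * (F (\<gamma> t) * resolvent_kernel (\<gamma> t) u)) s = (F (\<gamma> t) / (\<gamma> t - inverse s) - F (\<gamma> t) / \<gamma> t) * ?v t"
      unfolding mellin_scale mellin_resolvent_kernel[OF off[OF on[OF t]] s]
      by (simp add: algebra_simps divide_inverse)
  qed
  then have "mellin K s = contour_integral \<gamma> (\<lambda>z. F z / (z - inverse s) - F z / z)"
    by (intro contour_integral_unique[symmetric]) (simp add: has_contour_integral_def)
  also have "\<dots> = contour_integral \<gamma> (\<lambda>z. F z / (z - inverse s)) - contour_integral \<gamma> (\<lambda>z. F z / z)"
    using pole[OF s_circle] pole[OF zero] by (intro contour_integral_diff) auto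
  finally show "mellin K s = contour_integral \<gamma> (\<lambda>z. F z / (z - inverse s)) - contour_integral \<gamma> (\<lambda>z. F z / z)" .
qed

text \<open>
  Two circles around 1 that are close to the given one, the inner one reversed.
\<close>

lemma encircling_cycle_exists:
  assumes U: "open U" "sphere 1 1 \<subseteq> U"
  shows "\<exists>\<Gamma>. encircling_cycle U (sphere 1 1) \<Gamma>"
proof -
  obtain e where e: "e > 0" "(\<Union>x\<in>sphere 1 1. cball x e) \<subseteq> U"
    using compact_subset_open_imp_cball_epsilon_subset[OF compact_sphere U(1,2)] by metis
  define d where "d = min e (1 / 2)"
  have d: "0 < d" "d \<le> e" "d < 1"
    using e(1) by (auto simp: d_def)
  have ann: "z \<in> U" if z: "\<bar>cmod (z - 1) - 1\<bar> \<le> d" for z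
  proof -
    have "0 < cmod (z - 1)"
      using z d by auto
    define y where "y = 1 + (z - 1) / of_real (cmod (z - 1))"
    have "y \<in> sphere 1 1"
      using \<open>0 < cmod (z - 1)\<close> by (simp add: y_def dist_norm norm_divide)
    moreover have "z - y = (z - 1) / of_real (cmod (z - 1)) * of_real (cmod (z - 1) - 1)"
      using \<open>0 < cmod (z - 1)\<close> by (simp add: y_def field_simps)
    then have "cmod (z - y) = \<bar>cmod (z - 1) - 1\<bar>"
      using \<open>0 < cmod (z - 1)\<close> by (simp only: norm_mult norm_divide norm_of_real) simp
    then have "z \<in> cball y e"
      using z d(2) by (simp add: dist_norm norm_minus_commute)
    ultimately show ?thesis
      using e(2) by blast
  qed
  define \<Gamma> where "\<Gamma> = [circlepath 1 (1 + d), reversepath (circlepath 1 (1 - d))]"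
  have im: "path_image (circlepath 1 r) = sphere (1::complex) r" if "0 < r" for r :: real
    using that by simp
  have wn_in: "winding_number (circlepath 1 r) w = 1" if "cmod (w - 1) < r" for r w
    using that by (rule winding_number_circlepath)
  have wn_out: "winding_number (circlepath 1 r) w = 0" if "r < cmod (w - 1)" "0 < r" for r w
  proof (rule winding_number_zero_outside)
    show "path_image (circlepath 1 r) \<subseteq> cball 1 r" "w \<notin> cball 1 r"
      using that by (auto simp: dist_norm norm_minus_commute)
  qed auto
  have wn_rev: "winding_number (reversepath (circlepath 1 r)) w = - winding_number (circlepath 1 r) w"
    if "cmod (w - 1) \<noteq> r" "0 < r" for r w
    using that by (intro winding_number_reversepath) (auto simp: dist_norm norm_minus_commute)
  have "encircling_cycle U (sphere 1 1) \<Gamma>"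
    unfolding encircling_cycle_def
  proof (intro conjI ballI allI impI)
    fix \<gamma> assume \<gamma>: "\<gamma> \<in> set \<Gamma>"
    show "valid_path \<gamma>" "pathfinish \<gamma> = pathstart \<gamma>"
      using \<gamma> by (auto simp: \<Gamma>_def)
    have "path_image \<gamma> = sphere 1 (1 + d) \<or> path_image \<gamma> = sphere 1 (1 - d)"
      using \<gamma> d by (auto simp: \<Gamma>_def)
    then show "path_image \<gamma> \<subseteq> U - sphere 1 1"
      using d by (auto intro!: ann simp: dist_norm norm_minus_commute)
  next
    fix w :: complex assume "w \<in> sphere 1 1"
    then have "cmod (w - 1) = 1"
      by (simp add: dist_norm norm_minus_commute)
    then show "(\<Sum>\<gamma>\<leftarrow>\<Gamma>. winding_number \<gamma> w) = 1"
      using d by (simp add: \<Gamma>_def wn_rev wn_in wn_out)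
  next
    fix w assume "w \<notin> U"
    then have "\<not> \<bar>cmod (w - 1) - 1\<bar> \<le> d"
      using ann by blast
    then consider "cmod (w - 1) < 1 - d" | "1 + d < cmod (w - 1)"
      by linarith
    then show "(\<Sum>\<gamma>\<leftarrow>\<Gamma>. winding_number \<gamma> w) = 0"
      using d by cases (simp_all add: \<Gamma>_def wn_rev wn_in wn_out)
  qed
  then show ?thesis
    by blast
qed

text \<open>
  Both \<open>0\<close> and \<open>1 / s\<close> for \<open>Re s = 1 / 2\<close> lie on the circle, so Cauchy's formula evaluates the
  integrals of \<open>F z / z\<close> and \<open>F z / (z - 1 / s)\<close>, whichever cycle the definition selects.
\<close>

lemma holomorphic_calculus_cesaro_plus:
  assumes U: "open U" "sphere 1 1 \<subseteq> U" and F: "F holomorphic_on U"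
  obtains K where "borel_kernel K"
    "holomorphic_calculus U F cesaro_plus = scalar_op (F 0) + hausdorff_op_plus K"
    "\<And>s. Re s = 1 / 2 \<Longrightarrow> mellin K s = F (inverse s) - F 0"
proof -
  define \<Gamma> where "\<Gamma> = (SOME \<Gamma>. encircling_cycle U (spectrum cesaro_plus) \<Gamma>)"
  have cycle: "encircling_cycle U (sphere 1 1) \<Gamma>"
    unfolding \<Gamma>_def spectrum_cesaro_plus by (rule someI_ex[OF encircling_cycle_exists[OF U]])
  have \<Gamma>: "valid_path \<gamma>" "pathfinish \<gamma> = pathstart \<gamma>" "path_image \<gamma> \<subseteq> U - sphere 1 1" if "\<gamma> \<in> set \<Gamma>" for \<gamma>
    using that cycle by (auto simp: encircling_cycle_def)
  have one: "\<And>w. w \<in> sphere 1 1 \<Longrightarrow> (\<Sum>\<gamma>\<leftarrow>\<Gamma>. winding_number \<gamma> w) = 1"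
    and zero: "\<And>w. w \<notin> U \<Longrightarrow> (\<Sum>\<gamma>\<leftarrow>\<Gamma>. winding_number \<gamma> w) = 0"
    using cycle by (auto simp: encircling_cycle_def)
  define c where "c = 1 / (2 * of_real pi * \<i>)"
  define k where "k \<gamma> u = contour_integral \<gamma> (\<lambda>z. F z * resolvent_kernel z u)" for \<gamma> u
  have cauchy: "c * (\<Sum>\<gamma>\<leftarrow>\<Gamma>. contour_integral \<gamma> (\<lambda>z. F z / (z - w))) = F w" if w: "w \<in> sphere 1 1" for w
  proof -
    have "(\<Sum>\<gamma>\<leftarrow>\<Gamma>. contour_integral \<gamma> (\<lambda>z. F z / (z - w))) = 2 * of_real pi * \<i> * (\<Sum>\<gamma>\<leftarrow>\<Gamma>. winding_number \<gamma> w) * F w"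
    proof (rule Cauchy_integral_formula_cycle[OF U(1) F])
      show "valid_path \<gamma> \<and> pathfinish \<gamma> = pathstart \<gamma> \<and> path_image \<gamma> \<subseteq> U" "w \<notin> path_image \<gamma>"
        if "\<gamma> \<in> set \<Gamma>" for \<gamma>
        using \<Gamma>[OF that] w by blast+
    qed (use zero w U(2) in auto)
    then show ?thesis
      by (simp add: one[OF w] c_def)
  qed
  have cauchy0: "c * (\<Sum>\<gamma>\<leftarrow>\<Gamma>. contour_integral \<gamma> (\<lambda>z. F z / z)) = F 0"
    using cauchy[of 0] by simp
  note R = resolvent_integral_cesaro_plus[OF U(1) F \<Gamma>(1,3), folded k_def]
  have sums: "borel_kernel (\<lambda>u. \<Sum>\<gamma>\<leftarrow>\<Delta>. k \<gamma> u) \<and>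
      (\<Sum>\<gamma>\<leftarrow>\<Delta>. resolvent_integral F cesaro_plus \<gamma>)
        = scalar_op (\<Sum>\<gamma>\<leftarrow>\<Delta>. contour_integral \<gamma> (\<lambda>z. F z / z)) + hausdorff_op_plus (\<lambda>u. \<Sum>\<gamma>\<leftarrow>\<Delta>. k \<gamma> u) \<and>
      (\<forall>s. Re s = 1 / 2 \<longrightarrow> mellin (\<lambda>u. \<Sum>\<gamma>\<leftarrow>\<Delta>. k \<gamma> u) s
        = (\<Sum>\<gamma>\<leftarrow>\<Delta>. contour_integral \<gamma> (\<lambda>z. F z / (z - inverse s))) - (\<Sum>\<gamma>\<leftarrow>\<Delta>. contour_integral \<gamma> (\<lambda>z. F z / z)))"
    if "set \<Delta> \<subseteq> set \<Gamma>" for \<Delta>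
    using that
  proof (induction \<Delta>)
    case Nil
    have z: "borel_kernel (\<lambda>u. 0)"
      by (simp add: borel_kernel_def)
    have "scalar_op 0 = (0 :: l2_plus \<Rightarrow>\<^sub>L l2_plus)"
      by (rule linear_0[OF bounded_linear.linear[OF bounded_linear_scalar_op]])
    moreover have "hausdorff_op_plus (\<lambda>u. 0) = 0"
      using kernel_functional_diff[OF kernel_functional_hausdorff_op_plus z z] by simp
    ultimately show ?case
      using z mellin_scale[of 0 "\<lambda>u. 0"] by simp
  next
    case (Cons \<gamma> \<Delta>)
    then have \<gamma>: "\<gamma> \<in> set \<Gamma>" and IH: "borel_kernel (\<lambda>u. \<Sum>\<gamma>\<leftarrow>\<Delta>. k \<gamma> u)"
      "(\<Sum>\<gamma>\<leftarrow>\<Delta>. resolvent_integral F cesaro_plus \<gamma>)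
        = scalar_op (\<Sum>\<gamma>\<leftarrow>\<Delta>. contour_integral \<gamma> (\<lambda>z. F z / z)) + hausdorff_op_plus (\<lambda>u. \<Sum>\<gamma>\<leftarrow>\<Delta>. k \<gamma> u)"
      "\<And>s. Re s = 1 / 2 \<Longrightarrow> mellin (\<lambda>u. \<Sum>\<gamma>\<leftarrow>\<Delta>. k \<gamma> u) s
        = (\<Sum>\<gamma>\<leftarrow>\<Delta>. contour_integral \<gamma> (\<lambda>z. F z / (z - inverse s))) - (\<Sum>\<gamma>\<leftarrow>\<Delta>. contour_integral \<gamma> (\<lambda>z. F z / z))"
      by auto
    have mk: "mellin_kernel (k \<gamma>)" "mellin_kernel (\<lambda>u. \<Sum>\<gamma>\<leftarrow>\<Delta>. k \<gamma> u)"
      using R(1)[OF \<gamma> \<gamma>] IH(1) by (auto intro: borel_kernel_mellin_kernel)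
    show ?case
      using borel_kernel_add[OF R(1)[OF \<gamma> \<gamma>] IH(1)] IH(2,3) R(2,3)[OF \<gamma> \<gamma>] mellin_add[OF mk] hausdorff_op_plus_add[OF mk]
      by (simp add: scalar_op_add algebra_simps)
  qed
  define K where "K u = c * (\<Sum>\<gamma>\<leftarrow>\<Gamma>. k \<gamma> u)" for u
  note S = sums[OF order_refl]
  have S1: "borel_kernel (\<lambda>u. \<Sum>\<gamma>\<leftarrow>\<Gamma>. k \<gamma> u)"
    using S by blast
  show thesis
  proof
    show "borel_kernel K"
      unfolding K_def by (rule borel_kernel_scale[OF S1])
    have "holomorphic_calculus U F cesaro_plus = scalar_op c o\<^sub>L
        (scalar_op (\<Sum>\<gamma>\<leftarrow>\<Gamma>. contour_integral \<gamma> (\<lambda>z. F z / z)) + hausdorff_op_plus (\<lambda>u. \<Sum>\<gamma>\<leftarrow>\<Gamma>. k \<gamma> u))"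
      using S by (simp add: holomorphic_calculus_def \<Gamma>_def[symmetric] c_def[symmetric])
    also have "\<dots> = (scalar_op c o\<^sub>L scalar_op (\<Sum>\<gamma>\<leftarrow>\<Gamma>. contour_integral \<gamma> (\<lambda>z. F z / z)))
        + (scalar_op c o\<^sub>L hausdorff_op_plus (\<lambda>u. \<Sum>\<gamma>\<leftarrow>\<Gamma>. k \<gamma> u))"
      by (rule blinfun_eqI) (simp add: blinfun.add_left blinfun.add_right)
    also have "\<dots> = scalar_op (F 0) + hausdorff_op_plus K"
      unfolding K_def[abs_def] hausdorff_op_plus_scale[OF borel_kernel_mellin_kernel[OF S1]]
      by (simp add: scalar_op_compose cauchy0)
    finally show "holomorphic_calculus U F cesaro_plus = scalar_op (F 0) + hausdorff_op_plus K" .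
    show "mellin K s = F (inverse s) - F 0" if s: "Re s = 1 / 2" for s
    proof -
      have "mellin K s = c * ((\<Sum>\<gamma>\<leftarrow>\<Gamma>. contour_integral \<gamma> (\<lambda>z. F z / (z - inverse s)))
          - (\<Sum>\<gamma>\<leftarrow>\<Gamma>. contour_integral \<gamma> (\<lambda>z. F z / z)))"
        unfolding K_def[abs_def] mellin_scale using S s by simp
      also have "\<dots> = F (inverse s) - F 0"
        using cauchy[of "inverse s"] cauchy0 inverse_on_circle[OF s] by (simp add: right_diff_distrib)
      finally show ?thesis .
    qed
  qed
qed

text \<open>
  Dividing by the weight recovers the measurability of \<open>K\<close> from that of the weighted kernel.
\<close>

lemma kernel_for_mellin_kernel:
  assumes "kernel_for F K"
  shows "mellin_kernel K"
proof -
  define g where "g u = indicator {0<..} u *\<^sub>R (K u * complex_of_real (u powr (- 1 / 2)))" for u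
  have g: "integrable lebesgue g" and neg: "AE u in lebesgue. u < 0 \<longrightarrow> K u = 0"
    using assms by (simp_all add: kernel_for_def set_integrable_def g_def[abs_def])
  have nonpos: "AE u in lebesgue. u \<le> 0 \<longrightarrow> K u = 0"
    using neg AE_lebesgue_nonzero by eventually_elim auto
  have eq: "AE u in lebesgue. g u * complex_of_real (u powr (1 / 2)) = K u"
    using nonpos
  proof eventually_elim
    case (elim u)
    have "u powr (- 1 / 2) * u powr (1 / 2) = 1" if "0 < u"
      using that by (simp flip: powr_add)
    then have "complex_of_real (u powr (- 1 / 2)) * complex_of_real (u powr (1 / 2)) = 1" if "0 < u"
      using that by (simp flip: of_real_mult)
    with elim show ?case
      by (cases "0 < u") (simp_all add: g_def mult.assoc)
  qed
  have "(\<lambda>u. g u * complex_of_real (u powr (1 / 2))) \<in> borel_measurable lebesgue"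
  proof -
    have [measurable]: "(\<lambda>u. complex_of_real (u powr (1 / 2))) \<in> borel_measurable lebesgue"
      by (rule measurable_completion) measurable
    show ?thesis
      by (intro borel_measurable_times borel_measurable_integrable[OF g]) measurable
  qed
  from borel_measurable_AE[OF this eq] have Km [measurable]: "K \<in> borel_measurable lebesgue" .
  have [measurable]: "(\<lambda>u::real. u powr (- 1 / 2)) \<in> borel_measurable lebesgue"
    by (rule measurable_completion) measurable
  have ae: "AE u in lebesgue. cmod (g u) = cmod (K u) * u powr (- 1 / 2)"
    using nonpos
  proof eventually_elim
    case (elim u)
    then show ?case
      by (cases "0 < u") (simp_all add: g_def norm_mult)
  qed
  have "integrable lebesgue (\<lambda>u. cmod (K u) * u powr (- 1 / 2))"
    by (rule integrable_cong_AE_imp[OF integrable_norm[OF g] _ ae]) measurable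
  then show ?thesis
    using Km nonpos by (simp add: mellin_kernel_def)
qed

theorem theorem15:
  fixes F :: "complex \<Rightarrow> complex" and U :: "complex set"
  assumes "open U" and "sphere 1 1 \<subseteq> U" and "F holomorphic_on U"
  shows "(F 0 = 0 \<longrightarrow>
            (\<exists>K. holomorphic_calculus U F cesaro_plus = hausdorff_op_plus K \<and> kernel_for F K)) \<and>
         (\<forall>K. kernel_for F K \<longrightarrow>
            F 0 = 0 \<and> hausdorff_op_plus K = holomorphic_calculus U F cesaro_plus)"
proof -
  obtain L where L: "borel_kernel L" and calc: "holomorphic_calculus U F cesaro_plus = scalar_op (F 0) + hausdorff_op_plus L"
    and mL: "\<And>s. Re s = 1 / 2 \<Longrightarrow> mellin L s = F (inverse s) - F 0"
    using holomorphic_calculus_cesaro_plus[OF assms] by blast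
  note Lk = borel_kernel_mellin_kernel[OF L]
  have calc0: "holomorphic_calculus U F cesaro_plus = hausdorff_op_plus L" if "F 0 = 0"
    using calc that by (simp add: linear_0[OF bounded_linear.linear[OF bounded_linear_scalar_op]])
  have "kernel_for F L" if "F 0 = 0"
    unfolding kernel_for_def
  proof (intro conjI allI impI)
    show "AE u in lebesgue. u < 0 \<longrightarrow> L u = 0"
      using L by (auto simp: borel_kernel_def)
    have Lm [measurable]: "L \<in> borel_measurable borel"
      using L by (simp add: borel_kernel_def)
    have m: "(\<lambda>u. indicator {0<..} u *\<^sub>R (L u * complex_of_real (u powr (- 1 / 2)))) \<in> borel_measurable lborel"
      by measurable
    have "integrable lborel (\<lambda>u. cmod (L u) * u powr (- 1 / 2))"
      using L by (simp add: borel_kernel_def)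
    then have "integrable lborel (\<lambda>u. indicator {0<..} u *\<^sub>R (L u * complex_of_real (u powr (- 1 / 2))))"
      by (rule Bochner_Integration.integrable_bound[OF _ m]) (auto simp: norm_mult indicator_def)
    then show "set_integrable lebesgue {0<..} (\<lambda>u. L u * complex_of_real (u powr (- 1 / 2)))"
      unfolding set_integrable_def by (simp only: integrable_completion[OF m])
    show "mellin L z = F (inverse z)" if "Re z = 1 / 2" for z
      using mL[OF that] \<open>F 0 = 0\<close> by simp
  qed
  moreover have "F 0 = 0 \<and> hausdorff_op_plus K = holomorphic_calculus U F cesaro_plus" if K: "kernel_for F K" for K
  proof -
    note Kk = kernel_for_mellin_kernel[OF K]
    define M where "M u = K u + (-1) * L u" for u
    have Mk: "mellin_kernel M"
      unfolding M_def[abs_def] by (rule mellin_kernel_add[OF Kk mellin_kernel_scale(1)[OF Lk]])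
    have "mellin M s = F 0" if s: "Re s = 1 / 2" for s
    proof -
      have "mellin M s = mellin K s + (-1) * mellin L s"
        unfolding M_def[abs_def] mellin_add[OF Kk mellin_kernel_scale(1)[OF Lk] s] mellin_scale ..
      then show ?thesis
        using K s by (simp add: kernel_for_def mL)
    qed
    from mellin_uniqueness[OF Mk this] have "F 0 = 0" and ae: "AE u in lebesgue. M u = 0"
      by auto
    from ae have "AE u in lebesgue. K u = L u"
      by eventually_elim (simp add: M_def)
    then have "hausdorff_op_plus K = hausdorff_op_plus L"
      by (rule hausdorff_op_plus_cong[OF Kk Lk])
    then show ?thesis
      using calc0 \<open>F 0 = 0\<close> by simp
  qed
  ultimately show ?thesis
    using calc0 by blast
qed

end
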